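(* Let $0<\alpha<\frac12$, let $\sigma_\alpha(n)=\sum_{d\mid n}d^{\alpha}$, and define $E_\alpha(x)$ by $$\sum_{n\le x}\sigma_\alpha(n)=\frac{x^{1+\alpha}}{1+\alpha}\zeta(1+\alpha)+x\,\zeta(1-\alpha)+E_\alpha(x).$$ Let $\varepsilon>0$ be arbitrarily small and let $N=N(x)$ satisfy $x^{\frac12+\alpha+\varepsilon}\ll N\ll x^{\frac{1}{2\alpha}-\varepsilon}$. Then $$E_\alpha(x)=\frac{x^{\frac14+\frac{\alpha}{2}}}{\sqrt2\,\pi}\sum_{m\le N}\sigma_\alpha(m)\,m^{-\frac34-\frac{\alpha}{2}}\cos\!\left(4\pi\sqrt{mx}-\frac{\pi}{4}\right)+O\!\left(x^{\frac14+\frac{\alpha}{2}}\right)$$ as $x\to\infty$.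
   Context: $\zeta$ denotes the Riemann zeta function; $A\ll B$ means $A=O(B)$. *)

theory Defs
  imports "HOL-Complex_Analysis.Complex_Analysis" "HOL-Library.Landau_Symbols"
begin

(* The Riemann zeta function: the analytic continuation to the plane minus {1}
   of the Dirichlet series.  The value 0 at the pole s = 1 is only a convention that
   makes the description determine a single total function. *)
definition zeta :: "complex \<Rightarrow> complex" where
  "zeta = (THE f. f holomorphic_on (- {1}) \<and>
                  (\<forall>s. 1 < Re s \<longrightarrow> (\<lambda>n. of_nat (Suc n) powr (- s)) sums f s) \<and>
                  f 1 = 0)"

definition divisor_sigma :: "real \<Rightarrow> nat \<Rightarrow> real" where
  "divisor_sigma \<alpha> n = (\<Sum>d | d dvd n. real d powr \<alpha>)"

(* zeta is real on the real axis away from 1, so Re only changes the type here. *)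
definition sigma_error :: "real \<Rightarrow> real \<Rightarrow> real" where
  "sigma_error \<alpha> x =
     (\<Sum>n | 0 < n \<and> real n \<le> x. divisor_sigma \<alpha> n)
     - (x powr (1 + \<alpha>) / (1 + \<alpha>) * Re (zeta (complex_of_real (1 + \<alpha>)))
        + x * Re (zeta (complex_of_real (1 - \<alpha>))))"

end

(*
  Put N = M + 1/2 and let D be of size x + sqrt(N x).  Up to main terms, the divisor sum is a
  sum over d <= D of d^alpha times the sawtooth function at x/d.  Replace the sawtooth by its
  Fourier sum truncated at h <= d sqrt(N/x); letting the length grow with d keeps the total error
  at D^alpha and x^alpha sqrt(x/N) up to logarithms and divisor counts, and these are admissible
  by the upper and the lower bound on N respectively.  After interchanging the sums, the d-sum for
  a given h runs from h sqrt(x/N) to D.  Poisson summation turns it into integrals of u^alpha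
  against the phase h x/u + k u, whose saddle point sqrt(h x/k) lies in the range exactly when
  h k <= N.  So the saddle points contribute precisely the terms m = h k of the Voronoi sum up to
  N, and as N is half an odd integer none of them meets the end point.  The integrals with k = 0
  complete the two zeta main terms.
*)
theory Submission
  imports Defs "HOL-Probability.Distributions" "HOL-Real_Asymp.Real_Asymp"
begin

section \<open>The truncated sawtooth and Euler--Maclaurin summation\<close>

text \<open>The exponents leave room. With \<open>D\<close> of size \<open>x + sqrt (N x)\<close>,
  the upper bound on \<open>N\<close> makes \<open>(N x) powr (\<alpha> / 2)\<close> of order
  \<open>x powr (1/4 + \<alpha>/2 - \<alpha> \<epsilon> / 2)\<close>, and the lower bound makes
  \<open>x powr \<alpha> * sqrt (x / N)\<close> of order
  \<open>x powr (1/4 + \<alpha>/2 - \<epsilon> / 2)\<close>. These spare powers pay for all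
  logarithms and divisor counts, so nothing has to be sharp in them. The Poisson sum is cut at a
  finite frequency \<open>K\<close> by means of a Dirichlet kernel; \<open>K\<close> enters the
  final bound only through a logarithm and may be a large power of \<open>x\<close>, so crude bounds
  for this cut suffice. The delicate spots are saddles close to the lower end
  \<open>h sqrt (x / N)\<close> and quotients \<open>x / d\<close> close to an integer. Both losses
  become sums of \<open>1 / |N - m|\<close> or \<open>1 / |x - n|\<close> over integers, weighted by
  numbers of divisors. The upper end is harmless because \<open>D\<close> exceeds every saddle by a
  fixed factor. All estimates are explicit inequalities for fixed \<open>x\<close>, \<open>M\<close>
  and \<open>D\<close>; asymptotics appear only at the very end.\<close>

lemma second_mean_value_bound:
  fixes g f F :: "real \<Rightarrow> real"
  assumes "a \<le> b"
    and mono: "\<And>x y. \<lbrakk>a \<le> x; x \<le> y; y \<le> b\<rbrakk> \<Longrightarrow> g x \<le> g y"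
    and deriv: "\<And>x. x \<in> {a..b} \<Longrightarrow> (F has_vector_derivative f x) (at x within {a..b})"
    and bound: "\<And>x. x \<in> {a..b} \<Longrightarrow> \<bar>F x\<bar> \<le> M"
  shows "(\<lambda>x. g x * f x) integrable_on {a..b}"
    and "\<bar>integral {a..b} (\<lambda>x. g x * f x)\<bar> \<le> 2 * M * (\<bar>g a\<bar> + \<bar>g b\<bar>)"
proof -
  have I: "(f has_integral (F d - F c)) {c..d}" if "a \<le> c" "c \<le> d" "d \<le> b" for c d
    using that by (intro fundamental_theorem_of_calculus)
      (auto intro: has_vector_derivative_within_subset[OF deriv])
  have "f integrable_on {a..b}"
    using I[of a b] assms(1) by auto
  \<comment> \<open>Monotonicity is all that is asked of \<open>g\<close>: the intermediate point
    \<open>c\<close> splits the integral into two increments of \<open>F\<close>, weighted by the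
    end values of \<open>g\<close>.\<close>
  from second_mean_value_theorem_full[where g = g, OF this \<open>a \<le> b\<close> mono]
  obtain c where c: "c \<in> {a..b}"
    "((\<lambda>x. g x * f x) has_integral (g a * integral {a..c} f + g b * integral {c..b} f)) {a..b}"
    by blast
  show "(\<lambda>x. g x * f x) integrable_on {a..b}"
    using c(2) by blast
  have "integral {a..b} (\<lambda>x. g x * f x) = g a * (F c - F a) + g b * (F b - F c)"
    using c I[of a c] I[of c b] by (auto simp: integral_unique)
  also have "\<bar>\<dots>\<bar> \<le> \<bar>g a\<bar> * \<bar>F c - F a\<bar> + \<bar>g b\<bar> * \<bar>F b - F c\<bar>"
    by (rule order_trans[OF abs_triangle_ineq]) (simp add: abs_mult)
  also have "\<dots> \<le> \<bar>g a\<bar> * (2 * M) + \<bar>g b\<bar> * (2 * M)"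
    using bound[of a] bound[of b] bound[of c] c(1) assms(1)
    by (intro add_mono mult_left_mono) auto
  finally show "\<bar>integral {a..b} (\<lambda>x. g x * f x)\<bar> \<le> 2 * M * (\<bar>g a\<bar> + \<bar>g b\<bar>)"
    by (simp add: algebra_simps)
qed

text \<open>The mean value theorem is a statement about real functions, so real and imaginary parts
  are treated separately, which doubles the constant.\<close>

lemma monotone_oscillation_bound:
  fixes g :: "real \<Rightarrow> real" and f F :: "real \<Rightarrow> complex"
  assumes "a \<le> b"
    and mono: "\<And>x y. \<lbrakk>a \<le> x; x \<le> y; y \<le> b\<rbrakk> \<Longrightarrow> g x \<le> g y"
    and deriv: "\<And>x. x \<in> {a..b} \<Longrightarrow> (F has_vector_derivative f x) (at x within {a..b})"
    and bound: "\<And>x. x \<in> {a..b} \<Longrightarrow> norm (F x) \<le> M"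
  shows "(\<lambda>x. of_real (g x) * f x) integrable_on {a..b}"
    and "norm (integral {a..b} (\<lambda>x. of_real (g x) * f x)) \<le> 4 * M * (\<bar>g a\<bar> + \<bar>g b\<bar>)"
proof -
  have dRe: "((\<lambda>x. Re (F x)) has_vector_derivative Re (f x)) (at x within {a..b})"
    and dIm: "((\<lambda>x. Im (F x)) has_vector_derivative Im (f x)) (at x within {a..b})"
    if "x \<in> {a..b}" for x
    using deriv[OF that] by (simp_all add: has_vector_derivative_complex_iff has_real_derivative_iff_has_vector_derivative)
  have bRe: "\<bar>Re (F x)\<bar> \<le> M" and bIm: "\<bar>Im (F x)\<bar> \<le> M" if "x \<in> {a..b}" for x
    using bound[OF that] abs_Re_le_cmod[of "F x"] abs_Im_le_cmod[of "F x"] by linarith+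
  let ?R = "integral {a..b} (\<lambda>x. g x * Re (f x))" and ?J = "integral {a..b} (\<lambda>x. g x * Im (f x))"
  have R1: "(\<lambda>x. g x * Re (f x)) integrable_on {a..b}" and J1: "(\<lambda>x. g x * Im (f x)) integrable_on {a..b}"
    by (rule second_mean_value_bound(1)[OF \<open>a \<le> b\<close> _ dRe bRe] second_mean_value_bound(1)[OF \<open>a \<le> b\<close> _ dIm bIm];
        simp add: mono)+
  have "((\<lambda>x. of_real (g x * Re (f x)) + \<i> * of_real (g x * Im (f x))) has_integral
      (of_real ?R + \<i> * of_real ?J)) {a..b}"
    using R1 J1 by (intro has_integral_add has_integral_mult_right has_integral_of_real) auto
  moreover have "(\<lambda>x. of_real (g x * Re (f x)) + \<i> * of_real (g x * Im (f x))) = (\<lambda>x. of_real (g x) * f x)"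
    by (auto simp: complex_eq_iff)
  moreover have "of_real ?R + \<i> * of_real ?J = Complex ?R ?J"
    by (simp add: complex_eq_iff)
  ultimately have I: "((\<lambda>x. of_real (g x) * f x) has_integral Complex ?R ?J) {a..b}"
    by simp
  then show "(\<lambda>x. of_real (g x) * f x) integrable_on {a..b}"
    by blast
  have "\<bar>?R\<bar> \<le> 2 * M * (\<bar>g a\<bar> + \<bar>g b\<bar>)" "\<bar>?J\<bar> \<le> 2 * M * (\<bar>g a\<bar> + \<bar>g b\<bar>)"
    by (rule second_mean_value_bound(2)[OF \<open>a \<le> b\<close> _ dRe bRe] second_mean_value_bound(2)[OF \<open>a \<le> b\<close> _ dIm bIm];
        simp add: mono)+
  with cmod_le[of "Complex ?R ?J"] I
  show "norm (integral {a..b} (\<lambda>x. of_real (g x) * f x)) \<le> 4 * M * (\<bar>g a\<bar> + \<bar>g b\<bar>)"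
    by (simp add: integral_unique)
qed

section \<open>Fourier truncation of the sawtooth function\<close>

definition dirichlet_kernel :: "nat \<Rightarrow> real \<Rightarrow> real" where
  "dirichlet_kernel K u = 1 + 2 * (\<Sum>k=1..K. cos (2 * pi * real k * u))"

text \<open>On the open unit interval this is the sawtooth minus its \<open>K\<close>-th Fourier
  partial sum. It is not made periodic: as a smooth function of \<open>y\<close> it is a primitive
  of \<open>dirichlet_kernel K\<close>, and the jump of the sawtooth becomes the difference of its
  values at 0 and 1.\<close>

definition saw_rem :: "nat \<Rightarrow> real \<Rightarrow> real" where
  "saw_rem K y = y - 1 / 2 + (\<Sum>k=1..K. sin (2 * pi * real k * y) / (pi * real k))"

lemma saw_rem_half: "saw_rem K (1 / 2) = 0"
proof -
  have "sin (pi * real k) = 0" for k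
    using sin_npi[of k] by (simp add: mult.commute)
  then show ?thesis by (simp add: saw_rem_def)
qed

lemma saw_rem_deriv: "(saw_rem K has_real_derivative dirichlet_kernel K y) (at y within A)"
  unfolding saw_rem_def dirichlet_kernel_def
  by (auto intro!: derivative_eq_intros sum.cong simp: sum_distrib_left)

text \<open>Multiplied out, the usual quotient formula for the kernel also holds at the zeros of the
  sine. In the induction step the product-to-sum formula makes consecutive terms cancel.\<close>

lemma sin_mult_dirichlet_kernel: "sin (pi * u) * dirichlet_kernel K u = sin ((2 * real K + 1) * pi * u)"
proof (induction K)
  case (Suc K)
  have "sin (pi * u) * dirichlet_kernel (Suc K) u =
    sin (pi * u) * dirichlet_kernel K u + 2 * sin (pi * u) * cos (2 * pi * real (Suc K) * u)"
    by (simp add: dirichlet_kernel_def algebra_simps)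
  also have "2 * sin (pi * u) * cos (2 * pi * real (Suc K) * u) =
    sin (pi * u + 2 * pi * real (Suc K) * u) + sin (pi * u - 2 * pi * real (Suc K) * u)"
    by (simp add: sin_add sin_diff)
  also have "sin (pi * u - 2 * pi * real (Suc K) * u) = - sin ((2 * real K + 1) * pi * u)"
    by (subst sin_minus [symmetric]) (simp add: algebra_simps)
  also have "pi * u + 2 * pi * real (Suc K) * u = (2 * real (Suc K) + 1) * pi * u"
    by (simp add: algebra_simps)
  finally show ?case
    by (simp add: Suc.IH)
qed (simp add: dirichlet_kernel_def)

lemma saw_rem_reflect: "saw_rem K (1 - y) = - saw_rem K y"
proof -
  have "sin (2 * pi * real k * (1 - y)) = - sin (2 * pi * real k * y)" for k
  proof -
    have "sin (2 * pi * real k * (1 - y)) = sin (- (2 * pi * real k * y) + 2 * real k * pi)"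
      by (simp add: algebra_simps)
    also have "\<dots> = sin (- (2 * pi * real k * y))"
      using sin.plus_of_nat[of "- (2 * pi * real k * y)" k] by (simp add: algebra_simps)
    finally show ?thesis by simp
  qed
  then show ?thesis by (simp add: saw_rem_def sum_negf)
qed

lemma sin_ge_half: "x / 2 \<le> sin x" if "0 \<le> x" "x \<le> pi / 2" for x :: real
proof (cases "x \<le> pi / 3")
  case True
  have "(\<lambda>t. sin t - t / 2) 0 \<le> (\<lambda>t. sin t - t / 2) x"
  proof (rule DERIV_nonneg_imp_nondecreasing[OF that(1)])
    fix t assume t: "0 \<le> t" "t \<le> x"
    have "cos (pi / 3) \<le> cos t" using t True pi_gt_zero by (intro cos_monotone_0_pi_le) auto
    then show "\<exists>y. ((\<lambda>t. sin t - t / 2) has_real_derivative y) (at t) \<and> 0 \<le> y"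
      by (intro exI[of _ "cos t - 1 / 2"] conjI) (auto intro!: derivative_eq_intros simp: cos_60)
  qed
  then show ?thesis by simp
next
  case False
  have "sin (pi / 3) \<le> sin x" using that False pi_gt_zero by (intro sin_monotone_2pi_le) auto
  moreover have "sqrt 3 \<ge> 1.7" by (rule real_le_rsqrt) (simp add: power2_eq_square)
  moreover have "x / 2 \<le> 0.8" using that pi_less_4 pi_approx by simp
  ultimately show ?thesis by (simp add: sin_60)
qed

text \<open>The remainder vanishes at 1/2, so its value at \<open>y\<close> is minus the integral of
  the kernel from \<open>y\<close> to 1/2. There the kernel is the monotone factor
  \<open>1 / sin (pi v)\<close> times a sine of frequency proportional to \<open>2 K + 1\<close>,
  and the second mean value theorem gains that frequency.\<close>

lemma saw_rem_decay_aux: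
  assumes "0 < y" "y \<le> 1 / 2"
  shows "\<bar>saw_rem K y\<bar> \<le> 1 / ((2 * real K + 1) * y)"
proof -
  define L where "L = 2 * real K + 1"
  have L: "L > 0" by (simp add: L_def)
  \<comment> \<open>Both factors are negated to make the monotone one nondecreasing; the product is
    still the kernel.\<close>
  define g where "g = (\<lambda>v. - 1 / sin (pi * v))"
  define f where "f = (\<lambda>v. - sin (L * pi * v))"
  define F where "F = (\<lambda>v. cos (L * pi * v) / (L * pi))"
  have s_pos: "0 < sin (pi * v)" if "y \<le> v" "v \<le> 1 / 2" for v
    using that assms by (intro sin_gt_zero) (auto simp: field_simps)
  have mono: "g v \<le> g w" if "y \<le> v" "v \<le> w" "w \<le> 1 / 2" for v w
  proof -
    have "sin (pi * v) \<le> sin (pi * w)"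
    proof (rule sin_monotone_2pi_le)
      have "0 \<le> pi * v" using that assms by simp
      then show "- (pi / 2) \<le> pi * v" using pi_gt_zero by linarith
    qed (use that in \<open>auto simp: field_simps\<close>)
    with s_pos[of v] s_pos[of w] that show ?thesis
      by (auto simp: g_def intro!: divide_left_mono)
  qed
  have deriv: "(F has_vector_derivative f v) (at v within {y..1/2})" for v
    unfolding F_def f_def using L
    by (auto intro!: derivative_eq_intros simp flip: has_real_derivative_iff_has_vector_derivative)
  have bound: "\<bar>F v\<bar> \<le> 1 / (L * pi)" for v
    using L by (auto simp: F_def abs_mult divide_simps)
  have "((\<lambda>v. g v * f v) has_integral (saw_rem K (1/2) - saw_rem K y)) {y..1/2}"
  proof (rule fundamental_theorem_of_calculus)
    fix v assume v: "v \<in> {y..1/2}"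
    have "g v * f v = dirichlet_kernel K v"
      using s_pos[of v] v sin_mult_dirichlet_kernel[of v K] by (auto simp: g_def f_def L_def field_simps)
    then show "(saw_rem K has_vector_derivative g v * f v) (at v within {y..1/2})"
      using saw_rem_deriv by (simp add: has_real_derivative_iff_has_vector_derivative)
  qed (use assms in auto)
  then have "\<bar>saw_rem K y\<bar> = \<bar>integral {y..1/2} (\<lambda>v. g v * f v)\<bar>"
    by (simp add: saw_rem_half integral_unique)
  also have "\<dots> \<le> 2 * (1 / (L * pi)) * (\<bar>g y\<bar> + \<bar>g (1/2)\<bar>)"
    by (rule second_mean_value_bound(2)[OF _ mono deriv bound]) (use assms in auto)
  also have "\<dots> \<le> 2 * (1 / (L * pi)) * (2 * (2 / (pi * y)))"
  proof -
    have "pi * y / 2 \<le> sin (pi * y)"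
      using assms by (intro sin_ge_half) (auto simp: field_simps)
    moreover have "0 < pi * y / 2" using assms by simp
    ultimately have "1 / sin (pi * y) \<le> 1 / (pi * y / 2)"
      by (intro divide_left_mono) auto
    moreover have "\<bar>g y\<bar> = 1 / sin (pi * y)"
      using s_pos[of y] assms by (simp add: g_def)
    moreover have "\<bar>g (1/2)\<bar> \<le> \<bar>g y\<bar>"
      using mono[of y "1/2"] s_pos[of y] assms by (simp add: g_def)
    ultimately have "\<bar>g y\<bar> + \<bar>g (1/2)\<bar> \<le> 2 * (2 / (pi * y))" by simp
    then show ?thesis
      using L by (intro mult_left_mono) auto
  qed
  also have "\<dots> = (8 / pi\<^sup>2) * (1 / (L * y))"
    by (simp add: power2_eq_square)
  also have "\<dots> \<le> 1 * (1 / (L * y))"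
  proof -
    have "3 * 3 \<le> pi * pi" using pi_gt3 by (intro mult_mono) auto
    then have "8 / pi\<^sup>2 \<le> 1" by (simp add: power2_eq_square)
    then show ?thesis using L assms by (intro mult_right_mono) auto
  qed
  finally show ?thesis by (simp add: L_def)
qed

lemma saw_rem_decay:
  assumes "0 < y" "y < 1"
  shows "\<bar>saw_rem K y\<bar> \<le> 1 / ((2 * real K + 1) * min y (1 - y))"
  using saw_rem_decay_aux[of y K] saw_rem_decay_aux[of "1 - y" K] assms saw_rem_reflect[of K y]
  by (cases "y \<le> 1 / 2") (auto simp: min_def)

text \<open>As long as \<open>(2 K + 1) y <= 1\<close>, each sine is at most its argument and the
  sum stays at most 1; for larger \<open>y\<close> the decay bound is already at most 1.\<close>

lemma saw_rem_bounded:
  assumes "0 \<le> y" "y \<le> 1"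
  shows "\<bar>saw_rem K y\<bar> \<le> 2"
proof -
  have *: "\<bar>saw_rem K y\<bar> \<le> 2" if "0 \<le> y" "y \<le> 1 / 2" for y
  proof (cases "(2 * real K + 1) * y \<le> 1")
    case True
    have "\<bar>\<Sum>k=1..K. sin (2 * pi * real k * y) / (pi * real k)\<bar> \<le> (\<Sum>k=1..K. 2 * y)"
    proof (rule order_trans[OF sum_abs], rule sum_mono)
      fix k assume "k \<in> {1..K}"
      then have "k > 0" by simp
      have "\<bar>sin (2 * pi * real k * y)\<bar> \<le> 2 * pi * real k * y"
        using abs_sin_x_le_abs_x[of "2 * pi * real k * y"] that by simp
      with \<open>k > 0\<close> show "\<bar>sin (2 * pi * real k * y) / (pi * real k)\<bar> \<le> 2 * y"
        by (simp add: field_simps abs_mult)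
    qed
    also have "\<dots> \<le> 1" using True that by (simp add: algebra_simps)
    finally have "\<bar>\<Sum>k=1..K. sin (2 * pi * real k * y) / (pi * real k)\<bar> \<le> 1" .
    with that show ?thesis unfolding saw_rem_def by linarith
  next
    case False
    then have "y > 0" using that by (cases "y = 0") auto
    then have "\<bar>saw_rem K y\<bar> \<le> 1 / ((2 * real K + 1) * y)"
      using that by (intro saw_rem_decay_aux) auto
    also have "\<dots> \<le> 1" using False by simp
    finally show ?thesis by simp
  qed
  show ?thesis
    using *[of y] *[of "1 - y"] assms saw_rem_reflect[of K y] by (cases "y \<le> 1 / 2") auto
qed

lemma saw_rem_continuous_on: "continuous_on A (saw_rem K)"
  unfolding saw_rem_def by (intro continuous_intros) auto

text \<open>The geometric mean of the uniform bound and the decay bound is of order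
  \<open>1 / sqrt (L r)\<close>, where \<open>L = 2 K + 1\<close> and \<open>r\<close> is the
  distance to the nearer end; this is integrable. A logarithm over \<open>L\<close> would be the
  better order, but \<open>K\<close> is free and can be taken large.\<close>

lemma saw_rem_integral_le:
  "integral {0..1} (\<lambda>u. \<bar>saw_rem K u\<bar>) \<le> 6 / sqrt (2 * real K + 1)"
proof -
  define L where "L = 2 * real K + 1"
  have L: "L > 0" by (simp add: L_def)
  define c where "c = sqrt (2 / L)"
  have c: "c > 0" using L by (simp add: c_def)
  define H where "H = (\<lambda>u. c * (2 * sqrt u - 2 * sqrt (1 - u)))"
  define h where "h = (\<lambda>u::real. c * (1 / sqrt u + 1 / sqrt (1 - u)))"
  have Hh: "(h has_integral (H 1 - H 0)) {0..1}"
  proof (rule fundamental_theorem_of_calculus_interior)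
    show "continuous_on {0..1} H" unfolding H_def by (intro continuous_intros)
    fix u :: real assume "u \<in> {0<..<1}"
    then show "(H has_vector_derivative h u) (at u)"
      unfolding H_def h_def has_real_derivative_iff_has_vector_derivative[symmetric]
      by (auto intro!: derivative_eq_intros simp: field_simps)
  qed auto
  \<comment> \<open>At 0 and 1 division by zero yields 0, so \<open>h\<close> need not dominate
    there; these two values are replaced by the uniform bound.\<close>
  define h' where "h' = (\<lambda>u::real. if u \<in> {0, 1} then 2 else h u)"
  have h': "(h' has_integral (H 1 - H 0)) {0..1}"
    by (rule has_integral_spike_finite[OF _ _ Hh, of "{0,1}"]) (auto simp: h'_def)
  have "integral {0..1} (\<lambda>u. \<bar>saw_rem K u\<bar>) \<le> integral {0..1} h'"
  proof (rule integral_le)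
    show "(\<lambda>u. \<bar>saw_rem K u\<bar>) integrable_on {0..1}"
      by (intro integrable_continuous_real continuous_intros saw_rem_continuous_on)
    show "h' integrable_on {0..1}" using h' by blast
    fix u :: real assume u: "u \<in> {0..1}"
    show "\<bar>saw_rem K u\<bar> \<le> h' u"
    proof (cases "u \<in> {0, 1}")
      case True then show ?thesis using saw_rem_bounded[of u K] by (auto simp: h'_def)
    next
      case False
      define r where "r = min u (1 - u)"
      have r: "r > 0" "r \<le> u" "r \<le> 1 - u" using u False by (auto simp: r_def)
      have "\<bar>saw_rem K u\<bar>\<^sup>2 = \<bar>saw_rem K u\<bar> * \<bar>saw_rem K u\<bar>" by (simp add: power2_eq_square)
      also have "\<dots> \<le> 2 * (1 / (L * r))"
        using saw_rem_bounded[of u K] saw_rem_decay[of u K] u False r L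
        by (intro mult_mono) (auto simp: L_def r_def)
      finally have "\<bar>saw_rem K u\<bar> \<le> sqrt (2 / (L * r))"
        by (intro real_le_rsqrt) simp
      also have "\<dots> = c * (1 / sqrt r)" by (simp add: c_def real_sqrt_divide real_sqrt_mult)
      also have "1 / sqrt r \<le> 1 / sqrt u + 1 / sqrt (1 - u)"
        using r by (cases "u \<le> 1 - u") (auto simp: r_def min_def)
      finally show ?thesis using False c by (simp add: h'_def h_def)
    qed
  qed
  also have "\<dots> = 4 * c" using h' by (simp add: integral_unique H_def)
  also have "\<dots> \<le> 6 / sqrt L"
  proof -
    have "sqrt 2 \<le> 3 / 2" by (rule real_le_lsqrt) (auto simp: power2_eq_square)
    then show ?thesis using L by (simp add: c_def real_sqrt_divide field_simps)
  qed
  finally show ?thesis by (simp add: L_def)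
qed

section \<open>Euler-Maclaurin summation with a Dirichlet kernel\<close>

lemma dirichlet_kernel_shift: "dirichlet_kernel K (u - real n) = dirichlet_kernel K u"
proof -
  have "cos (2 * pi * real k * (u - real n)) = cos (2 * pi * real k * u)" for k
    using cos.minus_of_nat[of "2 * pi * real k * u" "k * n"] by (simp add: algebra_simps)
  then show ?thesis by (simp add: dirichlet_kernel_def)
qed

lemma dirichlet_kernel_continuous_on: "continuous_on A (dirichlet_kernel K)"
  unfolding dirichlet_kernel_def by (intro continuous_intros)

text \<open>Integration by parts inside one unit cell: the shifted remainder is a primitive of the
  periodic kernel, and what is left is \<open>F'\<close> against that remainder, controlled by the
  integral of its modulus over a period.\<close>

lemma dirichlet_kernel_unit_integral:
  fixes F F' :: "real \<Rightarrow> complex"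
  assumes vw: "real n \<le> v" "v \<le> w" "w \<le> real n + 1"
    and deriv: "\<And>u. u \<in> {v..w} \<Longrightarrow> (F has_vector_derivative F' u) (at u within {v..w})"
    and cont: "continuous_on {v..w} F'"
    and bound: "\<And>u. u \<in> {v..w} \<Longrightarrow> norm (F' u) \<le> B"
  shows "norm (saw_rem K (w - n) *\<^sub>R F w - saw_rem K (v - n) *\<^sub>R F v
            - integral {v..w} (\<lambda>u. dirichlet_kernel K u *\<^sub>R F u)) \<le> B * (6 / sqrt (2 * real K + 1))"
proof -
  have B: "B \<ge> 0" using bound[of v] vw norm_ge_zero[of "F' v"] by (auto simp del: norm_ge_zero)
  define R where "R = (\<lambda>u::real. saw_rem K (u - real n))"
  have R_deriv: "(R has_real_derivative dirichlet_kernel K u) (at u within A)" for u A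
  proof -
    have "((\<lambda>u. saw_rem K (u - real n)) has_real_derivative dirichlet_kernel K (u - n) * 1) (at u within A)"
      by (rule DERIV_chain'[OF _ saw_rem_deriv]) (auto intro!: derivative_eq_intros)
    then show ?thesis
      by (simp add: R_def dirichlet_kernel_shift)
  qed
  have R_cont: "continuous_on A R" for A
    unfolding R_def by (rule continuous_on_compose2[OF saw_rem_continuous_on[of UNIV]]) (auto intro!: continuous_intros)
  have F_cont: "continuous_on {v..w} F"
    using deriv by (meson continuous_on_vector_derivative)
  have "((\<lambda>u. R u *\<^sub>R F' u + dirichlet_kernel K u *\<^sub>R F u) has_integral (R w *\<^sub>R F w - R v *\<^sub>R F v)) {v..w}"
    by (rule fundamental_theorem_of_calculus)
      (use vw in \<open>auto intro!: has_vector_derivative_scaleR R_deriv deriv\<close>)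
  moreover have I1: "(\<lambda>u. R u *\<^sub>R F' u) integrable_on {v..w}"
    by (intro integrable_continuous_real continuous_intros R_cont cont)
  moreover have I2: "(\<lambda>u. dirichlet_kernel K u *\<^sub>R F u) integrable_on {v..w}"
    by (intro integrable_continuous_real continuous_intros dirichlet_kernel_continuous_on F_cont)
  ultimately have "R w *\<^sub>R F w - R v *\<^sub>R F v =
      integral {v..w} (\<lambda>u. R u *\<^sub>R F' u) + integral {v..w} (\<lambda>u. dirichlet_kernel K u *\<^sub>R F u)"
    by (simp add: has_integral_iff integral_add)
  then have eq: "R w *\<^sub>R F w - R v *\<^sub>R F v - integral {v..w} (\<lambda>u. dirichlet_kernel K u *\<^sub>R F u)
      = integral {v..w} (\<lambda>u. R u *\<^sub>R F' u)"
    by simp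
  have "norm (integral {v..w} (\<lambda>u. R u *\<^sub>R F' u)) \<le> integral {v..w} (\<lambda>u. B * \<bar>R u\<bar>)"
  proof (rule integral_norm_bound_integral[OF I1])
    show "(\<lambda>u. B * \<bar>R u\<bar>) integrable_on {v..w}"
      by (intro integrable_continuous_real continuous_intros R_cont)
    show "norm (R u *\<^sub>R F' u) \<le> B * \<bar>R u\<bar>" if "u \<in> {v..w}" for u
      using mult_left_mono[OF bound[OF that] abs_ge_zero[of "R u"]] by (simp add: mult.commute)
  qed
  also have "\<dots> \<le> integral {real n..real n + 1} (\<lambda>u. B * \<bar>R u\<bar>)"
    using vw B by (intro integral_subset_le integrable_continuous_real continuous_intros R_cont) auto
  also have "\<dots> = B * integral {real n..real n + 1} (\<lambda>u. \<bar>R u\<bar>)" by simp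
  also have "integral {real n..real n + 1} (\<lambda>u. \<bar>R u\<bar>) = integral {0..1} (\<lambda>u. \<bar>saw_rem K u\<bar>)"
  proof -
    have "continuous_on {0 + real n..1 + real n} (\<lambda>u. \<bar>R u\<bar>)" by (intro continuous_intros R_cont)
    from integral_shift[OF this] show ?thesis by (simp add: R_def o_def add.commute)
  qed
  also have "B * \<dots> \<le> B * (6 / sqrt (2 * real K + 1))"
    using B by (intro mult_left_mono saw_rem_integral_le)
  finally show ?thesis using eq by (simp add: R_def)
qed

text \<open>Half of the jump on each side: an integer inside the range receives weight 1/2 from the
  cell to its left and 1/2 from the cell to its right.\<close>

lemma saw_rem_0: "saw_rem K 0 = - 1 / 2" and saw_rem_1: "saw_rem K 1 = 1 / 2"
  using saw_rem_reflect[of K 0] by (simp_all add: saw_rem_def)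

text \<open>Adding the unit cells turns the boundary terms into the full sum, except for the half
  weight at \<open>D\<close> and the partial cell at \<open>a\<close>. As the kernel contains the
  frequencies up to \<open>K\<close>, this is Poisson summation with finitely many frequencies and
  an error that falls with \<open>K\<close>.\<close>

theorem euler_maclaurin_truncated:
  fixes F F' :: "real \<Rightarrow> complex"
  assumes a: "0 < a" "a \<le> real D"
    and deriv: "\<And>u. u \<in> {a..real D} \<Longrightarrow> (F has_vector_derivative F' u) (at u within {a..real D})"
    and cont: "continuous_on {a..real D} F'"
    and bound: "\<And>u. u \<in> {a..real D} \<Longrightarrow> norm (F' u) \<le> B"
  shows "norm ((\<Sum>d=nat \<lceil>a\<rceil>..D. F (real d)) - integral {a..real D} (\<lambda>u. dirichlet_kernel K u *\<^sub>R F u)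
            - (1 / 2) *\<^sub>R F (real D) - saw_rem K (a - \<lceil>a\<rceil> + 1) *\<^sub>R F a)
         \<le> real (D + 1) * (B * (6 / sqrt (2 * real K + 1)))"
proof -
  define n0 where "n0 = nat \<lceil>a\<rceil>"
  define E where "E = B * (6 / sqrt (2 * real K + 1))"
  have B: "B \<ge> 0" using bound[of a] a norm_ge_zero[of "F' a"] by (auto simp del: norm_ge_zero)
  then have E: "E \<ge> 0" by (simp add: E_def)
  have n0: "n0 \<ge> 1" "a \<le> real n0" "real n0 < a + 1" "real n0 = real_of_int \<lceil>a\<rceil>" "n0 \<le> D"
    using a by (auto simp: n0_def ceiling_le_iff) (linarith+)
  have F_cont: "continuous_on {a..real D} F"
    using deriv by (meson continuous_on_vector_derivative)
  let ?T = "\<lambda>m. (\<Sum>d=n0..m. F (real d)) - integral {a..real m} (\<lambda>u. dirichlet_kernel K u *\<^sub>R F u)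
            - (1 / 2) *\<^sub>R F (real m) - saw_rem K (a - \<lceil>a\<rceil> + 1) *\<^sub>R F a"
  have unit: "norm (saw_rem K (w - n) *\<^sub>R F w - saw_rem K (v - n) *\<^sub>R F v
            - integral {v..w} (\<lambda>u. dirichlet_kernel K u *\<^sub>R F u)) \<le> E"
    if "real n \<le> v" "v \<le> w" "w \<le> real n + 1" "a \<le> v" "w \<le> D" for n v w
    unfolding E_def
  proof (rule dirichlet_kernel_unit_integral[OF that(1-3)])
    show "(F has_vector_derivative F' u) (at u within {v..w})" if "u \<in> {v..w}" for u
      using that \<open>a \<le> v\<close> \<open>w \<le> D\<close> by (intro has_vector_derivative_within_subset[OF deriv]) auto
    show "continuous_on {v..w} F'"
      using \<open>a \<le> v\<close> \<open>w \<le> D\<close> by (intro continuous_on_subset[OF cont]) auto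
    show "norm (F' u) \<le> B" if "u \<in> {v..w}" for u
      using that \<open>a \<le> v\<close> \<open>w \<le> D\<close> by (intro bound) auto
  qed
  have "norm (?T m) \<le> real (m + 1) * E" if "n0 \<le> m" "m \<le> D" for m
    using that
  proof (induction m rule: dec_induct)
    case base
    have half: "z - (1 / 2) *\<^sub>R z - u - w = (1 / 2) *\<^sub>R z - w - u" for z u w :: complex
      by (simp add: scaleR_conv_of_real)
    have half': "z - u - (1 / 2) *\<^sub>R z - w = (1 / 2) *\<^sub>R z - w - u" for z u w :: complex
      by (simp add: scaleR_conv_of_real)
    note half = half half'
    \<comment> \<open>The first cell belongs to the unit interval starting at \<open>n0 - 1\<close>,
      in which \<open>a\<close> has an offset in (0, 1]. For integral \<open>a\<close> the offset is
      1 and the cell shrinks to a point.\<close>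
    have eq: "a - real (n0 - 1) = a - \<lceil>a\<rceil> + 1" "real n0 - real (n0 - 1) = 1"
      using n0 by (simp_all add: of_nat_diff)
    have "norm (?T n0) \<le> E"
      using unit[of "n0 - 1" a "real n0"] n0 unfolding eq saw_rem_1
      by (simp add: of_nat_diff half) 
    also have "E \<le> real (n0 + 1) * E" using E by (simp add: mult_le_cancel_right1)
    finally show ?case .
  next
    case (step m)
    have am: "a \<le> real m"
      by (rule order_trans[OF n0(2)]) (use step(1) in simp)
    have split: "integral {a..real (Suc m)} (\<lambda>u. dirichlet_kernel K u *\<^sub>R F u) =
      integral {a..real m} (\<lambda>u. dirichlet_kernel K u *\<^sub>R F u) +
      integral {real m..real (Suc m)} (\<lambda>u. dirichlet_kernel K u *\<^sub>R F u)"
      by (rule Henstock_Kurzweil_Integration.integral_combine[symmetric])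
        (use step n0 am in \<open>auto intro!: integrable_continuous_real continuous_intros
          dirichlet_kernel_continuous_on continuous_on_subset[OF F_cont]\<close>)
    have "?T (Suc m) = ?T m + (saw_rem K (real (Suc m) - m) *\<^sub>R F (real (Suc m)) - saw_rem K (real m - m) *\<^sub>R F (real m)
            - integral {real m..real (Suc m)} (\<lambda>u. dirichlet_kernel K u *\<^sub>R F u))"
      unfolding split using step n0 by (simp add: saw_rem_0 saw_rem_1 algebra_simps flip: scaleR_add_left)
    also have "norm \<dots> \<le> norm (?T m) + E"
      using unit[of m "real m" "real (Suc m)"] step n0 am by (intro order_trans[OF norm_triangle_ineq] add_left_mono) auto
    also have "\<dots> \<le> real (Suc m + 1) * E" using step by (simp add: algebra_simps)
    finally show ?case .
  qed
  from this[of D] show ?thesis using n0 by (simp add: n0_def E_def)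
qed

section \<open>Fresnel integrals\<close>

text \<open>Cauchy's theorem on the triangle 0, \<open>T\<close>, \<open>T (1 + i)\<close>: on the
  diagonal \<open>z^2\<close> is purely imaginary, so the oscillating integrand becomes a
  Gaussian.\<close>

lemma fresnel_rotation:
  fixes T :: real
  assumes "0 < T"
  shows "contour_integral (linepath 0 (of_real T)) (\<lambda>z. exp (2 * pi * \<i> * z\<^sup>2)) +
         contour_integral (linepath (of_real T) (of_real T * (1 + \<i>))) (\<lambda>z. exp (2 * pi * \<i> * z\<^sup>2)) =
         contour_integral (linepath 0 (of_real T * (1 + \<i>))) (\<lambda>z. exp (2 * pi * \<i> * z\<^sup>2))"
proof -
  let ?f = "\<lambda>z::complex. exp (2 * pi * \<i> * z\<^sup>2)"
  have "?f holomorphic_on S" for S by (intro holomorphic_intros)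
  then have c: "?f contour_integrable_on linepath a b" for a b
    by (intro contour_integrable_continuous_linepath holomorphic_on_imp_continuous_on)
  have "(?f has_contour_integral 0) (linepath 0 (of_real T) +++ linepath (of_real T) (of_real T * (1 + \<i>)) +++ linepath (of_real T * (1 + \<i>)) 0)"
    by (intro Cauchy_theorem_triangle holomorphic_intros)
  then have "contour_integral (linepath 0 (of_real T)) ?f + (contour_integral (linepath (of_real T) (of_real T * (1 + \<i>))) ?f
     + contour_integral (linepath (of_real T * (1 + \<i>)) 0) ?f) = 0"
    using c by (simp add: contour_integral_unique contour_integrable_joinI flip: contour_integral_join)
  moreover have "contour_integral (linepath 0 (of_real T * (1 + \<i>))) ?f = - contour_integral (linepath (of_real T * (1 + \<i>)) 0) ?f"
    by (rule contour_integral_reverse_linepath) (intro continuous_intros)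
  moreover have "A + B = X" if "A + (B + Y) = 0" "X = - Y" for A B X Y :: complex
    using that by (simp add: add_eq_0_iff2 flip: add.assoc)
  ultimately show ?thesis by blast
qed

text \<open>At \<open>T + i T s\<close> the integrand has modulus \<open>exp (-4 pi T^2 s)\<close>,
  and integrating this over the side leaves order \<open>1 / T\<close>.\<close>

lemma fresnel_side_bound:
  assumes "0 < T"
  shows "norm (contour_integral (linepath (of_real T) (of_real T * (1 + \<i>))) (\<lambda>z. exp (2 * pi * \<i> * z\<^sup>2))) \<le> 1 / T"
proof -
  let ?f = "\<lambda>z::complex. exp (2 * pi * \<i> * z\<^sup>2)"
  have eq: "linepath (of_real T) (of_real T * (1 + \<i>)) s = of_real T + \<i> * of_real (T * s)" for s
    by (simp add: linepath_def algebra_simps scaleR_conv_of_real)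
  have "contour_integral (linepath (of_real T) (of_real T * (1 + \<i>))) ?f
     = integral {0..1} (\<lambda>s. ?f (of_real T + \<i> * of_real (T * s)) * (\<i> * of_real T))"
    unfolding contour_integral_integral vector_derivative_linepath_at eq by (simp add: ring_distribs)
  also have "norm \<dots> \<le> integral {0..1} (\<lambda>s. T * exp (- 4 * pi * T\<^sup>2 * s))"
  proof (rule integral_norm_bound_integral)
    show "(\<lambda>s. ?f (of_real T + \<i> * of_real (T * s)) * (\<i> * of_real T)) integrable_on {0..1}"
      "(\<lambda>s. T * exp (- 4 * pi * T\<^sup>2 * s)) integrable_on {0..1}"
      by (intro integrable_continuous_real continuous_intros)+
    show "norm (?f (of_real T + \<i> * of_real (T * s)) * (\<i> * of_real T)) \<le> T * exp (- 4 * pi * T\<^sup>2 * s)" for s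
      using assms by (simp add: norm_mult power2_eq_square algebra_simps)
  qed
  also have "integral {0..1} (\<lambda>s. T * exp (- 4 * pi * T\<^sup>2 * s)) =
      (- exp (- 4 * pi * T\<^sup>2 * 1) / (4 * pi * T)) - (- exp (- 4 * pi * T\<^sup>2 * 0) / (4 * pi * T))"
    by (rule integral_unique, rule fundamental_theorem_of_calculus)
      (use assms in \<open>auto intro!: derivative_eq_intros simp: power2_eq_square simp flip: has_real_derivative_iff_has_vector_derivative\<close>)
  also have "\<dots> = (1 - exp (- 4 * pi * T\<^sup>2)) / (4 * pi * T)"
    by (simp add: diff_divide_distrib)
  also have "\<dots> \<le> 1 / (4 * pi * T)"
    using assms by (intro divide_right_mono) auto
  also have "\<dots> \<le> 1 / T"
    using assms pi_gt3 by (intro divide_left_mono) auto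
  finally show ?thesis .
qed

text \<open>The complete integral is the zeroth moment known from probability theory; in the tail
  \<open>exp (-r^2)\<close> is below \<open>1 / r^2\<close>.\<close>

lemma gaussian_truncated:
  assumes "0 < T"
  shows "\<bar>integral {0..T} (\<lambda>r. exp (- r\<^sup>2)) - sqrt pi / 2\<bar> \<le> 1 / T"
proof -
  let ?g = "\<lambda>r::real. exp (- r\<^sup>2)"
  have "((\<lambda>x. indicator {0..} x *\<^sub>R exp (- x\<^sup>2)) has_integral (sqrt pi / 2)) (UNIV :: real set)"
  proof -
    have i: "integrable lborel (\<lambda>x. indicator {0..} x *\<^sub>R exp (- x\<^sup>2) :: real)"
      and v: "integral\<^sup>L lborel (\<lambda>x. indicator {0..} x *\<^sub>R exp (- x\<^sup>2) :: real) = sqrt pi / 2"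
      using gaussian_moment_0 unfolding has_bochner_integral_iff by blast+
    show ?thesis using has_integral_integral_lborel[OF i] unfolding v .
  qed
  have G: "(?g has_integral (sqrt pi / 2)) {0..}"
  proof -
    have "(\<lambda>x::real. indicator {0..} x *\<^sub>R exp (- x\<^sup>2)) = (\<lambda>x. if x \<in> {0..} then exp (- x\<^sup>2) else 0)"
      by (auto simp: indicator_def)
    with \<open>((\<lambda>x. indicator {0..} x *\<^sub>R exp (- x\<^sup>2)) has_integral (sqrt pi / 2)) (UNIV :: real set)\<close>
    show ?thesis by (simp only: has_integral_restrict_UNIV)
  qed
  have tail: "?g integrable_on {T..}"
  proof -
    have "?g absolutely_integrable_on {0..}"
      using G by (intro nonnegative_absolutely_integrable_1) auto
    then have "?g absolutely_integrable_on {T..}"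
      by (rule set_integrable_subset) (use assms in auto)
    then show ?thesis by (rule set_lebesgue_integral_eq_integral(1))
  qed
  have "((\<lambda>r. exp (- r\<^sup>2)) has_integral (integral {0..T} ?g + integral {T..} ?g)) ({0..T} \<union> {T..})"
  proof (rule has_integral_Un)
    show "negligible ({0..T} \<inter> {T..})"
      by (rule negligible_subset[of "{T}"]) auto
  qed (use tail in \<open>auto intro!: integrable_integral integrable_continuous_real continuous_intros\<close>)
  also have "{0..T} \<union> {T..} = {0..}" using assms by auto
  finally have split: "sqrt pi / 2 = integral {0..T} ?g + integral {T..} ?g"
    using G has_integral_unique by blast
  have P: "((\<lambda>r. r powr -2) has_integral - (T powr (-2 + 1)) / (-2 + 1)) {T..}"
    by (rule has_integral_powr_to_inf) (use assms in auto)
  have "integral {T..} ?g \<le> - (T powr (-2 + 1)) / (-2 + 1)"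
  proof (rule has_integral_le[OF integrable_integral[OF tail] P])
    fix r assume "r \<in> {T..}"
    then have r: "r > 0" using assms by auto
    have "r\<^sup>2 \<le> exp (r\<^sup>2)" using exp_ge_add_one_self[of "r\<^sup>2"] by linarith
    then have "exp (- r\<^sup>2) \<le> 1 / r\<^sup>2" using r by (simp add: exp_minus field_simps)
    also have "\<dots> = r powr -2" using r by (simp add: powr_minus powr_numeral field_simps)
    finally show "exp (- r\<^sup>2) \<le> r powr -2" .
  qed
  also have "\<dots> = 1 / T" using assms by (simp add: powr_minus field_simps)
  finally have "integral {T..} ?g \<le> 1 / T" .
  moreover have "0 \<le> integral {T..} ?g" by (rule integral_nonneg[OF tail]) auto
  ultimately show ?thesis using split by linarith
qed

definition fresnel :: "real \<Rightarrow> complex" where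
  "fresnel T = integral {0..T} (\<lambda>t. cis (2 * pi * t\<^sup>2))"

lemma fresnel_asymptotic:
  assumes "0 < T"
  shows "norm (fresnel T - (1 + \<i>) / 4) \<le> 2 / T"
proof -
  let ?f = "\<lambda>z::complex. exp (2 * pi * \<i> * z\<^sup>2)"
  have "contour_integral (linepath 0 (of_real T)) ?f = integral {Re 0..Re (of_real T)} (\<lambda>x. ?f (of_real x))"
    by (rule contour_integral_linepath_Reals_eq) (use assms in auto)
  also have "\<dots> = fresnel T"
    unfolding fresnel_def by (auto intro!: Henstock_Kurzweil_Integration.integral_cong simp: cis_conv_exp algebra_simps)
  finally have 1: "contour_integral (linepath 0 (of_real T)) ?f = fresnel T" .
  \<comment> \<open>On the diagonal \<open>2 pi i z^2 = - 4 pi s^2 T^2\<close>, so this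
    \<open>k\<close> turns the exponent into \<open>- (k s)^2\<close>.\<close>
  define k where "k = 2 * sqrt pi * T"
  have k: "k > 0" using assms by (simp add: k_def)
  have "((\<lambda>s. k *\<^sub>R exp (- (k * s)\<^sup>2)) has_integral integral {k * 0..k * 1} (\<lambda>r. exp (- r\<^sup>2))) {0..1}"
    by (rule has_integral_substitution[where c = 0 and d = k])
      (use k in \<open>auto intro!: continuous_intros derivative_eq_intros\<close>)
  then have "((\<lambda>s. complex_of_real (k * exp (- (k * s)\<^sup>2))) has_integral of_real (integral {0..k} (\<lambda>r. exp (- r\<^sup>2)))) {0..1}"
    by (intro has_integral_of_real) simp
  from has_integral_mult_right[OF this, of "(1 + \<i>) / of_real (2 * sqrt pi)"]
  have "((\<lambda>s. (1 + \<i>) / of_real (2 * sqrt pi) * complex_of_real (k * exp (- (k * s)\<^sup>2)))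
      has_integral (1 + \<i>) / of_real (2 * sqrt pi) * of_real (integral {0..k} (\<lambda>r. exp (- r\<^sup>2)))) {0..1}" .
  moreover have "(1 + \<i>) / of_real (2 * sqrt pi) * complex_of_real (k * exp (- (k * s)\<^sup>2)) =
      ?f (linepath 0 (of_real T * (1 + \<i>)) s) * (of_real T * (1 + \<i>) - 0)" for s
  proof -
    have rot: "complex_of_real (2 * pi) * \<i> * (C * (2 * \<i>)) = - (4 * of_real pi * C)" for C
      by (simp add: complex_eq_iff)
    have "2 * pi * \<i> * (linepath 0 (of_real T * (1 + \<i>)) s)\<^sup>2 = of_real (- (k * s)\<^sup>2)"
    proof -
      have "linepath 0 (of_real T * (1 + \<i>)) s = of_real (s * T) * (1 + \<i>)"
        by (simp add: linepath_def scaleR_conv_of_real algebra_simps)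
      then have "(linepath 0 (of_real T * (1 + \<i>)) s)\<^sup>2 = (of_real (s * T))\<^sup>2 * (1 + \<i>)\<^sup>2"
        by (simp only: power_mult_distrib)
      also have "(1 + \<i>)\<^sup>2 = 2 * \<i>" by (simp add: power2_eq_square algebra_simps)
      finally have "2 * pi * \<i> * (linepath 0 (of_real T * (1 + \<i>)) s)\<^sup>2 = - (4 * of_real pi * (of_real (s * T))\<^sup>2)"
        by (simp only: rot)
      also have "\<dots> = of_real (- (4 * pi * (s * T)\<^sup>2))" by simp
      also have "4 * pi * (s * T)\<^sup>2 = (k * s)\<^sup>2" by (simp add: k_def power_mult_distrib)
      finally show ?thesis .
    qed
    then have "?f (linepath 0 (of_real T * (1 + \<i>)) s) = of_real (exp (- (k * s)\<^sup>2))"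
      by (simp only: exp_of_real)
    moreover have "complex_of_real (k * E) = of_real (2 * sqrt pi) * of_real T * of_real E" for E
      by (simp add: k_def)
    moreover have "u / c * (c * t * E) = E * (t * u - 0)" if "c \<noteq> 0" for u c t E :: complex
      using that by simp
    moreover have "complex_of_real (2 * sqrt pi) \<noteq> 0" by simp
    ultimately show ?thesis by (simp only:)
  qed
  ultimately have 3: "contour_integral (linepath 0 (of_real T * (1 + \<i>))) ?f =
      (1 + \<i>) / of_real (2 * sqrt pi) * of_real (integral {0..k} (\<lambda>r. exp (- r\<^sup>2)))"
    by (intro contour_integral_unique) (simp add: has_contour_integral_linepath)
  have "complex_of_real (sqrt pi / 2) = of_real (2 * sqrt pi) / 4" by simp
  then have quarter: "(1 + \<i>) / of_real (2 * sqrt pi) * of_real (sqrt pi / 2) = (1 + \<i>) / 4"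
    by simp
  have "fresnel T = (1 + \<i>) / of_real (2 * sqrt pi) * of_real (integral {0..k} (\<lambda>r. exp (- r\<^sup>2)))
     - contour_integral (linepath (of_real T) (of_real T * (1 + \<i>))) ?f"
    using fresnel_rotation[OF assms] unfolding 1 3 by (simp only: eq_diff_eq)
  then have "fresnel T - (1 + \<i>) / 4 = (1 + \<i>) / of_real (2 * sqrt pi) * of_real (integral {0..k} (\<lambda>r. exp (- r\<^sup>2)) - sqrt pi / 2)
     - contour_integral (linepath (of_real T) (of_real T * (1 + \<i>))) ?f"
    unfolding of_real_diff right_diff_distrib quarter by (simp only: diff_diff_eq2 diff_diff_eq add.commute)
  also have "norm \<dots> \<le> norm ((1 + \<i>) / of_real (2 * sqrt pi)) * \<bar>integral {0..k} (\<lambda>r. exp (- r\<^sup>2)) - sqrt pi / 2\<bar> + 1 / T"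
    by (rule order_trans[OF norm_triangle_ineq4], rule add_mono)
      (simp only: norm_mult norm_of_real order_refl, rule fresnel_side_bound[OF assms])
  also have "\<dots> \<le> 1 * (1 / T) + 1 / T"
  proof (intro add_mono mult_mono order_refl)
    have sp: "sqrt pi \<ge> 1" using pi_gt3 by (intro real_le_rsqrt) auto
    have "norm (1 + \<i>) \<le> 2" using norm_triangle_ineq[of 1 "\<i>"] by simp
    then show "norm ((1 + \<i>) / of_real (2 * sqrt pi)) \<le> 1"
      using sp by (simp add: norm_divide divide_le_eq del: real_sqrt_ge_1_iff)
    have "\<bar>integral {0..k} (\<lambda>r. exp (- r\<^sup>2)) - sqrt pi / 2\<bar> \<le> 1 / k" by (rule gaussian_truncated[OF k])
    also have "1 / k \<le> 1 / T"
      using sp assms mult_right_mono[of 1 "2 * sqrt pi" T] by (intro divide_left_mono) (auto simp: k_def simp del: real_sqrt_ge_1_iff)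
    finally show "\<bar>integral {0..k} (\<lambda>r. exp (- r\<^sup>2)) - sqrt pi / 2\<bar> \<le> 1 / T" .
  qed auto
  finally show ?thesis by simp
qed

lemma integral_cis_square_tail:
  assumes "0 < p" "p \<le> q"
  shows "norm (integral {p..q} (\<lambda>t. cis (2 * pi * t\<^sup>2))) \<le> 4 / p"
proof -
  have "fresnel p + integral {p..q} (\<lambda>t. cis (2 * pi * t\<^sup>2)) = fresnel q"
    unfolding fresnel_def
    by (rule Henstock_Kurzweil_Integration.integral_combine)
      (use assms in \<open>auto intro!: integrable_continuous_real continuous_intros\<close>)
  then have "integral {p..q} (\<lambda>t. cis (2 * pi * t\<^sup>2)) = (fresnel q - (1 + \<i>) / 4) - (fresnel p - (1 + \<i>) / 4)"
    by (simp add: algebra_simps)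
  also have "norm \<dots> \<le> 2 / q + 2 / p"
    by (rule order_trans[OF norm_triangle_ineq4 add_mono]) (use assms in \<open>auto intro!: fresnel_asymptotic\<close>)
  also have "\<dots> \<le> 2 / p + 2 / p" using assms by (intro add_mono divide_left_mono) auto
  finally show ?thesis by simp
qed

lemma integral_cis_square_reflect:
  "integral {- p..- q} (\<lambda>t. cis (2 * pi * t\<^sup>2)) = integral {q..p} (\<lambda>t. cis (2 * pi * t\<^sup>2))"
  using Henstock_Kurzweil_Integration.integral_reflect_real[of p q "\<lambda>t. cis (2 * pi * t\<^sup>2)"] by simp

text \<open>A segment picks up the complete Fresnel integral exactly when it passes 0, where the
  phase is stationary; each end costs a multiple of the reciprocal of its distance from 0.\<close>

theorem fresnel_segment:
  assumes "p \<noteq> 0" "p \<le> q" "0 < q"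
  shows "norm (integral {p..q} (\<lambda>t. cis (2 * pi * t\<^sup>2)) - (if p < 0 then (1 + \<i>) / 2 else 0)) \<le> 4 / \<bar>p\<bar> + 4 / q"
proof (cases "p < 0")
  case True
  have "integral {p..0} (\<lambda>t. cis (2 * pi * t\<^sup>2)) + integral {0..q} (\<lambda>t. cis (2 * pi * t\<^sup>2)) = integral {p..q} (\<lambda>t. cis (2 * pi * t\<^sup>2))"
    by (rule Henstock_Kurzweil_Integration.integral_combine)
      (use assms True in \<open>auto intro!: integrable_continuous_real continuous_intros\<close>)
  moreover have "integral {p..0} (\<lambda>t. cis (2 * pi * t\<^sup>2)) = fresnel (- p)"
    using integral_cis_square_reflect[of "- p" 0] by (simp add: fresnel_def)
  ultimately have "integral {p..q} (\<lambda>t. cis (2 * pi * t\<^sup>2)) = fresnel (- p) + fresnel q"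
    by (simp add: fresnel_def)
  then have "integral {p..q} (\<lambda>t. cis (2 * pi * t\<^sup>2)) - (1 + \<i>) / 2 =
      (fresnel (- p) - (1 + \<i>) / 4) + (fresnel q - (1 + \<i>) / 4)"
    by (simp add: field_simps)
  also have "norm \<dots> \<le> 2 / (- p) + 2 / q"
    by (rule order_trans[OF norm_triangle_ineq add_mono]; rule fresnel_asymptotic) (use assms True in auto)
  also have "\<dots> \<le> 4 / \<bar>p\<bar> + 4 / q"
    by (intro add_mono) (use assms True in \<open>auto simp: field_simps\<close>)
  finally show ?thesis using True by simp
next
  case False
  then have "norm (integral {p..q} (\<lambda>t. cis (2 * pi * t\<^sup>2))) \<le> 4 / p"
    using assms by (intro integral_cis_square_tail) auto
  then show ?thesis using False assms by (simp add: add_increasing2)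
qed

section \<open>Stationary phase for hyperbolic phases\<close>

text \<open>This is \<open>cis (2 pi phi) / (2 pi i)\<close> written out in real and imaginary
  parts.\<close>

definition phase_primitive :: "(real \<Rightarrow> real) \<Rightarrow> real \<Rightarrow> complex" where
  "phase_primitive \<phi> u = Complex (sin (2 * pi * \<phi> u) / (2 * pi)) (- cos (2 * pi * \<phi> u) / (2 * pi))"

lemma phase_primitive_deriv:
  assumes "(\<phi> has_real_derivative \<phi>') (at u within S)"
  shows "(phase_primitive \<phi> has_vector_derivative of_real \<phi>' * cis (2 * pi * \<phi> u)) (at u within S)"
  unfolding phase_primitive_def has_vector_derivative_complex_iff
  using assms by (auto intro!: derivative_eq_intros)

lemma norm_phase_primitive: "norm (phase_primitive \<phi> u) \<le> 1"
proof -
  have "(norm (phase_primitive \<phi> u))\<^sup>2 = ((sin (2 * pi * \<phi> u))\<^sup>2 + (cos (2 * pi * \<phi> u))\<^sup>2) / (2 * pi)\<^sup>2"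
    by (simp add: phase_primitive_def cmod_power2 power_divide flip: add_divide_distrib)
  also have "\<dots> = (1 / (2 * pi))\<^sup>2" by (simp add: power_divide)
  finally have "norm (phase_primitive \<phi> u) = 1 / (2 * pi)"
    by (rule power2_eq_imp_eq) auto
  also have "\<dots> \<le> 1" using pi_gt3 by simp
  finally show ?thesis .
qed

text \<open>The integrand is written with the factor \<open>phi'\<close> split off, so
  \<open>g\<close> stands for amplitude over phase velocity; its monotonicity is what the first
  derivative test asks for.\<close>

lemma phase_integral_mono:
  fixes g \<phi> \<phi>' :: "real \<Rightarrow> real"
  assumes "a \<le> b"
    and mono: "\<And>x y. \<lbrakk>a \<le> x; x \<le> y; y \<le> b\<rbrakk> \<Longrightarrow> g x \<le> g y"
    and deriv: "\<And>u. u \<in> {a..b} \<Longrightarrow> (\<phi> has_real_derivative \<phi>' u) (at u within {a..b})"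
  shows "(\<lambda>u. of_real (g u) * (of_real (\<phi>' u) * cis (2 * pi * \<phi> u))) integrable_on {a..b}"
    and "norm (integral {a..b} (\<lambda>u. of_real (g u) * (of_real (\<phi>' u) * cis (2 * pi * \<phi> u)))) \<le> 4 * (\<bar>g a\<bar> + \<bar>g b\<bar>)"
  using monotone_oscillation_bound[where g = g and M = 1 and F = "phase_primitive \<phi>"
      and f = "\<lambda>u. of_real (\<phi>' u) * cis (2 * pi * \<phi> u)", OF \<open>a \<le> b\<close> mono phase_primitive_deriv[OF deriv] norm_phase_primitive]
  by simp_all

lemma phase_integral_antimono:
  fixes g \<phi> \<phi>' :: "real \<Rightarrow> real"
  assumes "a \<le> b"
    and mono: "\<And>x y. \<lbrakk>a \<le> x; x \<le> y; y \<le> b\<rbrakk> \<Longrightarrow> g y \<le> g x"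
    and deriv: "\<And>u. u \<in> {a..b} \<Longrightarrow> (\<phi> has_real_derivative \<phi>' u) (at u within {a..b})"
  shows "(\<lambda>u. of_real (g u) * (of_real (\<phi>' u) * cis (2 * pi * \<phi> u))) integrable_on {a..b}"
    and "norm (integral {a..b} (\<lambda>u. of_real (g u) * (of_real (\<phi>' u) * cis (2 * pi * \<phi> u)))) \<le> 4 * (\<bar>g a\<bar> + \<bar>g b\<bar>)"
  using phase_integral_mono[where g = "\<lambda>u. - g u", OF \<open>a \<le> b\<close> _ deriv] mono
  by (simp_all add: integrable_neg_iff)

text \<open>The phase has derivative \<open>- (A / u^2 + k)\<close>, which never vanishes. Amplitude
  over its modulus is nondecreasing, because the numerator grows and the denominator falls. The case
  \<open>k = 0\<close> serves the zero frequency.\<close>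

lemma nonstationary_integral_bound:
  assumes "0 < a" "a \<le> b" "0 < A" "0 \<le> k" "0 \<le> c"
  shows "norm (integral {a..b} (\<lambda>u. of_real (u powr c) * cis (2 * pi * (A / u - k * u)))) \<le> 8 * (b powr c / (A / b\<^sup>2 + k))"
proof -
  define g where "g = (\<lambda>u. u powr c / (A / u\<^sup>2 + k))"
  have pos: "A / u\<^sup>2 + k > 0" if "u > 0" for u using assms that by (intro add_pos_nonneg) auto
  have mono: "g u \<le> g v" if "a \<le> u" "u \<le> v" "v \<le> b" for u v
    unfolding g_def
  proof (rule frac_le)
    show "u powr c \<le> v powr c" using that assms by (intro powr_mono2) auto
    show "0 < A / v\<^sup>2 + k" using that assms by (intro pos) auto
    show "A / v\<^sup>2 + k \<le> A / u\<^sup>2 + k" using that assms by (intro add_mono divide_left_mono power_mono) auto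
  qed auto
  have "norm (integral {a..b} (\<lambda>u. of_real (g u) * (of_real (- A / u\<^sup>2 - k) * cis (2 * pi * (A / u - k * u))))) \<le> 4 * (\<bar>g a\<bar> + \<bar>g b\<bar>)"
    by (rule phase_integral_mono(2)[where \<phi> = "\<lambda>u. A / u - k * u"])
      (use assms mono in \<open>auto intro!: derivative_eq_intros simp: power2_eq_square field_simps\<close>)
  also have "integral {a..b} (\<lambda>u. of_real (g u) * (of_real (- A / u\<^sup>2 - k) * cis (2 * pi * (A / u - k * u))))
     = integral {a..b} (\<lambda>u. - (of_real (u powr c) * cis (2 * pi * (A / u - k * u))))"
  proof (rule Henstock_Kurzweil_Integration.integral_cong)
    fix u assume "u \<in> {a..b}"
    then have "A / u\<^sup>2 + k > 0" using assms by (intro pos) auto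
    then have "g u * (- A / u\<^sup>2 - k) = - (u powr c)" unfolding g_def
      by (simp add: field_simps)
    then have "complex_of_real (g u) * of_real (- A / u\<^sup>2 - k) = - of_real (u powr c)"
      by (metis of_real_minus of_real_mult)
    then show "of_real (g u) * (of_real (- A / u\<^sup>2 - k) * cis (2 * pi * (A / u - k * u))) = - (of_real (u powr c) * cis (2 * pi * (A / u - k * u)))"
      by (simp only: mult.assoc[symmetric] mult_minus_left)
  qed
  also have "4 * (\<bar>g a\<bar> + \<bar>g b\<bar>) \<le> 4 * (g b + g b)"
  proof -
    have "0 \<le> g a" "0 \<le> g b" using pos[of a] pos[of b] assms by (auto simp: g_def)
    then show ?thesis using mono[of a b] assms by simp
  qed
  finally show ?thesis by (simp add: g_def)
qed

text \<open>The slope of the chord of \<open>y powr p\<close> from 1 to \<open>y\<close>, completed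
  at 1 by the derivative so that no singularity remains at the saddle.\<close>

definition power_slope :: "real \<Rightarrow> real \<Rightarrow> real" where
  "power_slope p y = (if y = 1 then p else (y powr p - 1) / (y - 1))"

lemma power_slope_bounds:
  assumes "1 \<le> p"
  shows "1 < y \<Longrightarrow> p \<le> power_slope p y" "1 < y \<Longrightarrow> power_slope p y \<le> p * y powr (p - 1)"
    "0 < y \<Longrightarrow> y < 1 \<Longrightarrow> power_slope p y \<le> p" "0 < y \<Longrightarrow> 0 \<le> power_slope p y"
proof -
  have mvt: "\<exists>z>x. z < y \<and> y powr p - x powr p = (y - x) * (p * z powr (p - 1))" if "0 < x" "x < y" for x y :: real
    by (rule MVT2) (use that in \<open>auto intro!: derivative_eq_intros\<close>)
  show "p \<le> power_slope p y" "power_slope p y \<le> p * y powr (p - 1)" if y: "1 < y"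
  proof -
    obtain z where z: "1 < z" "z < y" "y powr p - 1 powr p = (y - 1) * (p * z powr (p - 1))"
      using mvt[of 1 y] y by auto
    then have eq: "power_slope p y = p * z powr (p - 1)" using that by (simp add: power_slope_def field_simps)
    have "1 powr (p - 1) \<le> z powr (p - 1)" using z assms by (intro powr_mono2) auto
    then show "p \<le> power_slope p y" unfolding eq using assms mult_left_mono[of 1 "z powr (p - 1)" p] by simp
    show "power_slope p y \<le> p * y powr (p - 1)"
      unfolding eq using z assms by (intro mult_left_mono powr_mono2) auto
  qed
  show "power_slope p y \<le> p" if y: "0 < y" "y < 1"
  proof -
    obtain z where z: "y < z" "z < 1" "1 powr p - y powr p = (1 - y) * (p * z powr (p - 1))"
      using mvt[of y 1] y by auto
    then have eq: "power_slope p y = p * z powr (p - 1)" using that by (simp add: power_slope_def field_simps)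
    have "z powr (p - 1) \<le> 1" using z assms that by (intro powr_le1) auto
    then show ?thesis unfolding eq using assms mult_left_mono[of "z powr (p - 1)" 1 p] by simp
  qed
  show "0 \<le> power_slope p y" if "0 < y"
  proof (cases "y \<ge> 1")
    case True
    then show ?thesis using assms ge_one_powr_ge_zero[of y p] by (simp add: power_slope_def)
  next
    case False
    then have "y powr p \<le> 1" using assms that by (intro powr_le1) auto
    then show ?thesis using False by (simp add: power_slope_def divide_nonpos_nonpos)
  qed
qed

text \<open>Chord slopes of a convex function increase. The point 1 is compared separately, since
  the value there is a derivative and not a slope.\<close>

lemma power_slope_mono:
  assumes p: "1 \<le> p" and xy: "0 < x" "x \<le> y"
  shows "power_slope p x \<le> power_slope p y"
proof -
  note C = convex_on_slope_le[OF powr_convex[OF p]]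
  consider "x = y" | "x = 1" "1 < y" | "x < 1" "y = 1" | "x < y" "y < 1" | "x < 1" "1 < y" | "1 < x" "x < y"
    using xy by linarith
  then show ?thesis
  proof cases
    case 2 then show ?thesis using power_slope_bounds(1)[OF p, of y] by (simp add: power_slope_def)
  next
    case 3 then show ?thesis using power_slope_bounds(3)[OF p, of x] xy by (simp add: power_slope_def)
  next
    case 4 then show ?thesis using C(2)[of x 1 y] xy by (simp add: power_slope_def)
  next
    case 5
    have "(x powr p - 1) / (x - 1) \<le> (1 - y powr p) / (1 - y)"
      using C[of x y 1] 5 xy by simp
    also have "\<dots> = (y powr p - 1) / (y - 1)" using 5 by (simp add: field_simps)
    finally show ?thesis using 5 by (simp add: power_slope_def)
  next
    case 6
    have e: "(1 - z powr p) / (1 - z) = (z powr p - 1) / (z - 1)" if "z > 1" for z :: real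
      using that by (simp add: field_simps)
    show ?thesis using C(1)[of 1 y x] 6 e[of x] e[of y] by (simp add: power_slope_def)
  qed auto
qed

text \<open>Half of this is \<open>(y powr (2 c) - 1 / y) / (1 - 1 / y^4)\<close> with the factor
  \<open>y - 1\<close> cancelled, so it is regular at the saddle \<open>y = 1\<close>.\<close>

definition saddle_weight :: "real \<Rightarrow> real \<Rightarrow> real" where
  "saddle_weight c y = 2 * (y ^ 3 / ((y + 1) * (y\<^sup>2 + 1))) * power_slope (1 + 2 * c) y"

text \<open>Divided through by \<open>y^3\<close> the factor is
  \<open>1 / ((1 + 1/y) (1 + 1/y^2))\<close>, which makes both its growth and the bound 1
  visible.\<close>

lemma saddle_weight_factor:
  fixes x y :: real
  assumes "0 < x" "x \<le> y"
  shows "x ^ 3 / ((x + 1) * (x\<^sup>2 + 1)) \<le> y ^ 3 / ((y + 1) * (y\<^sup>2 + 1))"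
    "y ^ 3 / ((y + 1) * (y\<^sup>2 + 1)) \<le> 1"
proof -
  have e: "z ^ 3 / ((z + 1) * (z\<^sup>2 + 1)) = 1 / ((1 + 1 / z) * (1 + 1 / z\<^sup>2))" if "z > 0" for z :: real
    using that by (simp add: field_simps power3_eq_cube power2_eq_square add_pos_pos)
  show "x ^ 3 / ((x + 1) * (x\<^sup>2 + 1)) \<le> y ^ 3 / ((y + 1) * (y\<^sup>2 + 1))"
  proof -
    have "(1 + 1 / y) * (1 + 1 / y\<^sup>2) \<le> (1 + 1 / x) * (1 + 1 / x\<^sup>2)"
      using assms by (intro mult_mono add_mono divide_left_mono power_mono) auto
    moreover have "0 < (1 + 1 / y) * (1 + 1 / y\<^sup>2)"
      using assms by (intro mult_pos_pos add_pos_pos) auto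
    ultimately show ?thesis using assms by (simp only: e[of x] e[of y]) (intro divide_left_mono; simp)
  qed
  have "1 * 1 \<le> (1 + 1 / y) * (1 + 1 / y\<^sup>2)" using assms by (intro mult_mono) auto
  then show "y ^ 3 / ((y + 1) * (y\<^sup>2 + 1)) \<le> 1" using assms by (subst e) auto
qed

lemma saddle_weight_mono:
  assumes "0 \<le> c" "0 < x" "x \<le> y"
  shows "saddle_weight c x \<le> saddle_weight c y" "0 \<le> saddle_weight c x"
proof -
  show "saddle_weight c x \<le> saddle_weight c y"
    unfolding saddle_weight_def using assms
    by (intro mult_mono mult_left_mono saddle_weight_factor power_slope_mono power_slope_bounds) auto
  show "0 \<le> saddle_weight c x"
    unfolding saddle_weight_def using assms by (intro mult_nonneg_nonneg power_slope_bounds) auto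
qed

lemma saddle_weight_le:
  assumes "0 \<le> c" "c \<le> 1 / 2" "1 < y"
  shows "saddle_weight c y \<le> 4 * y powr (2 * c)"
proof -
  have "saddle_weight c y \<le> 2 * 1 * ((1 + 2 * c) * y powr (1 + 2 * c - 1))"
    unfolding saddle_weight_def using assms
    by (intro mult_mono saddle_weight_factor(2)[of y] power_slope_bounds) auto
  also have "\<dots> \<le> 2 * 1 * (2 * y powr (1 + 2 * c - 1))"
    using assms by (intro mult_left_mono mult_right_mono) auto
  finally show ?thesis by simp
qed

text \<open>With $t = \sqrt{ku} - \sqrt{A/u}$ the phase $A/u + ku$ equals $t^2 + 2\sqrt{Ak}$. For
$u = \sqrt{A/k}\, y^2$, the first summand below is proportional to $dt/du$ and gives a Fresnel integral, while
$1 - 1/y^4$ is proportional to the derivative of the phase, so that the second one integrates by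
parts; its cofactor is a combination of piecewise monotone functions.\<close>

lemma saddle_decomposition:
  assumes "0 < y"
  shows "y powr (2 * c) = (1 / y + 1 / y ^ 3) / 2 + (1 - 1 / y ^ 4) * ((saddle_weight c y + y / (y\<^sup>2 + 1)) / 2)"
proof (cases "y = 1")
  case False
  define P where "P = y powr (2 * c)"
  have sl: "power_slope (1 + 2 * c) y = (y * P - 1) / (y - 1)"
    using assms False by (simp add: power_slope_def P_def powr_add)
  have y1: "y - 1 \<noteq> 0" "y + 1 \<noteq> 0" "y\<^sup>2 + 1 \<noteq> 0" "y \<noteq> 0"
    using assms False by (auto simp: add_nonneg_eq_0_iff)
  have "(1 - 1 / y ^ 4) = (y - 1) * (y + 1) * (y\<^sup>2 + 1) / y ^ 4"
    using y1 by (simp add: field_simps power2_eq_square power4_eq_xxxx)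
  then have "(1 - 1 / y ^ 4) * ((saddle_weight c y + y / (y\<^sup>2 + 1)) / 2) =
      (2 * y ^ 3 * (y * P - 1) + y * (y - 1) * (y + 1)) / (2 * y ^ 4)"
    unfolding saddle_weight_def sl using y1 by (simp add: divide_simps) (simp add: algebra_simps)
  also have "\<dots> = P - (1 / y + 1 / y ^ 3) / 2"
    using y1 by (simp add: field_simps) (simp add: algebra_simps eval_nat_numeral)
  finally show ?thesis unfolding P_def[symmetric] by (metis add.commute diff_add_cancel)
qed simp


text \<open>In \<open>y = sqrt (u / u0)\<close> the first weight is nondecreasing throughout, and
  its size at \<open>b\<close> gives the factor \<open>(b / u0) powr c\<close>. The second,
  \<open>y / (y^2 + 1)\<close>, rises up to \<open>u0\<close> and falls beyond it, so it is handled
  on two pieces.\<close>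

lemma saddle_remainder_bound:
  fixes \<phi> \<phi>' y :: "real \<Rightarrow> real"
  assumes ab: "0 < a" "a \<le> b" and c: "0 \<le> c" "c \<le> 1 / 2" and u0: "0 < u0" "u0 < b"
    and deriv: "\<And>u. u \<in> {a..b} \<Longrightarrow> (\<phi> has_real_derivative \<phi>' u) (at u within {a..b})"
  shows "(\<lambda>u. of_real ((saddle_weight c (sqrt (u / u0)) + sqrt (u / u0) / ((sqrt (u / u0))\<^sup>2 + 1)) / 2) * (of_real (\<phi>' u) * cis (2 * pi * \<phi> u))) integrable_on {a..b}"
    and "norm (integral {a..b} (\<lambda>u. of_real ((saddle_weight c (sqrt (u / u0)) + sqrt (u / u0) / ((sqrt (u / u0))\<^sup>2 + 1)) / 2) * (of_real (\<phi>' u) * cis (2 * pi * \<phi> u))))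
       \<le> 24 * (b / u0) powr c"
proof -
  define Y where "Y = (\<lambda>u. sqrt (u / u0))"
  define e where "e = (\<lambda>u. of_real (\<phi>' u) * cis (2 * pi * \<phi> u))"
  define w where "w = (\<lambda>u. saddle_weight c (Y u) / 2)"
  define v where "v = (\<lambda>u. Y u / ((Y u)\<^sup>2 + 1) / 2)"
  have Ypos: "0 < Y u" if "u > 0" for u using that u0 by (simp add: Y_def)
  have Ymono: "Y u \<le> Y u'" if "0 < u" "u \<le> u'" for u u'
    using that u0 by (auto simp: Y_def intro!: divide_right_mono)
  \<comment> \<open>This lets the contribution of the second weight, a pure constant, be absorbed
    into the same bound.\<close>
  have B: "(b / u0) powr c \<ge> 1" using u0 c by (intro ge_one_powr_ge_zero) auto
  have wmono: "w x \<le> w z" "0 \<le> w x" if "0 < x" "x \<le> z" for x z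
    unfolding w_def using saddle_weight_mono[OF c(1) Ypos Ymono] that by auto
  have wi: "(\<lambda>u. of_real (w u) * e u) integrable_on {a..b}"
    and wb: "norm (integral {a..b} (\<lambda>u. of_real (w u) * e u)) \<le> 4 * (\<bar>w a\<bar> + \<bar>w b\<bar>)"
    unfolding e_def
    by (rule phase_integral_mono[where g = w, OF ab(2) _ deriv]; use wmono ab in force)+
  have "w b \<le> 2 * (b / u0) powr c"
  proof -
    have "saddle_weight c (Y b) \<le> 4 * Y b powr (2 * c)"
      using u0 by (intro saddle_weight_le c) (simp add: Y_def)
    also have "Y b powr (2 * c) = (b / u0) powr c"
      using u0 by (simp add: Y_def powr_half_sqrt[symmetric] powr_powr)
    finally show ?thesis by (simp add: w_def)
  qed
  then have wb': "norm (integral {a..b} (\<lambda>u. of_real (w u) * e u)) \<le> 16 * (b / u0) powr c"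
    using wb wmono[of a b] wmono[of b b] ab by simp
  have v_eq: "z / (z\<^sup>2 + 1) = 1 / (z + 1 / z)" if "z > 0" for z :: real
    using that by (simp add: field_simps power2_eq_square)
  have v01: "0 \<le> v u" "v u \<le> 1 / 4" if "0 < u" for u
  proof -
    have "0 \<le> (Y u - 1)\<^sup>2" by simp
    then have "2 * Y u \<le> (Y u)\<^sup>2 + 1" by (simp add: power2_eq_square algebra_simps)
    moreover have "(Y u)\<^sup>2 + 1 > 0" by (simp add: add_nonneg_pos)
    ultimately show "v u \<le> 1 / 4" by (simp add: v_def field_simps)
    show "0 \<le> v u" using Ypos[OF that] by (simp add: v_def)
  qed
  have v_cmp: "x / (x\<^sup>2 + 1) \<le> z / (z\<^sup>2 + 1)" if "0 < x" "0 < z" "(z - x) * (1 - x * z) \<ge> 0" for x z :: real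
  proof -
    have "x * (z\<^sup>2 + 1) \<le> z * (x\<^sup>2 + 1)" using that(3) by (simp add: algebra_simps power2_eq_square)
    moreover have "x\<^sup>2 + 1 > 0" "z\<^sup>2 + 1 > 0" by (simp_all add: add_nonneg_pos)
    ultimately show ?thesis by (simp add: divide_le_eq le_divide_eq mult.commute)
  qed
  have vup: "v x \<le> v z" if "0 < x" "x \<le> z" "z \<le> u0" for x z
  proof -
    have "Y x \<le> 1" "Y z \<le> 1" using that u0 by (auto simp: Y_def)
    then have "(Y z - Y x) * (1 - Y x * Y z) \<ge> 0"
      using Ymono[of x z] Ypos[of x] Ypos[of z] that by (intro mult_nonneg_nonneg) (auto simp: mult_le_one)
    then show ?thesis unfolding v_def using Ypos[of x] Ypos[of z] that by (intro divide_right_mono v_cmp) auto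
  qed
  have vdown: "v z \<le> v x" if "u0 \<le> x" "x \<le> z" for x z
  proof -
    have "1 \<le> Y x" "1 \<le> Y z" using that u0 by (auto simp: Y_def)
    then have "1 \<le> Y x * Y z" using mult_mono[of 1 "Y x" 1 "Y z"] by simp
    then have "(Y x - Y z) * (1 - Y z * Y x) \<ge> 0"
      using Ymono[of x z] that u0 by (intro mult_nonpos_nonpos) (auto simp: mult.commute)
    then show ?thesis unfolding v_def using Ypos[of x] Ypos[of z] that u0 by (intro divide_right_mono v_cmp) auto
  qed
  have v1: "(\<lambda>u. of_real (v u) * e u) integrable_on {p..q} \<and> norm (integral {p..q} (\<lambda>u. of_real (v u) * e u)) \<le> 4"
    if "a \<le> p" "p \<le> q" "q \<le> b" "q \<le> u0 \<or> u0 \<le> p" for p q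
  proof -
    have d: "(\<phi> has_real_derivative \<phi>' u) (at u within {p..q})" if "u \<in> {p..q}" for u
      using deriv[of u] that \<open>a \<le> p\<close> \<open>q \<le> b\<close> by (auto intro: DERIV_subset)
    have "(\<lambda>u. of_real (v u) * e u) integrable_on {p..q} \<and> norm (integral {p..q} (\<lambda>u. of_real (v u) * e u)) \<le> 4 * (\<bar>v p\<bar> + \<bar>v q\<bar>)"
      using that(4)
    proof
      assume "q \<le> u0"
      then have "v x \<le> v z" if "p \<le> x" "x \<le> z" "z \<le> q" for x z
        using that ab \<open>a \<le> p\<close> by (intro vup) auto
      from phase_integral_mono[where g = v, OF \<open>p \<le> q\<close> this d] show ?thesis unfolding e_def by blast
    next
      assume "u0 \<le> p"
      then have "v z \<le> v x" if "p \<le> x" "x \<le> z" "z \<le> q" for x z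
        using that by (intro vdown) auto
      from phase_integral_antimono[where g = v, OF \<open>p \<le> q\<close> this d] show ?thesis unfolding e_def by blast
    qed
    moreover have "4 * (\<bar>v p\<bar> + \<bar>v q\<bar>) \<le> 4" using v01[of p] v01[of q] that ab by simp
    ultimately show ?thesis by linarith
  qed
  have v2: "(\<lambda>u. of_real (v u) * e u) integrable_on {a..b} \<and> norm (integral {a..b} (\<lambda>u. of_real (v u) * e u)) \<le> 8"
  proof (cases "a \<le> u0")
    case True
    note L = v1[of a u0] and R = v1[of u0 b]
    have i: "(\<lambda>u. of_real (v u) * e u) integrable_on {a..b}"
      by (rule Henstock_Kurzweil_Integration.integrable_combine[of a u0]) (use L R True u0 in auto)
    have "integral {a..b} (\<lambda>u. of_real (v u) * e u) = integral {a..u0} (\<lambda>u. of_real (v u) * e u) + integral {u0..b} (\<lambda>u. of_real (v u) * e u)"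
      by (rule Henstock_Kurzweil_Integration.integral_combine[symmetric]) (use i True u0 in auto)
    also have "norm \<dots> \<le> 4 + 4"
      by (rule order_trans[OF norm_triangle_ineq add_mono]) (use L R True u0 in auto)
    finally show ?thesis using i by simp
  next
    case False
    then show ?thesis using v1[of a b] ab by auto
  qed
  have eq: "(\<lambda>u. of_real ((saddle_weight c (sqrt (u / u0)) + sqrt (u / u0) / ((sqrt (u / u0))\<^sup>2 + 1)) / 2) * (of_real (\<phi>' u) * cis (2 * pi * \<phi> u)))
      = (\<lambda>u. of_real (w u) * e u + of_real (v u) * e u)"
    unfolding w_def v_def e_def Y_def of_real_add[symmetric] distrib_right[symmetric] add_divide_distrib ..
  show "(\<lambda>u. of_real ((saddle_weight c (sqrt (u / u0)) + sqrt (u / u0) / ((sqrt (u / u0))\<^sup>2 + 1)) / 2) * (of_real (\<phi>' u) * cis (2 * pi * \<phi> u))) integrable_on {a..b}"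
    unfolding eq using wi v2 by (intro integrable_add) auto
  have "norm (integral {a..b} (\<lambda>u. of_real (w u) * e u + of_real (v u) * e u)) \<le> 16 * (b / u0) powr c + 8"
    using wi v2 wb' by (subst integral_add) (auto intro: order_trans[OF norm_triangle_ineq add_mono])
  then show "norm (integral {a..b} (\<lambda>u. of_real ((saddle_weight c (sqrt (u / u0)) + sqrt (u / u0) / ((sqrt (u / u0))\<^sup>2 + 1)) / 2) * (of_real (\<phi>' u) * cis (2 * pi * \<phi> u))))
       \<le> 24 * (b / u0) powr c"
    unfolding eq using B by linarith
qed

text \<open>In the variable \<open>T\<close> the phase is exactly quadratic and the main part
  becomes a Fresnel integral. The saddle \<open>u0\<close> may lie close to the lower end, which
  costs \<open>sqrt (a u0) / |a - u0|\<close>; the condition on \<open>b\<close> keeps it a fixed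
  factor below the upper end, so that end costs only a constant.\<close>

theorem saddle_point_integral:
  fixes A k a b c :: real
  assumes A: "0 < A" and k: "0 < k" and ab: "0 < a" "a \<le> b" and c: "0 \<le> c" "c \<le> 1 / 2"
    and b: "2 * A \<le> k * b\<^sup>2" and u0_def: "u0 = sqrt (A / k)" and a0: "a \<noteq> u0"
  shows "norm (integral {a..b} (\<lambda>u. of_real (u powr c) * cis (2 * pi * (A / u + k * u)))
     - (if a < u0 then of_real (u0 powr (c + 1 / 2) / sqrt k) * cis (4 * pi * sqrt (A * k)) * ((1 + \<i>) / 2) else 0))
     \<le> 40 * (b powr c / k) * (1 + sqrt (a * u0) / \<bar>a - u0\<bar>)"
proof -
  have u0: "u0 > 0" "u0\<^sup>2 = A / k" using A k by (simp_all add: u0_def)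
  have "2 * u0\<^sup>2 \<le> b\<^sup>2" using b k by (simp add: u0 field_simps)
  moreover have "(4 * u0)\<^sup>2 = 16 * u0\<^sup>2" "(3 * b)\<^sup>2 = 9 * b\<^sup>2" by (simp_all add: power_mult_distrib)
  ultimately have "(4 * u0)\<^sup>2 \<le> (3 * b)\<^sup>2" using zero_le_power2[of b] by linarith
  \<comment> \<open>Since \<open>1 / sqrt 2 < 3 / 4\<close>, a rational factor separates the saddle
    from the upper end.\<close>
  then have b43: "4 * u0 \<le> 3 * b" by (rule power2_le_imp_le) (use ab in auto)
  then have bu0: "u0 < b" using u0 ab by linarith
  define T where "T = (\<lambda>u. sqrt k * sqrt u - sqrt A / sqrt u)"
  define T' where "T' = (\<lambda>u. (sqrt k / sqrt u + sqrt A / (u * sqrt u)) / 2)"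
  define \<phi> where "\<phi> = (\<lambda>u. A / u + k * u)"
  define \<phi>' where "\<phi>' = (\<lambda>u. k - A / u\<^sup>2)"
  define G where "G = u0 powr (c + 1 / 2) / sqrt k"
  define e0 where "e0 = cis (4 * pi * sqrt (A * k))"
  define E where "E = (\<lambda>u. cis (2 * pi * \<phi> u))"
  define S where "S = (\<lambda>u. (saddle_weight c (sqrt (u / u0)) + sqrt (u / u0) / ((sqrt (u / u0))\<^sup>2 + 1)) / 2)"
  have sA: "sqrt A = u0 * sqrt k" using A k by (simp add: u0_def real_sqrt_divide)
  have Tphi: "\<phi> u = (T u)\<^sup>2 + 2 * sqrt (A * k)" if "u > 0" for u
    using that A k by (simp add: \<phi>_def T_def power2_diff power_divide power_mult_distrib real_sqrt_mult)
  have T_deriv: "(T has_real_derivative T' u) (at u within X)" if "u > 0" for u X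
    unfolding T_def T'_def using that
    by (auto intro!: derivative_eq_intros simp: field_simps)
  have phi_deriv: "(\<phi> has_real_derivative \<phi>' u) (at u within X)" if "u > 0" for u X
    unfolding \<phi>_def \<phi>'_def using that by (auto intro!: derivative_eq_intros simp: power2_eq_square field_simps)
  have G_eq: "G = u0 powr c * sqrt u0 / sqrt k"
    using u0 by (simp add: G_def powr_add powr_half_sqrt)
  have decomp: "u powr c = G * T' u + (u0 powr c / k) * (S u * \<phi>' u)" if "u > 0" for u
  proof -
    define y where "y = sqrt (u / u0)"
    have y: "y > 0" "u = u0 * y\<^sup>2" using that u0(1) by (simp_all add: y_def)
    then have y3: "sqrt u = sqrt u0 * y" by (simp add: real_sqrt_mult)
    have "y\<^sup>2 = y powr 2" using y(1) by simp
    then have "u powr c = u0 powr c * (y powr 2) powr c"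
      using y(1) u0 unfolding y(2) by (simp add: powr_mult)
    then have "u powr c = u0 powr c * y powr (2 * c)" by (simp only: powr_powr)
    moreover have "G * T' u = u0 powr c * ((1 / y + 1 / y ^ 3) / 2)"
    proof -
      have "G * T' u = u0 powr c * (sqrt u0 * (sqrt k / sqrt k) * (1 / (sqrt u0 * y) + u0 / (u0 * y\<^sup>2 * (sqrt u0 * y))) / 2)"
        unfolding G_eq T'_def sA y3 using k by (simp add: field_simps y(2)) 
      also have "\<dots> = u0 powr c * ((1 / y + 1 / y ^ 3) / 2)"
        using k u0 y(1) by (simp add: field_simps power2_eq_square power3_eq_cube)
      finally show ?thesis .
    qed
    moreover have "(u0 powr c / k) * (S u * \<phi>' u) = u0 powr c * ((1 - 1 / y ^ 4) * S u)"
    proof -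
      have "A = k * u0\<^sup>2" using u0 k by simp
      moreover have "u\<^sup>2 = u0\<^sup>2 * y ^ 4"
        unfolding y(2) by (simp add: power_mult_distrib flip: power_mult)
      ultimately have "\<phi>' u = k - k * u0\<^sup>2 / (u0\<^sup>2 * y ^ 4)" by (simp only: \<phi>'_def)
      also have "\<dots> = k * (1 - 1 / y ^ 4)" using u0(1) by (simp add: right_diff_distrib)
      finally have "\<phi>' u = k * (1 - 1 / y ^ 4)" .
      then show ?thesis using k by simp
    qed
    ultimately show ?thesis
      using saddle_decomposition[OF y(1), of c] unfolding S_def y_def[symmetric] by (simp only: distrib_left)
  qed
  have split: "of_real (u powr c) * E u = of_real G * e0 * (T' u *\<^sub>R cis (2 * pi * (T u)\<^sup>2)) +
      of_real (u0 powr c / k) * (of_real (S u) * (of_real (\<phi>' u) * E u))" if "u > 0" for u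
  proof -
    have "E u = e0 * cis (2 * pi * (T u)\<^sup>2)"
      unfolding E_def e0_def Tphi[OF that] cis_mult by (simp add: algebra_simps)
    then show ?thesis
      unfolding decomp[OF that] of_real_add of_real_mult scaleR_conv_of_real by (simp add: algebra_simps)
  qed
  have M: "((\<lambda>u. T' u *\<^sub>R cis (2 * pi * (T u)\<^sup>2)) has_integral integral {T a..T b} (\<lambda>t. cis (2 * pi * t\<^sup>2))) {a..b}"
  proof (rule has_integral_substitution)
    have mono: "T u \<le> T v" if "0 < u" "u \<le> v" for u v
      unfolding T_def using that A k by (intro diff_mono mult_left_mono divide_left_mono) auto
    then show "T a \<le> T b" "T ` {a..b} \<subseteq> {T a..T b}" using ab by auto
    show "continuous_on {T a..T b} (\<lambda>t. cis (2 * pi * t\<^sup>2))" by (intro continuous_intros)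
  qed (use ab T_deriv in auto)
  have R: "(\<lambda>u. of_real (S u) * (of_real (\<phi>' u) * E u)) integrable_on {a..b}"
    "norm (integral {a..b} (\<lambda>u. of_real (S u) * (of_real (\<phi>' u) * E u))) \<le> 24 * (b / u0) powr c"
    unfolding S_def E_def
    by (rule saddle_remainder_bound[OF ab c u0(1) bu0]; use phi_deriv ab in auto)+
  have "integral {a..b} (\<lambda>u. of_real (u powr c) * E u) = integral {a..b} (\<lambda>u. of_real G * e0 * (T' u *\<^sub>R cis (2 * pi * (T u)\<^sup>2)) +
      of_real (u0 powr c / k) * (of_real (S u) * (of_real (\<phi>' u) * E u)))"
    by (rule Henstock_Kurzweil_Integration.integral_cong) (use split ab in auto)
  also have "\<dots> = of_real G * e0 * integral {T a..T b} (\<lambda>t. cis (2 * pi * t\<^sup>2)) +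
      of_real (u0 powr c / k) * integral {a..b} (\<lambda>u. of_real (S u) * (of_real (\<phi>' u) * E u))"
    by (intro integral_unique has_integral_add has_integral_mult_right M integrable_integral R)
  finally have I: "integral {a..b} (\<lambda>u. of_real (u powr c) * E u) = of_real G * e0 * integral {T a..T b} (\<lambda>t. cis (2 * pi * t\<^sup>2)) +
      of_real (u0 powr c / k) * integral {a..b} (\<lambda>u. of_real (S u) * (of_real (\<phi>' u) * E u))" .
  \<comment> \<open>In this form \<open>T\<close> visibly changes sign exactly at the
    saddle.\<close>
  have Ta: "T a = sqrt k * (a - u0) / sqrt a" "T b = sqrt k * (b - u0) / sqrt b"
    using ab by (simp_all add: T_def sA field_simps)
  have Ta0: "T a < 0 \<longleftrightarrow> a < u0" "T a \<noteq> 0" "0 < T b" "T a \<le> T b"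
  proof -
    show "T a < 0 \<longleftrightarrow> a < u0" unfolding Ta using k ab by (simp add: divide_less_0_iff mult_less_0_iff)
    show "T a \<noteq> 0" unfolding Ta using k ab a0 by simp
    show "0 < T b" unfolding Ta using k ab bu0 by simp
    show "T a \<le> T b" unfolding T_def using ab A k by (intro diff_mono mult_left_mono divide_left_mono) auto
  qed
  define F where "F = integral {T a..T b} (\<lambda>t. cis (2 * pi * t\<^sup>2)) - (if a < u0 then (1 + \<i>) / 2 else 0)"
  have F: "norm F \<le> 4 / \<bar>T a\<bar> + 4 / T b"
    unfolding F_def using fresnel_segment[OF Ta0(2,4,3)] by (simp only: Ta0(1))
  have Gpos: "G \<ge> 0" using u0 k by (simp add: G_def)
  have cb: "u0 powr c \<le> b powr c" using u0 bu0 c by (intro powr_mono2) auto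
  have quot: "G / (sqrt k * d / sqrt z) = (u0 powr c / k) * (sqrt (z * u0) / d)" if "0 < z" "0 < d" for z d
  proof -
    have "G / (sqrt k * d / sqrt z) = u0 powr c * (sqrt (z * u0) / d) / (sqrt k * sqrt k)"
    proof -
      have "(P * s / r) / (r * d / q) = P * (q * s / d) / (r * r)" if "0 < r" "0 < q" for P s r q :: real
        using that \<open>0 < d\<close> by (simp add: field_simps)
      then show ?thesis unfolding G_eq real_sqrt_mult using that k by simp
    qed
    then show ?thesis using k by simp
  qed
  have "\<bar>T a\<bar> = sqrt k * \<bar>a - u0\<bar> / sqrt a" using k ab by (simp add: Ta abs_mult)
  then have GTa: "G / \<bar>T a\<bar> = (u0 powr c / k) * (sqrt (a * u0) / \<bar>a - u0\<bar>)"
    using quot[of a "\<bar>a - u0\<bar>"] ab a0 by simp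
  have "G / T b = (u0 powr c / k) * (sqrt (b * u0) / (b - u0))"
    using quot[of b "b - u0"] ab bu0 by (simp add: Ta)
  also have "\<dots> \<le> (u0 powr c / k) * 4"
  proof (intro mult_left_mono)
    have "sqrt (b * u0) \<le> sqrt (b * b)" using bu0 ab by (intro real_sqrt_le_mono mult_left_mono) auto
    then have "sqrt (b * u0) \<le> b" using ab by simp
    also have "b \<le> 4 * (b - u0)" using b43 by simp
    finally show "sqrt (b * u0) / (b - u0) \<le> 4" using bu0 by (simp add: divide_le_eq)
  qed (use k in auto)
  finally have GTb: "G / T b \<le> (u0 powr c / k) * 4" .
  define X where "X = sqrt (a * u0) / \<bar>a - u0\<bar>"
  have X: "X \<ge> 0" using ab u0 by (simp add: X_def)
  have "integral {a..b} (\<lambda>u. of_real (u powr c) * E u) - (if a < u0 then of_real G * e0 * ((1 + \<i>) / 2) else 0)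
      = of_real G * e0 * F + of_real (u0 powr c / k) * integral {a..b} (\<lambda>u. of_real (S u) * (of_real (\<phi>' u) * E u))"
    unfolding I F_def by (simp add: algebra_simps)
  also have "norm \<dots> \<le> G * (4 / \<bar>T a\<bar> + 4 / T b) + (u0 powr c / k) * (24 * (b / u0) powr c)"
  proof (rule order_trans[OF norm_triangle_ineq], rule add_mono)
    show "norm (of_real G * e0 * F) \<le> G * (4 / \<bar>T a\<bar> + 4 / T b)"
      using mult_left_mono[OF F Gpos] Gpos by (simp add: norm_mult e0_def)
    show "norm (of_real (u0 powr c / k) * integral {a..b} (\<lambda>u. of_real (S u) * (of_real (\<phi>' u) * E u))) \<le> (u0 powr c / k) * (24 * (b / u0) powr c)"
      unfolding norm_mult norm_of_real using k by (intro mult_mono R(2)) auto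
  qed
  also have "(u0 powr c / k) * (24 * (b / u0) powr c) = 24 * (b powr c / k)"
    using u0 ab by (simp add: powr_divide)
  also have "G * (4 / \<bar>T a\<bar> + 4 / T b) = 4 * (G / \<bar>T a\<bar>) + 4 * (G / T b)" by (simp add: algebra_simps)
  also have "\<dots> \<le> 4 * ((u0 powr c / k) * X) + 4 * ((u0 powr c / k) * 4)"
    using GTa GTb by (simp add: X_def)
  also have "\<dots> = (u0 powr c / k) * (4 * X + 16)" by (simp add: algebra_simps)
  also have "\<dots> \<le> (b powr c / k) * (4 * X + 16)"
    using cb k X by (intro mult_right_mono divide_right_mono) auto
  also have "(b powr c / k) * (4 * X + 16) + 24 * (b powr c / k) \<le> 40 * (b powr c / k) * (1 + X)"
  proof -
    have "B * (4 * X + 16) + 24 * B \<le> 40 * B * (1 + X)" if "0 \<le> B * X" for B :: real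
      using that by (simp add: algebra_simps)
    from this[of "b powr c / k"] show ?thesis using k X by simp
  qed
  finally show ?thesis
    unfolding E_def \<phi>_def G_def e0_def X_def by simp
qed

section \<open>Divisor counts and harmonic sums\<close>

text \<open>Every divisor of \<open>p^a m\<close> is some \<open>p^i\<close> with
  \<open>i <= a\<close> times a divisor of \<open>m\<close>, and there are \<open>a + 1\<close>
  choices of \<open>i\<close>.\<close>

lemma divisor_count_prime_power_mult:
  fixes m p :: nat
  assumes "prime p" "m > 0"
  shows "card {d. d dvd p ^ a * m} \<le> (a + 1) * card {d. d dvd m}"
proof -
  have sub: "{d. d dvd p ^ a * m} \<subseteq> (\<lambda>(i, d). p ^ i * d) ` ({0..a} \<times> {d. d dvd m})"
  proof
    fix d assume "d \<in> {d. d dvd p ^ a * m}"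
    then obtain b c where bc: "d = b * c" "b dvd p ^ a" "c dvd m"
      using division_decomp[of d "p ^ a" m] by auto
    obtain i where "i \<le> a" "b = p ^ i"
      using bc(2) divides_primepow_nat[OF assms(1)] by blast
    with bc show "d \<in> (\<lambda>(i, d). p ^ i * d) ` ({0..a} \<times> {d. d dvd m})" by force
  qed
  have fin: "finite ({0..a} \<times> {d. d dvd m})" using assms by simp
  have "card {d. d dvd p ^ a * m} \<le> card ({0..a} \<times> {d. d dvd m})"
    by (rule order_trans[OF card_mono[OF finite_imageI[OF fin] sub] card_image_le[OF fin]])
  then show ?thesis by (simp add: card_cartesian_product)
qed

text \<open>One prime is removed at a time. For a prime of size at least
  \<open>2 powr (1 / \<delta>)\<close> the factor \<open>a + 1\<close> is at most
  \<open>2 ^ a\<close>, which \<open>p powr (a \<delta>)\<close> pays for; each of the boundedly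
  many smaller primes costs one factor \<open>C1\<close>.\<close>

lemma divisor_count_bound:
  fixes \<delta> :: real
  assumes "\<delta> > 0"
  obtains C where "C > 0" "\<And>n. n > 0 \<Longrightarrow> real (card {d. d dvd n}) \<le> C * real n powr \<delta>"
proof -
  define P where "P = nat \<lceil>2 powr (1 / \<delta>)\<rceil>"
  \<comment> \<open>Chosen so that \<open>a + 1 <= C1 (1 + a \<delta> ln 2)\<close>, where the
    bracket is at most \<open>2 powr (a \<delta>)\<close>.\<close>
  define C1 where "C1 = 1 + 1 / (\<delta> * ln 2)"
  have C1: "C1 \<ge> 1" using assms by (simp add: C1_def)
  define S where "S = (\<lambda>n::nat. {p. prime p \<and> p dvd n \<and> p < P})"
  have fS: "finite (S n)" for n by (rule finite_subset[of _ "{..<P}"]) (auto simp: S_def)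
  have *: "real (card {d. d dvd n}) \<le> C1 ^ card (S n) * real n powr \<delta>" if "n > 0" for n
    using that
  proof (induction n rule: less_induct)
    case (less n)
    show ?case
    proof (cases "n = 1")
      case True
      then have "S n = {}" by (auto simp: S_def dest: prime_gt_1_nat)
      then show ?thesis using True by simp
    next
      case False
      then obtain p where p: "prime p" "p dvd n" using prime_factor_nat by blast
      define a where "a = multiplicity p n"
      obtain m where m: "n = p ^ a * m" "\<not> p dvd m"
        using multiplicity_decompose'[of n p] less.prems p not_prime_unit a_def by (metis not_gr_zero)
      have a: "a \<ge> 1" using m p by (cases a) auto
      have m0: "m > 0" using m less.prems by (cases m) auto
      have p2: "p \<ge> 2" using p prime_ge_2_nat by blast
      have pa: "p ^ a \<ge> 2" using p2 a self_le_power[of p a] by linarith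
      have "m * 2 \<le> m * p ^ a" using pa by (intro mult_left_mono) auto
      then have mn: "m < n" using m0 m(1) by (simp add: mult.commute)
      have npow: "real n powr \<delta> = real p powr (real a * \<delta>) * real m powr \<delta>"
      proof -
        have "real n powr \<delta> = (real p ^ a) powr \<delta> * real m powr \<delta>"
          using m(1) by (simp add: powr_mult)
        also have "real p ^ a = real p powr real a" using p2 by (simp add: powr_realpow)
        finally show ?thesis by (simp only: powr_powr)
      qed
      have step: "real (card {d. d dvd n}) \<le> (real a + 1) * (C1 ^ card (S m) * real m powr \<delta>)"
      proof -
        have "real (card {d. d dvd n}) \<le> (real a + 1) * real (card {d. d dvd m})"
          using of_nat_mono[OF divisor_count_prime_power_mult[OF p(1) m0, of a], where 'a = real]
          unfolding m(1) of_nat_mult of_nat_add of_nat_1 .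
        also have "\<dots> \<le> (real a + 1) * (C1 ^ card (S m) * real m powr \<delta>)"
          using less.IH[OF mn m0] by (intro mult_left_mono) auto
        finally show ?thesis .
      qed
      have sub: "S m \<subseteq> S n" using m by (auto simp: S_def)
      have "(real a + 1) * C1 ^ card (S m) \<le> C1 ^ card (S n) * real p powr (real a * \<delta>)"
      proof (cases "p < P")
        case True
        have "card (insert p (S m)) \<le> card (S n)"
          using True sub p by (intro card_mono fS) (auto simp: S_def)
        moreover have "p \<notin> S m" using m by (auto simp: S_def)
        ultimately have "C1 ^ Suc (card (S m)) \<le> C1 ^ card (S n)"
          using C1 fS by (intro power_increasing) auto
        have "real a + 1 \<le> C1 * (1 + real a * \<delta> * ln 2)"
        proof -
          have "C1 * (\<delta> * ln 2) \<ge> 1" using assms by (simp add: C1_def field_simps)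
          then have "real a * (C1 * (\<delta> * ln 2)) \<ge> real a * 1" by (intro mult_left_mono) auto
          then show ?thesis using C1 by (simp add: algebra_simps)
        qed
        also have "1 + real a * \<delta> * ln 2 \<le> 2 powr (real a * \<delta>)"
          using exp_ge_add_one_self[of "real a * \<delta> * ln 2"] by (simp add: powr_def mult.commute)
        also have "(2::real) powr (real a * \<delta>) \<le> real p powr (real a * \<delta>)"
          using p2 assms by (intro powr_mono2) auto
        finally have "real a + 1 \<le> C1 * real p powr (real a * \<delta>)" using C1 by simp
        then have "(real a + 1) * C1 ^ card (S m) \<le> C1 * real p powr (real a * \<delta>) * C1 ^ card (S m)"
          using C1 by (intro mult_right_mono) auto
        also have "\<dots> = C1 ^ Suc (card (S m)) * real p powr (real a * \<delta>)" by simp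
        also have "\<dots> \<le> C1 ^ card (S n) * real p powr (real a * \<delta>)"
          using \<open>C1 ^ Suc (card (S m)) \<le> C1 ^ card (S n)\<close> by (intro mult_right_mono) auto
        finally show ?thesis .
      next
        case False
        then have "2 powr (1 / \<delta>) \<le> real p" unfolding P_def by linarith
        then have "(2 powr (1 / \<delta>)) powr (real a * \<delta>) \<le> real p powr (real a * \<delta>)"
          using assms by (intro powr_mono2) auto
        then have "2 ^ a \<le> real p powr (real a * \<delta>)"
          using assms by (simp add: powr_powr powr_realpow)
        moreover have "real a + 1 \<le> 2 ^ a"
        proof -
          have "a + 1 \<le> 2 ^ a" using less_exp[of a] by linarith
          then have "real (a + 1) \<le> real (2 ^ a)" by (simp only: of_nat_le_iff)
          then show ?thesis by simp
        qed
        moreover have "C1 ^ card (S m) \<le> C1 ^ card (S n)"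
          using C1 sub by (intro power_increasing card_mono fS) auto
        ultimately have "(real a + 1) * C1 ^ card (S m) \<le> real p powr (real a * \<delta>) * C1 ^ card (S n)"
          using C1 by (intro mult_mono) auto
        then show ?thesis by (simp add: mult.commute)
      qed
      then have "((real a + 1) * C1 ^ card (S m)) * real m powr \<delta> \<le> (C1 ^ card (S n) * real p powr (real a * \<delta>)) * real m powr \<delta>"
        by (intro mult_right_mono) auto
      with step npow show ?thesis by (simp add: mult.assoc)
    qed
  qed
  show thesis
  proof (rule that)
    show "C1 ^ P > 0" using C1 by simp
    fix n :: nat assume n: "n > 0"
    have "card (S n) \<le> card {..<P}" by (intro card_mono) (auto simp: S_def)
    then have "C1 ^ card (S n) \<le> C1 ^ P" using C1 by (intro power_increasing) auto
    then have "C1 ^ card (S n) * real n powr \<delta> \<le> C1 ^ P * real n powr \<delta>" by (intro mult_right_mono) auto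
    with *[OF n] show "real (card {d. d dvd n}) \<le> C1 ^ P * real n powr \<delta>" by linarith
  qed
qed

lemma harmonic_sum_le:
  assumes "K \<ge> 1"
  shows "(\<Sum>k=1..K. 1 / real k) \<le> 1 + ln (real K)"
  using assms
proof (induction K rule: dec_induct)
  case (step K)
  have "ln (real K / real (Suc K)) \<le> real K / real (Suc K) - 1"
    using step by (intro ln_le_minus_one) auto
  then have "1 / real (Suc K) \<le> ln (real (Suc K)) - ln (real K)"
    using step by (simp add: ln_div field_simps)
  then show ?case using step by simp
qed simp

text \<open>On either side of \<open>x\<close> the integers lie at distances at least 0, 1, 2, and
  so on, so two harmonic sums bound the total.\<close>

lemma sum_inverse_distance_le:
  fixes x :: real
  assumes x: "0 \<le> x" "x \<le> real M"
  shows "(\<Sum>n\<in>{n\<in>{1..M}. 1 / 2 \<le> \<bar>x - real n\<bar>}. 1 / \<bar>x - real n\<bar>) \<le> 6 * (1 + ln (real M + 1))"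
proof -
  define n0 where "n0 = nat \<lfloor>x\<rfloor>"
  have n0: "real n0 \<le> x" "x < real n0 + 1" "n0 \<le> M" using x by (auto simp: n0_def) linarith+
  define f where "f = (\<lambda>n. if 1 / 2 \<le> \<bar>x - real n\<bar> then 1 / \<bar>x - real n\<bar> else 0)"
  have inv: "f n \<le> 3 / real (Suc i)" if "real i \<le> \<bar>x - real n\<bar>" for n i
  proof (cases "1 / 2 \<le> \<bar>x - real n\<bar>")
    case True
    \<comment> \<open>For \<open>i = 0\<close> the minimal distance 1/2 is used, for larger
      \<open>i\<close> the distance \<open>i\<close>; the factor 3 covers both.\<close>
    have "real (Suc i) / 3 \<le> \<bar>x - real n\<bar>" using that True by (cases i) auto
    then have "1 / \<bar>x - real n\<bar> \<le> 1 / (real (Suc i) / 3)" using True by (intro divide_left_mono mult_pos_pos) auto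
    then show ?thesis using True by (simp add: f_def)
  qed (simp add: f_def)
  have harm: "(\<Sum>i\<le>m. 3 / real (Suc i)) \<le> 3 * (1 + ln (real M + 1))" if "m \<le> M" for m
  proof -
    have "(\<Sum>i\<le>m. 3 / real (Suc i)) = 3 * (\<Sum>k=1..Suc m. 1 / real k)"
      by (induction m) (simp_all add: distrib_left)
    also have "\<dots> \<le> 3 * (1 + ln (real (Suc m)))"
      by (intro mult_left_mono harmonic_sum_le) auto
    also have "\<dots> \<le> 3 * (1 + ln (real M + 1))"
      using that by auto
    finally show ?thesis .
  qed
  have "(\<Sum>n\<in>{n\<in>{1..M}. 1 / 2 \<le> \<bar>x - real n\<bar>}. 1 / \<bar>x - real n\<bar>) = (\<Sum>n\<in>{1..M}. f n)"
    unfolding f_def by (rule sum.inter_filter) simp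
  also have "\<dots> \<le> (\<Sum>n\<in>{..n0} \<union> {Suc n0..Suc (n0 + M)}. f n)"
    by (rule sum_mono2) (auto simp: f_def)
  also have "\<dots> = (\<Sum>n\<le>n0. f n) + (\<Sum>n=Suc n0..Suc (n0 + M). f n)"
    by (rule sum.union_disjoint) auto
  also have "(\<Sum>n\<le>n0. f n) = (\<Sum>i\<le>n0. f (n0 - i))"
    using sum.nat_diff_reindex[of f "Suc n0"] by (simp add: lessThan_Suc_atMost)
  also have "\<dots> \<le> (\<Sum>i\<le>n0. 3 / real (Suc i))"
    by (intro sum_mono inv) (use n0 in \<open>auto simp: of_nat_diff\<close>)
  also have "\<dots> \<le> 3 * (1 + ln (real M + 1))" by (rule harm) (use n0 in auto)
  also have "(\<Sum>n=Suc n0..Suc (n0 + M). f n) = (\<Sum>i\<le>M. f (Suc n0 + i))"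
    by (rule sum.reindex_bij_witness[where i = "\<lambda>i. Suc n0 + i" and j = "\<lambda>n. n - Suc n0"]) auto
  also have "\<dots> \<le> (\<Sum>i\<le>M. 3 / real (Suc i))"
    by (intro sum_mono inv) (use n0 in \<open>auto simp: of_nat_diff\<close>)
  also have "\<dots> \<le> 3 * (1 + ln (real M + 1))" by (rule harm) auto
  finally show ?thesis by simp
qed

section \<open>Analytic continuation of the zeta function\<close>

text \<open>Writing $w = 1 - s$, the binomial expansion of $(n+1)^w$ telescopes to a recursion expressing
  $(s-1)\zeta(s)$ through its values at $s+1, s+2, \dots$; this continues it one unit to the left.\<close>

definition binom_rem :: "nat \<Rightarrow> nat \<Rightarrow> complex \<Rightarrow> complex" where
  "binom_rem J n w = of_nat (n + 2) powr w - (\<Sum>j\<le>J. (w gchoose j) * of_nat (n + 1) powr (w - of_nat j))"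

lemma powr_nat_deriv_chain:
  fixes x w :: complex
  assumes "x \<noteq> 0" "x \<notin> \<real>\<^sub>\<le>\<^sub>0"
  shows "((\<lambda>x. fact i * (w gchoose i) * x powr (w - of_nat i)) has_field_derivative
           fact (Suc i) * (w gchoose (Suc i)) * x powr (w - of_nat (Suc i))) (at x within A)"
proof -
  have "((\<lambda>x. fact i * (w gchoose i) * x powr (w - of_nat i)) has_field_derivative
           fact i * (w gchoose i) * ((w - of_nat i) * x powr (w - of_nat i - 1))) (at x within A)"
    using assms(2) by (intro DERIV_cmult has_field_derivative_at_within[OF has_field_derivative_powr])
  moreover have E: "(w gchoose i) * (w - of_nat i) = of_nat (Suc i) * (w gchoose (Suc i))"
    using gbinomial_absorb_comp[of w i] gbinomial_mult_1[of w i] by (simp add: algebra_simps)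
  have "fact i * (w gchoose i) * ((w - of_nat i) * x powr (w - of_nat i - 1)) =
     fact i * ((w gchoose i) * (w - of_nat i)) * x powr (w - of_nat (Suc i))"
    by (simp add: algebra_simps)
  then have "fact i * (w gchoose i) * ((w - of_nat i) * x powr (w - of_nat i - 1)) =
     fact (Suc i) * (w gchoose (Suc i)) * x powr (w - of_nat (Suc i))"
    unfolding E by (simp only: fact_Suc mult_ac)
  ultimately show ?thesis by metis
qed

text \<open>Taylor's theorem on the segment from \<open>n + 1\<close> to \<open>n + 2\<close>. Its
  points are at most twice \<open>n + 1\<close>, which the power of 2 absorbs; \<open>B\<close> and
  \<open>R\<close> are parameters so that the bound becomes uniform on compact sets.\<close>

lemma binom_rem_bound:
  assumes B: "norm (w gchoose (Suc J)) \<le> B" "\<bar>Re w\<bar> \<le> R"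
  shows "norm (binom_rem J n w) \<le> real (J + 1) * B * 2 powr (R + real J + 1) * real (n + 1) powr (Re w - real J - 1)"
proof -
  let ?f = "\<lambda>i x. fact i * (w gchoose i) * x powr (w - of_nat i)"
  define S where "S = complex_of_real ` {real (n + 1)..real (n + 2)}"
  have S: "x \<in> S \<Longrightarrow> \<exists>r. x = of_real r \<and> real (n + 1) \<le> r \<and> r \<le> real (n + 2)" for x
    by (auto simp: S_def)
  have "norm (?f 0 (of_nat (n + 2)) - (\<Sum>i\<le>J. ?f i (of_nat (n + 1)) * (of_nat (n + 2) - of_nat (n + 1)) ^ i / fact i))
    \<le> (fact (Suc J) * B * 2 powr (R + real J + 1) * real (n + 1) powr (Re w - real J - 1)) *
        norm (of_nat (n + 2) - of_nat (n + 1) :: complex) ^ Suc J / fact J"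
  proof (rule complex_Taylor)
    show "convex S" unfolding S_def
      by (rule convex_linear_image) (auto simp: linear_iff scaleR_conv_of_real)
    show "(?f i has_field_derivative ?f (Suc i) x) (at x within S)" if "x \<in> S" for i x
      using S[OF that] by (intro powr_nat_deriv_chain) auto
    show "of_nat (n + 2) \<in> S" "of_nat (n + 1) \<in> S"
      unfolding S_def
      by (rule image_eqI[where x = "real (n + 2)"]; simp; fail) (rule image_eqI[where x = "real (n + 1)"]; simp)
    show "norm (?f (Suc J) x) \<le> fact (Suc J) * B * 2 powr (R + real J + 1) * real (n + 1) powr (Re w - real J - 1)"
      if xS: "x \<in> S" for x
    proof -
      obtain r where r: "x = of_real r" "real (n + 1) \<le> r" "r \<le> real (n + 2)" using S[OF xS] by blast
      define e where "e = Re w - real J - 1"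
      have "norm (x powr (w - of_nat (Suc J))) = r powr e"
        using r by (simp add: norm_powr_real_powr e_def algebra_simps)
      also have "r powr e = (r / real (n + 1)) powr e * real (n + 1) powr e"
        using r by (simp add: powr_divide)
      also have "(r / real (n + 1)) powr e \<le> 2 powr (R + real J + 1)"
      proof -
        have q: "1 \<le> r / real (n + 1)" "r / real (n + 1) \<le> 2" using r by (auto simp: field_simps)
        have "(r / real (n + 1)) powr e \<le> (r / real (n + 1)) powr (R + real J + 1)"
          using q B(2) by (intro powr_mono) (auto simp: e_def)
        also have "\<dots> \<le> 2 powr (R + real J + 1)"
          using q B(2) by (intro powr_mono2) auto
        finally show ?thesis .
      qed
      finally have "norm (x powr (w - of_nat (Suc J))) \<le> 2 powr (R + real J + 1) * real (n + 1) powr e"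
        by (simp add: mult_right_mono)
      then have "norm (w gchoose Suc J) * norm (x powr (w - of_nat (Suc J))) \<le> B * (2 powr (R + real J + 1) * real (n + 1) powr e)"
        using B(1) by (intro mult_mono) (auto intro: order_trans[OF norm_ge_zero])
      then have "fact (Suc J) * (norm (w gchoose Suc J) * norm (x powr (w - of_nat (Suc J)))) \<le> fact (Suc J) * (B * (2 powr (R + real J + 1) * real (n + 1) powr e))"
        by (intro mult_left_mono) auto
      then show ?thesis by (simp add: norm_mult e_def mult.assoc del: fact_Suc of_nat_Suc) 
    qed
  qed
  also have "?f 0 (of_nat (n + 2)) - (\<Sum>i\<le>J. ?f i (of_nat (n + 1)) * (of_nat (n + 2) - of_nat (n + 1)) ^ i / fact i) = binom_rem J n w"
    by (simp add: binom_rem_def)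
  finally have "norm (binom_rem J n w) \<le> (fact (Suc J) / fact J) * B * 2 powr (R + real J + 1) * real (n + 1) powr (Re w - real J - 1)"
    by simp
  also have "fact (Suc J) / fact J = real (J + 1)" by (simp add: field_simps)
  finally show ?thesis .
qed

text \<open>Summable majorants on compact sets give locally uniform convergence, which preserves
  holomorphy.\<close>

lemma holomorphic_suminf:
  fixes f :: "nat \<Rightarrow> complex \<Rightarrow> complex"
  assumes S: "open S" and hol: "\<And>n. f n holomorphic_on S"
    and bound: "\<And>K. compact K \<Longrightarrow> K \<subseteq> S \<Longrightarrow> \<exists>M. summable M \<and> (\<forall>n. \<forall>z\<in>K. norm (f n z) \<le> M n)"
  shows "(\<lambda>z. \<Sum>n. f n z) holomorphic_on S" and "\<And>z. z \<in> S \<Longrightarrow> summable (\<lambda>n. f n z)"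
proof -
  show "summable (\<lambda>n. f n z)" if "z \<in> S" for z
    using bound[of "{z}"] that by (auto intro: summable_comparison_test')
  show "(\<lambda>z. \<Sum>n. f n z) holomorphic_on S"
  proof (rule holomorphic_uniform_sequence[OF S, where f = "\<lambda>n z. \<Sum>i<n. f i z"])
    show "(\<lambda>z. \<Sum>i<n. f i z) holomorphic_on S" for n by (intro holomorphic_intros hol)
    fix z assume "z \<in> S"
    then obtain d where d: "d > 0" "cball z d \<subseteq> S" using S open_contains_cball by blast
    obtain M where M: "summable M" "\<And>n w. w \<in> cball z d \<Longrightarrow> norm (f n w) \<le> M n"
      using bound[OF compact_cball d(2)] by blast
    have "uniform_limit (cball z d) (\<lambda>n z. \<Sum>i<n. f i z) (\<lambda>z. \<Sum>n. f n z) sequentially"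
      by (rule Weierstrass_m_test[OF _ M(1)]) (use M(2) in auto)
    with d show "\<exists>d. 0 < d \<and> cball z d \<subseteq> S \<and> uniform_limit (cball z d) (\<lambda>n z. \<Sum>i<n. f i z) (\<lambda>z. \<Sum>n. f n z) sequentially"
      by blast
  qed
qed

lemma compact_Re_bounds:
  assumes "compact K" "K \<subseteq> {s. Re s > c}"
  obtains d R where "d > c" "\<And>s. s \<in> K \<Longrightarrow> Re s \<ge> d" "\<And>s. s \<in> K \<Longrightarrow> norm s \<le> R" "R \<ge> 0"
proof (cases "K = {}")
  case True then show ?thesis using that[of "c + 1" 0] by simp
next
  case False
  obtain s0 where s0: "s0 \<in> K" "\<And>s. s \<in> K \<Longrightarrow> Re s0 \<le> Re s"
    using continuous_attains_inf[OF assms(1) False continuous_on_Re[OF continuous_on_id]] by blast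
  obtain R where R: "\<And>s. s \<in> K \<Longrightarrow> norm s \<le> R" 
    using compact_imp_bounded[OF assms(1)] by (auto simp: bounded_iff)
  show ?thesis
  proof (rule that[of "Re s0" "R"])
    show "R \<ge> 0" using R[OF s0(1)] norm_ge_zero order_trans by blast
  qed (use s0 R assms(2) in auto)
qed

definition dirichlet_zeta :: "complex \<Rightarrow> complex" where
  "dirichlet_zeta s = (\<Sum>n. of_nat (Suc n) powr (- s))"

lemma dirichlet_zeta_holomorphic: "dirichlet_zeta holomorphic_on {s. Re s > 1}"
  and dirichlet_zeta_summable: "\<And>s. Re s > 1 \<Longrightarrow> summable (\<lambda>n. of_nat (Suc n) powr (- s) :: complex)"
proof -
  have b: "\<exists>M. summable M \<and> (\<forall>n. \<forall>z\<in>K. norm (of_nat (Suc n) powr (- z) :: complex) \<le> M n)"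
    if K: "compact K" "K \<subseteq> {s. Re s > 1}" for K
  proof -
    obtain d R where d: "d > 1" "\<And>s. s \<in> K \<Longrightarrow> Re s \<ge> d"
      using compact_Re_bounds[OF K] by metis
    have "summable (\<lambda>n. real (Suc n) powr (- d))"
      using d(1) by (subst summable_Suc_iff) (simp add: summable_real_powr_iff)
    moreover have "norm (of_nat (Suc n) powr (- z) :: complex) \<le> real (Suc n) powr (- d)" if "z \<in> K" for z n
    proof -
      have "norm (of_nat (Suc n) powr (- z) :: complex) = real (Suc n) powr (- Re z)"
        using norm_powr_real_powr[of "of_nat (Suc n)" "- z"] by simp
      also have "\<dots> \<le> real (Suc n) powr (- d)" using d(2)[OF that] by (intro powr_mono) auto
      finally show ?thesis .
    qed
    ultimately show ?thesis by blast
  qed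
  have h: "(\<lambda>s. of_nat (Suc n) powr (- s) :: complex) holomorphic_on {s. Re s > 1}" for n
    by (intro holomorphic_intros)
  note H = holomorphic_suminf[OF open_halfspace_Re_gt h b]
  show "dirichlet_zeta holomorphic_on {s. Re s > 1}" using H(1) unfolding dirichlet_zeta_def .
  show "summable (\<lambda>n. of_nat (Suc n) powr (- s) :: complex)" if "Re s > 1" for s using H(2)[of s] that by simp
qed

lemma gbinomial_holomorphic [holomorphic_intros]:
  "f holomorphic_on S \<Longrightarrow> (\<lambda>s. f s gchoose j) holomorphic_on S"
  unfolding gbinomial_prod_rev by (intro holomorphic_intros) auto

text \<open>With \<open>w = 1 - s\<close> the remainder is bounded by a multiple of
  \<open>n powr (- Re s - J)\<close>, so each further Taylor term gains one unit of
  half-plane.\<close>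

lemma binom_rem_series_holomorphic:
  "(\<lambda>s. \<Sum>n. binom_rem J n (1 - s)) holomorphic_on {s. Re s > 1 - real J}" (is ?A)
  and binom_rem_summable: "Re s > 1 - real J \<Longrightarrow> summable (\<lambda>n. binom_rem J n (1 - s))"
proof -
  have b: "\<exists>M. summable M \<and> (\<forall>n. \<forall>s\<in>K. norm (binom_rem J n (1 - s)) \<le> M n)"
    if K: "compact K" "K \<subseteq> {s. Re s > 1 - real J}" for K
  proof -
    obtain d R where d: "d > 1 - real J" "\<And>s. s \<in> K \<Longrightarrow> Re s \<ge> d" "\<And>s. s \<in> K \<Longrightarrow> norm s \<le> R" "R \<ge> 0"
      using compact_Re_bounds[OF K] by metis
    have "(\<lambda>s. (1 - s) gchoose (Suc J)) holomorphic_on UNIV" by (intro holomorphic_intros)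
    then have "continuous_on K (\<lambda>s. (1 - s) gchoose (Suc J))"
      using holomorphic_on_imp_continuous_on continuous_on_subset by blast
    then have "bounded ((\<lambda>s. (1 - s) gchoose (Suc J)) ` K)"
      using K(1) compact_continuous_image compact_imp_bounded by blast
    then obtain B where B: "\<And>s. s \<in> K \<Longrightarrow> norm ((1 - s) gchoose (Suc J)) \<le> B"
      by (auto simp: bounded_iff)
    define C where "C = real (J + 1) * B * 2 powr (R + 1 + real J + 1)"
    have "summable (\<lambda>n. C * real (Suc n) powr (- d - real J))"
      using d(1) by (intro summable_mult, subst summable_Suc_iff) (simp add: summable_real_powr_iff)
    moreover have "norm (binom_rem J n (1 - s)) \<le> C * real (Suc n) powr (- d - real J)" if "s \<in> K" for s n
    proof -
      have "\<bar>Re s\<bar> \<le> R" using d(3)[OF that] abs_Re_le_cmod[of s] by linarith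
      then have "norm (binom_rem J n (1 - s)) \<le> C * real (n + 1) powr (Re (1 - s) - real J - 1)"
        unfolding C_def by (intro binom_rem_bound B that) auto
      also have "\<dots> \<le> C * real (n + 1) powr (- d - real J)"
      proof (intro mult_left_mono powr_mono)
        have "B \<ge> 0" using B[OF that] norm_ge_zero order_trans by blast
        then show "0 \<le> C" by (simp add: C_def)
      qed (use d(2)[OF that] in auto)
      finally show ?thesis by simp
    qed
    ultimately show ?thesis by blast
  qed
  have h: "(\<lambda>s. binom_rem J n (1 - s)) holomorphic_on {s. Re s > 1 - real J}" for n
    unfolding binom_rem_def by (intro holomorphic_intros)
  note H = holomorphic_suminf[OF open_halfspace_Re_gt h b]
  show ?A using H(1) .
  show "summable (\<lambda>n. binom_rem J n (1 - s))" if "Re s > 1 - real J" using H(2)[of s] that by simp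
qed

text \<open>The differences of consecutive powers sum to -1. In their expansion the term
  \<open>j = 1\<close> is \<open>1 - s\<close> times the series at \<open>s\<close>, and every later
  term is a value at least one unit further to the right.\<close>

lemma dirichlet_zeta_recursion:
  assumes s: "Re s > 1" and J: "J \<ge> 1"
  shows "(s - 1) * dirichlet_zeta s = 1 + (\<Sum>j=2..J. ((1 - s) gchoose j) * dirichlet_zeta (s + of_nat j - 1))
           + (\<Sum>n. binom_rem J n (1 - s))"
proof -
  define w where "w = 1 - s"
  have tele: "(\<lambda>n. of_nat (Suc (Suc n)) powr w - of_nat (Suc n) powr w :: complex) sums (0 - of_nat (Suc 0) powr w)"
  proof (rule telescope_sums)
    have "((\<lambda>n. real (Suc n) powr Re w) \<longlongrightarrow> 0) sequentially"
      using s by (intro tendsto_neg_powr filterlim_compose[OF filterlim_real_sequentially] filterlim_Suc) (auto simp: w_def)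
    then have "((\<lambda>n. norm (of_nat (Suc n) powr w :: complex)) \<longlongrightarrow> 0) sequentially"
      using norm_powr_real_powr[of "of_nat (Suc n)" w for n] by simp
    then show "((\<lambda>n. of_nat (Suc n) powr w :: complex) \<longlongrightarrow> 0) sequentially"
      by (rule tendsto_norm_zero_cancel)
  qed
  have z: "(\<lambda>n. (w gchoose j) * of_nat (Suc n) powr (w - of_nat j)) sums ((w gchoose j) * dirichlet_zeta (s + of_nat j - 1))"
    if "j \<ge> 1" for j
  proof (rule sums_mult)
    have "Re (s + of_nat j - 1) > 1" using s that by simp
    from summable_sums[OF dirichlet_zeta_summable[OF this]]
    show "(\<lambda>n. of_nat (Suc n) powr (w - of_nat j)) sums dirichlet_zeta (s + of_nat j - 1)"
      unfolding dirichlet_zeta_def by (simp add: w_def algebra_simps)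
  qed
  have "(\<lambda>n. (of_nat (Suc (Suc n)) powr w - of_nat (Suc n) powr w) - (\<Sum>j=1..J. (w gchoose j) * of_nat (Suc n) powr (w - of_nat j)))
      sums ((0 - of_nat (Suc 0) powr w) - (\<Sum>j=1..J. (w gchoose j) * dirichlet_zeta (s + of_nat j - 1)))"
    by (intro sums_diff tele sums_sum z) auto
  also have "(\<lambda>n. (of_nat (Suc (Suc n)) powr w - of_nat (Suc n) powr w) - (\<Sum>j=1..J. (w gchoose j) * of_nat (Suc n) powr (w - of_nat j)))
      = (\<lambda>n. binom_rem J n w)"
  proof
    fix n
    have "{..J} = insert 0 {1..J}" by auto
    then show "(of_nat (Suc (Suc n)) powr w - of_nat (Suc n) powr w) - (\<Sum>j=1..J. (w gchoose j) * of_nat (Suc n) powr (w - of_nat j)) = binom_rem J n w"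
      by (simp add: binom_rem_def algebra_simps)
  qed
  finally have "(\<Sum>n. binom_rem J n w) = - 1 - (\<Sum>j=1..J. (w gchoose j) * dirichlet_zeta (s + of_nat j - 1))"
    by (simp add: sums_iff)
  also have "(\<Sum>j=1..J. (w gchoose j) * dirichlet_zeta (s + of_nat j - 1)) =
      w * dirichlet_zeta s + (\<Sum>j=2..J. (w gchoose j) * dirichlet_zeta (s + of_nat j - 1))"
    using J by (subst sum.atLeast_Suc_atMost) (auto simp: numeral_2_eq_2)
  finally show ?thesis by (simp add: w_def algebra_simps)
qed

text \<open>Multiplying the series by \<open>s - 1\<close> removes the pole, so that this product
  can be continued one unit to the left at a time through values already available.\<close>

lemma zeta_continuation_halfplane:
  "\<exists>g. g holomorphic_on {s. Re s > 1 - real m} \<and> (\<forall>s. Re s > 1 \<longrightarrow> g s = (s - 1) * dirichlet_zeta s)"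
proof (induction m)
  case 0
  show ?case
    by (intro exI[of _ "\<lambda>s. (s - 1) * dirichlet_zeta s"]) (auto intro!: holomorphic_intros dirichlet_zeta_holomorphic)
next
  case (Suc m)
  then obtain g where g: "g holomorphic_on {s. Re s > 1 - real m}"
    and g_eq: "\<And>s. Re s > 1 \<Longrightarrow> g s = (s - 1) * dirichlet_zeta s" by blast
  define J where "J = Suc m"
  \<comment> \<open>On the right half-plane \<open>g (s + j - 1)\<close> is \<open>s + j - 2\<close>
    times the series. Up to sign, \<open>s + j - 2\<close> is the last factor of
    \<open>(1 - s) gchoose j\<close>; trading it for \<open>g\<close> avoids any quotient with a
    pole.\<close>
  define h where "h = (\<lambda>s. 1 - (\<Sum>j=2..J. ((1 - s) gchoose (j - 1)) / of_nat j * g (s + of_nat j - 1))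
     + (\<Sum>n. binom_rem J n (1 - s)))"
  have "(\<lambda>s. g (s + of_nat j - 1)) holomorphic_on {s. Re s > 1 - real (Suc m)}" if "j \<in> {2..J}" for j
    by (rule holomorphic_on_compose_gen[OF _ g, of "\<lambda>s. s + of_nat j - 1", unfolded o_def])
      (use that in \<open>auto intro!: holomorphic_intros\<close>)
  moreover have "(\<lambda>s. \<Sum>n. binom_rem J n (1 - s)) holomorphic_on {s. Re s > 1 - real (Suc m)}"
    using binom_rem_series_holomorphic[of J] by (simp add: J_def)
  ultimately have "h holomorphic_on {s. Re s > 1 - real (Suc m)}"
    unfolding h_def by (intro holomorphic_intros) auto
  moreover have "h s = (s - 1) * dirichlet_zeta s" if s: "Re s > 1" for s
  proof -
    have "((1 - s) gchoose (j - 1)) / of_nat j * g (s + of_nat j - 1) =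
        - (((1 - s) gchoose j) * dirichlet_zeta (s + of_nat j - 1))" if j: "j \<in> {2..J}" for j
    proof -
      obtain i where i: "j = Suc i" "i \<ge> 1" using j by (cases j) auto
      have "((1 - s) gchoose j) = ((1 - s) gchoose i) * (1 - s - of_nat i) / of_nat j"
        using gbinomial_absorb_comp[of "1 - s" i] gbinomial_mult_1[of "1 - s" i] i
        by (simp add: field_simps del: of_nat_Suc)
      moreover have "g (s + of_nat j - 1) = (s + of_nat i - 1) * dirichlet_zeta (s + of_nat j - 1)"
        using i s by (subst g_eq) (auto simp: algebra_simps)
      moreover have "B / q * ((s + of_nat i - 1) * d) = - (B * (1 - s - of_nat i) / q * d)" for B q d :: complex
        by (simp add: algebra_simps diff_divide_distrib add_divide_distrib)
      ultimately show ?thesis using i by (simp del: of_nat_Suc)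
    qed
    then have "h s = 1 + (\<Sum>j=2..J. ((1 - s) gchoose j) * dirichlet_zeta (s + of_nat j - 1)) + (\<Sum>n. binom_rem J n (1 - s))"
      by (simp add: h_def sum_negf)
    then show ?thesis using dirichlet_zeta_recursion[OF s, of J] by (simp add: J_def)
  qed
  ultimately show ?case by blast
qed

lemma halfplane_identity:
  assumes "f holomorphic_on {s. Re s > c}" "g holomorphic_on {s. Re s > c}" "c \<le> 1"
    and "\<And>s. Re s > 1 \<Longrightarrow> f s = g s" and "Re z > c"
  shows "f z = g z"
proof (rule analytic_continuation_open[of "{s. Re s > 1}" "{s. Re s > c}" f g z])
  have "2 \<in> {s. Re s > 1}" by simp
  then show "{s. Re s > 1} \<noteq> {}" by blast
qed (use assms in \<open>auto intro!: open_halfspace_Re_gt convex_connected convex_halfspace_Re_gt\<close>)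

lemma zeta_continuation:
  obtains G where "G holomorphic_on UNIV" "\<And>s. Re s > 1 \<Longrightarrow> G s = (s - 1) * dirichlet_zeta s"
proof -
  obtain g where g: "\<And>m. g m holomorphic_on {s. Re s > 1 - real m}"
    and g_eq: "\<And>m s. Re s > 1 \<Longrightarrow> g m s = (s - 1) * dirichlet_zeta s"
    using zeta_continuation_halfplane by metis
  have le: "g m s = g n s" if "Re s > 1 - real m" "m \<le> n" for m n s
    by (rule halfplane_identity[where c = "1 - real m"])
      (use that g g_eq in \<open>auto intro: holomorphic_on_subset[OF g]\<close>)
  \<comment> \<open>Any index \<open>m\<close> with \<open>1 - m < Re s\<close> gives the same
    value; this one always qualifies.\<close>
  define G where "G = (\<lambda>s. g (nat \<lceil>2 - Re s\<rceil>) s)"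
  have G: "G s = g m s" if "Re s > 1 - real m" for m s
  proof -
    have "Re s > 1 - real (nat \<lceil>2 - Re s\<rceil>)" by linarith
    then show ?thesis
      using le[of m s "nat \<lceil>2 - Re s\<rceil>"] le[of "nat \<lceil>2 - Re s\<rceil>" s m] that
      unfolding G_def by (cases "m \<le> nat \<lceil>2 - Re s\<rceil>") auto
  qed
  have "G holomorphic_on (\<Union>m. {s. Re s > 1 - real m})"
  proof (rule holomorphic_on_UN_open)
    show "G holomorphic_on {s. Re s > 1 - real m}" for m
      by (rule holomorphic_transform[OF g]) (simp add: G)
  qed (auto intro: open_halfspace_Re_gt)
  moreover have "s \<in> (\<Union>m. {s. Re s > 1 - real m})" for s
    using reals_Archimedean2[of "1 - Re s"] by (auto simp: algebra_simps)
  then have "(\<Union>m. {s. Re s > 1 - real m}) = UNIV" by blast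
  ultimately have "G holomorphic_on UNIV" by simp
  moreover have "G s = (s - 1) * dirichlet_zeta s" if "Re s > 1" for s
    using G[of 0 s] g_eq[of s 0] that by simp
  ultimately show ?thesis by (rule that)
qed

text \<open>This gives meaning to the description that defines \<open>zeta\<close>. Uniqueness rests
  on the connectedness of the plane without 1, with the value at 1 fixed by convention.\<close>

lemma zeta_unique_existence:
  "\<exists>!f. f holomorphic_on (- {1}) \<and> (\<forall>s. 1 < Re s \<longrightarrow> (\<lambda>n. of_nat (Suc n) powr (- s)) sums f s) \<and> f 1 = 0"
proof -
  obtain G where G: "G holomorphic_on UNIV" "\<And>s. Re s > 1 \<Longrightarrow> G s = (s - 1) * dirichlet_zeta s"
    using zeta_continuation by blast
  define f where "f = (\<lambda>s. if s = 1 then 0 else G s / (s - 1))"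
  show ?thesis
  proof (rule ex1I[of _ f])
    have "(\<lambda>s. G s / (s - 1)) holomorphic_on - {1}"
      by (intro holomorphic_intros holomorphic_on_subset[OF G(1)]) auto
    then have "f holomorphic_on - {1}" by (rule holomorphic_transform) (simp add: f_def)
    moreover have "(\<lambda>n. of_nat (Suc n) powr (- s)) sums f s" if "1 < Re s" for s
    proof -
      have "f s = dirichlet_zeta s" using that G(2)[of s] by (auto simp: f_def)
      then show ?thesis using summable_sums[OF dirichlet_zeta_summable[OF that]] by (simp add: dirichlet_zeta_def)
    qed
    ultimately show f: "f holomorphic_on (- {1}) \<and> (\<forall>s. 1 < Re s \<longrightarrow> (\<lambda>n. of_nat (Suc n) powr (- s)) sums f s) \<and> f 1 = 0"
      by (simp add: f_def)
    fix h :: "complex \<Rightarrow> complex"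
    assume h: "h holomorphic_on (- {1}) \<and> (\<forall>s. 1 < Re s \<longrightarrow> (\<lambda>n. of_nat (Suc n) powr (- s)) sums h s) \<and> h 1 = 0"
    show "h = f"
    proof
      fix z
      show "h z = f z"
      proof (cases "z = 1")
        case False
        show ?thesis
        proof (rule analytic_continuation_open[of "{s. Re s > 1}" "- {1}" h f z])
          have "2 \<in> {s. Re s > 1}" by simp
          then show "{s. Re s > 1} \<noteq> {}" by blast
          show "connected (- {1::complex})"
            by (rule connected_punctured_universe) simp
          show "h s = f s" if "s \<in> {s. Re s > 1}" for s
            using h f that sums_unique2 by blast
        qed (use h f False in \<open>auto intro!: open_halfspace_Re_gt\<close>)
      qed (use h in \<open>simp add: f_def\<close>)
    qed
  qed
qed

lemma zeta_characterization:
  "zeta holomorphic_on (- {1}) \<and> (\<forall>s. 1 < Re s \<longrightarrow> (\<lambda>n. of_nat (Suc n) powr (- s)) sums zeta s) \<and> zeta 1 = 0"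
  unfolding zeta_def by (rule theI'[OF zeta_unique_existence])

lemma zeta_sums: "1 < Re s \<Longrightarrow> (\<lambda>n. of_nat (Suc n) powr (- s)) sums zeta s"
  and zeta_holomorphic: "zeta holomorphic_on (- {1})"
  using zeta_characterization by blast+

text \<open>For \<open>J = 1\<close> the recursion contains no other values of the series and stays
  valid for \<open>Re s > 0\<close>. It gives access to \<open>zeta\<close> at
  \<open>1 - \<alpha>\<close>, left of the region of convergence.\<close>

lemma zeta_critical_strip:
  assumes "0 < Re s" "s \<noteq> 1"
  shows "(s - 1) * zeta s = 1 + (\<Sum>n. binom_rem 1 n (1 - s))"
proof -
  obtain G where G: "G holomorphic_on UNIV" "\<And>s. Re s > 1 \<Longrightarrow> G s = (s - 1) * dirichlet_zeta s"
    using zeta_continuation by blast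
  have dz: "dirichlet_zeta s = zeta s" if "Re s > 1" for s
    using zeta_sums[OF that] unfolding dirichlet_zeta_def by (simp only: sums_iff)
  have "(s - 1) * zeta s = G s"
  proof (rule analytic_continuation_open[of "{s. Re s > 1}" "- {1}" "\<lambda>s. (s - 1) * zeta s" G s])
    have "2 \<in> {s. Re s > 1}" by simp
    then show "{s. Re s > 1} \<noteq> {}" by blast
    show "connected (- {1::complex})"
      by (rule connected_punctured_universe) simp
    show "(s - 1) * zeta s = G s" if "s \<in> {s. Re s > 1}" for s
      using G(2)[of s] dz[of s] that by simp
  qed (use assms in \<open>auto intro!: open_halfspace_Re_gt holomorphic_intros zeta_holomorphic holomorphic_on_subset[OF G(1)]\<close>)
  also have "G s = 1 + (\<Sum>n. binom_rem 1 n (1 - s))"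
  proof (rule halfplane_identity[where c = 0 and f = G and g = "\<lambda>s. 1 + (\<Sum>n. binom_rem 1 n (1 - s))"])
    show "(\<lambda>s. 1 + (\<Sum>n. binom_rem 1 n (1 - s))) holomorphic_on {s. Re s > 0}"
      using binom_rem_series_holomorphic[of 1] by (intro holomorphic_intros) simp
    show "G s = 1 + (\<Sum>n. binom_rem 1 n (1 - s))" if "Re s > 1" for s
      using G(2)[OF that] dirichlet_zeta_recursion[OF that, of 1] by simp
  qed (use assms in \<open>auto intro: holomorphic_on_subset[OF G(1)]\<close>)
  finally show ?thesis .
qed

section \<open>Power sums and zeta values at real points\<close>

lemma powr_diff_MVT:
  fixes a :: real
  assumes "0 < a" "a < 1" "0 < y"
  shows "a * (y + 1) powr (a - 1) \<le> (y + 1) powr a - y powr a"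
    and "(y + 1) powr a - y powr a \<le> a * y powr (a - 1)"
proof -
  have "\<exists>z>y. z < y + 1 \<and> (y + 1) powr a - y powr a = (y + 1 - y) * (a * z powr (a - 1))"
    by (rule MVT2) (use assms in \<open>auto intro!: derivative_eq_intros\<close>)
  then obtain z where z: "y < z" "z < y + 1" "(y + 1) powr a - y powr a = a * z powr (a - 1)" by auto
  show "a * (y + 1) powr (a - 1) \<le> (y + 1) powr a - y powr a"
    unfolding z(3) using assms z by (intro mult_left_mono powr_mono2') auto
  show "(y + 1) powr a - y powr a \<le> a * y powr (a - 1)"
    unfolding z(3) using assms z by (intro mult_left_mono powr_mono2') auto
qed

text \<open>At \<open>s = 1 - a\<close> the remainders \<open>r n\<close> are real, and their
  partial sums contain the sum of \<open>d powr (a - 1)\<close>. The full series is known from zeta,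
  so only its tail from \<open>D\<close> on has to be estimated.\<close>

lemma sum_powr_zeta:
  assumes a: "0 < a" "a < 1" and D: "D \<ge> 1"
  shows "\<bar>(\<Sum>d=1..D. real d powr (a - 1)) - real D powr a / a - Re (zeta (complex_of_real (1 - a)))\<bar> \<le> real D powr (a - 1)"
proof -
  define r where "r = (\<lambda>n. real (n + 2) powr a - real (n + 1) powr a - a * real (n + 1) powr (a - 1))"
  define S where "S = (\<Sum>n. r n)"
  have rem: "binom_rem (Suc 0) n (of_real a) = of_real (r n)" for n
  proof -
    have "(of_nat k :: complex) powr (of_real y) = of_real (real k powr y)" for k y
      using powr_of_real[of "real k" y] by simp
    from this[of "n + 2" a] this[of "n + 1" a] this[of "n + 1" "a - 1"]
    show ?thesis by (simp add: binom_rem_def r_def)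
  qed
  have "summable (\<lambda>n. complex_of_real (r n))"
    using binom_rem_summable[of 1 "of_real (1 - a)"] a by (simp add: rem)
  then have sm: "summable r" by (simp add: summable_of_real_iff)
  have "(of_real (1 - a) - 1) * zeta (of_real (1 - a)) = 1 + (\<Sum>n. binom_rem 1 n (1 - of_real (1 - a)))"
    using a by (intro zeta_critical_strip) auto
  also have "(\<Sum>n. binom_rem 1 n (1 - of_real (1 - a))) = of_real S"
    by (simp add: rem S_def suminf_of_real[OF sm])
  finally have "Re ((of_real (1 - a) - 1) * zeta (of_real (1 - a))) = 1 + S" by simp
  then have Z: "- a * Re (zeta (of_real (1 - a))) = 1 + S" by simp
  have P: "(\<Sum>n<m. r n) = real (m + 1) powr a - 1 - a * (\<Sum>d=1..m. real d powr (a - 1))" for m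
  proof (induction m)
    case (Suc m)
    then show ?case by (simp add: r_def distrib_left)
  qed simp
  have r_bounds: "- a * (real (n + 1) powr (a - 1) - real (n + 2) powr (a - 1)) \<le> r n" "r n \<le> 0" for n
    using powr_diff_MVT[OF a, of "real (n + 1)"] by (auto simp: r_def algebra_simps)
  have lim: "(\<lambda>m. (\<Sum>n<m. r n)) \<longlonglongrightarrow> S"
    using summable_LIMSEQ[OF sm] by (simp add: S_def)
  \<comment> \<open>Each remainder is nonpositive and bounded below by a telescoping
    difference.\<close>
  have part: "(\<Sum>n<m. r n) - (\<Sum>n<D. r n) \<in> {- a * real (D + 1) powr (a - 1)..0}" if "m \<ge> D" for m
  proof -
    have "(\<Sum>n<m. r n) - (\<Sum>n<D. r n) \<in> {- a * (real (D + 1) powr (a - 1) - real (m + 1) powr (a - 1))..0}"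
      using that
    proof (induction m rule: dec_induct)
      case (step m)
      then show ?case using r_bounds[of m] by (auto simp: algebra_simps)
    qed auto
    moreover have "0 \<le> a * real (m + 1) powr (a - 1)" using a by simp
    ultimately show ?thesis by (auto simp: algebra_simps)
  qed
  have "S - (\<Sum>n<D. r n) \<ge> - a * real (D + 1) powr (a - 1)"
    by (rule tendsto_lowerbound[OF tendsto_diff[OF lim tendsto_const]])
      (use part in \<open>auto simp: eventually_sequentially\<close>)
  moreover have "S - (\<Sum>n<D. r n) \<le> 0"
    by (rule tendsto_upperbound[OF tendsto_diff[OF lim tendsto_const]])
      (use part in \<open>auto simp: eventually_sequentially\<close>)
  moreover have "real (D + 1) powr (a - 1) \<le> real D powr (a - 1)"
    using a D by (intro powr_mono2') auto
  then have "a * real (D + 1) powr (a - 1) \<le> a * real D powr (a - 1)"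
    using a by (intro mult_left_mono) auto
  \<comment> \<open>The correction from \<open>D + 1\<close> to \<open>D\<close> is nonnegative
    while the tail is nonpositive, so the two errors do not add up.\<close>
  moreover have "0 \<le> real (D + 1) powr a - real D powr a" "real (D + 1) powr a - real D powr a \<le> a * real D powr (a - 1)"
    using powr_diff_MVT(2)[OF a, of "real D"] D a by (auto intro!: powr_mono2 simp: add.commute)
  moreover have "a * ((\<Sum>d=1..D. real d powr (a - 1)) - real D powr a / a - Re (zeta (of_real (1 - a)))) =
      (real (D + 1) powr a - real D powr a) + (S - (\<Sum>n<D. r n))"
    using a Z P[of D] by (simp add: algebra_simps)
  ultimately have "\<bar>a * ((\<Sum>d=1..D. real d powr (a - 1)) - real D powr a / a - Re (zeta (of_real (1 - a))))\<bar> \<le> a * real D powr (a - 1)"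
    by linarith
  then show ?thesis using a by (simp add: abs_mult)
qed

lemma zeta_real_sums:
  assumes "0 < a"
  shows "(\<lambda>n. real (Suc n) powr (- 1 - a)) sums Re (zeta (complex_of_real (1 + a)))"
proof -
  have "(\<lambda>n. (of_nat (Suc n) :: complex) powr (- of_real (1 + a))) sums zeta (of_real (1 + a))"
    using assms by (intro zeta_sums) auto
  moreover have "(of_nat (Suc n) :: complex) powr (- of_real (1 + a)) = of_real (real (Suc n) powr (- 1 - a))" for n
    using powr_of_real[of "real (Suc n)" "- 1 - a"] by simp
  ultimately have "(\<lambda>n. complex_of_real (real (Suc n) powr (- 1 - a))) sums zeta (of_real (1 + a))" by simp
  from sums_Re[OF this] show ?thesis by simp
qed

section \<open>Poisson summation over one frequency\<close>

lemma two_cos_mult_cis: "complex_of_real (2 * cos t) * cis s = cis (s + t) + cis (s - t)"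
  by (simp add: complex_eq_iff cos_add cos_diff sin_add sin_diff)

text \<open>\<open>M\<close> is the integer cutoff and \<open>D\<close> the last divisor kept. With
  \<open>2 x <= D\<close> the floor of \<open>x / d\<close> vanishes past \<open>D\<close>; the
  bound by \<open>sqrt (N x)\<close> keeps the saddles below \<open>D / sqrt 2\<close>. No
  asymptotic relation is imposed, and the numerical constants in the estimates are absolute.\<close>

locale voronoi =
  fixes \<alpha> x :: real and M D :: nat
  assumes alpha: "0 < \<alpha>" "\<alpha> < 1 / 2" and x1: "1 \<le> x"
    and D2x: "2 * x \<le> real D" and DNx: "2 * sqrt ((real M + 1 / 2) * x) \<le> real D"
begin

definition N :: real where "N = real M + 1 / 2"
text \<open>The Fourier sum at \<open>d\<close> has length \<open>Z d\<close>; equivalently, the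
  frequency \<open>h\<close> occurs for \<open>d >= h / Z\<close>.\<close>

definition Z :: real where "Z = sqrt (N / x)"
definition H :: nat where "H = nat \<lfloor>Z * real D\<rfloor>"

lemma N_pos: "N > 0" and Z_pos: "Z > 0" and x_pos: "x > 0" and D_pos: "real D > 0"
  using x1 D2x by (auto simp: N_def Z_def)

lemma Z_sq: "Z\<^sup>2 * x = N"
  using N_pos x_pos by (simp add: Z_def)

lemma Zx_eq: "Z * x = sqrt (N * x)"
  using x_pos by (simp add: Z_def real_sqrt_divide real_sqrt_mult field_simps)

lemma ZxD: "2 * (Z * x) \<le> real D"
  using DNx by (simp add: Zx_eq N_def)

lemma ZD_ge: "2 * N \<le> Z * real D"
proof -
  have "2 * N = Z * (2 * (Z * x))" using Z_sq by (simp add: power2_eq_square mult_ac)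
  also have "\<dots> \<le> Z * real D" using ZxD Z_pos by (intro mult_left_mono) auto
  finally show ?thesis .
qed

text \<open>This is the separation from the upper end that the saddle point estimate asks for, in
  the worst case \<open>k = 1\<close>.\<close>

lemma hx_le_D_sq:
  assumes "real h \<le> Z * real D"
  shows "2 * (real h * x) \<le> (real D)\<^sup>2"
proof -
  have "2 * (real h * x) \<le> 2 * (Z * real D * x)" using assms x_pos by simp
  also have "\<dots> = real D * (2 * (Z * x))" by (simp add: mult_ac)
  also have "\<dots> \<le> real D * real D" using ZxD by (intro mult_left_mono) auto
  finally show ?thesis by (simp add: power2_eq_square)
qed

definition F :: "nat \<Rightarrow> real \<Rightarrow> complex" where
  "F h u = of_real (u powr \<alpha>) * cis (2 * pi * (real h * x / u))"

definition F' :: "nat \<Rightarrow> real \<Rightarrow> complex" where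
  "F' h u = of_real (\<alpha> * u powr (\<alpha> - 1)) * cis (2 * pi * (real h * x / u))
     + of_real (u powr \<alpha> * (- 2 * pi * real h * x / u\<^sup>2)) * (\<i> * cis (2 * pi * (real h * x / u)))"

lemma F_deriv:
  assumes "u > 0"
  shows "(F h has_vector_derivative F' h u) (at u within S)"
proof -
  have "((\<lambda>u. u powr \<alpha> * cos (2 * pi * (real h * x / u))) has_real_derivative Re (F' h u)) (at u within S)"
    unfolding F'_def using assms
    by (auto intro!: derivative_eq_intros simp: power2_eq_square)
  moreover have "((\<lambda>u. u powr \<alpha> * sin (2 * pi * (real h * x / u))) has_real_derivative Im (F' h u)) (at u within S)"
    unfolding F'_def using assms
    by (auto intro!: derivative_eq_intros simp: power2_eq_square)
  ultimately show ?thesis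
    unfolding has_vector_derivative_complex_iff F_def by simp
qed

lemma F_continuous_on: "S \<subseteq> {0<..} \<Longrightarrow> continuous_on S (F h)"
  unfolding F_def by (auto intro!: continuous_intros)

lemma F'_continuous_on: "S \<subseteq> {0<..} \<Longrightarrow> continuous_on S (F' h)"
  unfolding F'_def by (auto intro!: continuous_intros)

lemma F_integrable: "0 < a \<Longrightarrow> F h integrable_on {a..b}"
  by (intro integrable_continuous_real F_continuous_on) auto

lemma norm_F: "norm (F h u) = u powr \<alpha>"
  by (simp add: F_def norm_mult)

text \<open>On \<open>u >= h / Z\<close> the phase velocity \<open>h x / u^2\<close> is at most
  \<open>Z^2 x / h = N / h\<close>, so the derivative is bounded uniformly in \<open>h\<close>. The
  7 stands for \<open>2 pi\<close>.\<close>

lemma norm_F'_le: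
  assumes h: "h \<ge> 1" and u: "real h / Z \<le> u" "u \<le> real D"
  shows "norm (F' h u) \<le> real D powr \<alpha> * (Z + 7 * N)"
proof -
  have a: "real h / Z > 0" using h Z_pos by simp
  then have u0: "u > 0" using u by linarith
  have pD: "u powr \<alpha> \<le> real D powr \<alpha>" using u u0 alpha by (intro powr_mono2) auto
  have uZ: "1 / u \<le> Z"
  proof -
    have "1 / Z \<le> real h / Z" using h Z_pos by (intro divide_right_mono) auto
    then have "1 / Z \<le> u" using u by linarith
    then show ?thesis using u0 Z_pos by (simp add: field_simps)
  qed
  have hx: "real h * x / u\<^sup>2 \<le> N"
  proof -
    have "(real h / Z)\<^sup>2 \<le> u\<^sup>2" using u a by (intro power_mono) auto
    then have "real h * x / u\<^sup>2 \<le> real h * x / (real h / Z)\<^sup>2"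
      using x_pos u0 a by (intro divide_left_mono mult_pos_pos zero_less_power) auto
    also have "\<dots> = N / real h" using h Z_pos Z_sq[symmetric] by (simp add: field_simps power2_eq_square)
    also have "\<dots> \<le> N" using h N_pos by (simp add: divide_le_eq)
    finally show ?thesis .
  qed
  have "norm (F' h u) \<le> \<bar>\<alpha> * u powr (\<alpha> - 1)\<bar> + \<bar>u powr \<alpha> * (- 2 * pi * real h * x / u\<^sup>2)\<bar>"
    unfolding F'_def
    by (rule order_trans[OF norm_triangle_ineq])
      (simp only: norm_mult norm_of_real norm_cis norm_ii mult_1_right order_refl)
  also have "\<dots> = \<alpha> * u powr (\<alpha> - 1) + u powr \<alpha> * (2 * pi * (real h * x / u\<^sup>2))"
    using alpha x_pos by (simp add: abs_mult)
  also have "u powr (\<alpha> - 1) = u powr \<alpha> * (1 / u)" using u0 by (simp add: powr_diff)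
  also have "\<alpha> * (u powr \<alpha> * (1 / u)) \<le> 1 * (real D powr \<alpha> * Z)"
    using alpha pD uZ u0 by (intro mult_mono) auto
  also have "u powr \<alpha> * (2 * pi * (real h * x / u\<^sup>2)) \<le> real D powr \<alpha> * (7 * N)"
  proof (rule mult_mono[OF pD])
    have "2 * pi \<le> 7" using pi_approx by simp
    then show "2 * pi * (real h * x / u\<^sup>2) \<le> 7 * N"
      using hx x_pos N_pos by (intro mult_mono) auto
  qed (use x_pos in auto)
  finally show ?thesis by (simp add: algebra_simps)
qed

text \<open>Each cosine of the kernel splits into a phase with \<open>+ k u\<close>, which has a
  saddle, and one with \<open>- k u\<close>, which has none.\<close>

lemma kernel_mult_F:
  "dirichlet_kernel K u *\<^sub>R F h u = F h u + (\<Sum>k=1..K. of_real (u powr \<alpha>) * cis (2 * pi * (real h * x / u + real k * u))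
     + of_real (u powr \<alpha>) * cis (2 * pi * (real h * x / u - real k * u)))"
proof -
  have "dirichlet_kernel K u *\<^sub>R F h u = F h u + (\<Sum>k=1..K. of_real (2 * cos (2 * pi * real k * u)) * F h u)"
    unfolding dirichlet_kernel_def scaleR_conv_of_real
    by (simp add: distrib_right sum_distrib_left sum_distrib_right)
  also have "(\<Sum>k=1..K. of_real (2 * cos (2 * pi * real k * u)) * F h u) = (\<Sum>k=1..K. of_real (u powr \<alpha>) * cis (2 * pi * (real h * x / u + real k * u))
     + of_real (u powr \<alpha>) * cis (2 * pi * (real h * x / u - real k * u)))"
  proof (rule sum.cong)
    fix k
    have "of_real (2 * cos (2 * pi * real k * u)) * F h u = of_real (u powr \<alpha>) *
      (of_real (2 * cos (2 * pi * real k * u)) * cis (2 * pi * (real h * x / u)))"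
      by (simp add: F_def mult_ac)
    also have "\<dots> = of_real (u powr \<alpha>) * cis (2 * pi * (real h * x / u + real k * u))
     + of_real (u powr \<alpha>) * cis (2 * pi * (real h * x / u - real k * u))"
      unfolding two_cos_mult_cis by (simp add: algebra_simps)
    finally show "of_real (2 * cos (2 * pi * real k * u)) * F h u = of_real (u powr \<alpha>) * cis (2 * pi * (real h * x / u + real k * u))
     + of_real (u powr \<alpha>) * cis (2 * pi * (real h * x / u - real k * u))" .
  qed auto
  finally show ?thesis .
qed

definition saddle :: "nat \<Rightarrow> nat \<Rightarrow> complex" where
  "saddle h k = of_real (sqrt (real h * x / real k) powr (\<alpha> + 1 / 2) / sqrt (real k))
     * cis (4 * pi * sqrt (real h * x * real k)) * ((1 + \<i>) / 2)"

lemma N_minus_nat: "1 / 2 \<le> \<bar>N - real m\<bar>"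
proof (cases "m \<le> M")
  case False
  then have "real M + 1 \<le> real m" by linarith
  then show ?thesis by (simp add: N_def)
qed (simp add: N_def)

text \<open>In units of the lower end \<open>h / Z\<close> the saddle sits at \<open>sqrt s\<close>
  with \<open>s = N / (h k)\<close>. It is inside iff \<open>h k < N\<close>, that is
  \<open>h k <= M\<close>, and the loss from its distance to the end is controlled by
  \<open>|N - h k|\<close>, which is at least 1/2.\<close>

lemma saddle_integral:
  assumes h: "h \<ge> 1" "real h \<le> Z * real D" and k: "k \<ge> 1"
  shows "norm (integral {real h / Z..real D} (\<lambda>u. of_real (u powr \<alpha>) * cis (2 * pi * (real h * x / u + real k * u)))
      - (if h * k \<le> M then saddle h k else 0)) \<le> real D powr \<alpha> * (120 + 160 * (N / \<bar>N - real (h * k)\<bar>)) / real k"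
proof -
  define a where "a = real h / Z"
  define u0 where "u0 = sqrt (real h * x / real k)"
  define s where "s = N / real (h * k)"
  have hk: "real h > 0" "real k > 0" using h k by auto
  have a: "a > 0" using hk Z_pos by (simp add: a_def)
  have aD: "a \<le> real D" using h Z_pos by (simp add: a_def divide_le_eq mult.commute)
  have s: "s > 0" using N_pos hk by (simp add: s_def)
  have u0: "u0 = a * sqrt s"
  proof -
    have "real h * x / real k = a\<^sup>2 * s"
      using hk Z_pos Z_sq[symmetric] by (simp add: a_def s_def field_simps power2_eq_square)
    then show ?thesis using a by (simp add: u0_def real_sqrt_mult)
  qed
  have s1: "s - 1 = (N - real (h * k)) / real (h * k)" using hk by (simp add: s_def field_simps)
  have Nne: "N \<noteq> real (h * k)" using N_minus_nat[of "h * k"] by auto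
  then have sne: "s \<noteq> 1" using s1 hk by auto
  have case1: "a < u0 \<longleftrightarrow> h * k \<le> M"
  proof -
    have "a < u0 \<longleftrightarrow> 1 < sqrt s" using a unfolding u0 by simp
    also have "\<dots> \<longleftrightarrow> s > 1" by simp
    also have "\<dots> \<longleftrightarrow> real (h * k) < N" using hk by (simp add: s_def less_divide_eq)
    also have "\<dots> \<longleftrightarrow> h * k \<le> M" unfolding N_def by linarith
    finally show ?thesis .
  qed
  have ane: "a \<noteq> u0" using a sne s unfolding u0 by auto
  have X: "sqrt (a * u0) / \<bar>a - u0\<bar> \<le> 2 + 4 * (N / \<bar>N - real (h * k)\<bar>)"
  proof -
    define r where "r = sqrt s"
    have r: "r > 0" "r \<noteq> 1" "r\<^sup>2 = s" using s sne by (auto simp: r_def)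
    have "sqrt (a * u0) = a * sqrt r" using a by (simp add: u0 r_def real_sqrt_mult)
    moreover have "\<bar>a - u0\<bar> = a * \<bar>r - 1\<bar>"
      using a by (simp add: u0 r_def abs_mult[symmetric] right_diff_distrib abs_minus_commute flip: abs_mult)
        (simp add: abs_mult_pos' abs_minus_commute algebra_simps)
    ultimately have "sqrt (a * u0) / \<bar>a - u0\<bar> = sqrt r / \<bar>r - 1\<bar>" using a by simp
    \<comment> \<open>Rationalising replaces \<open>|r - 1|\<close> by \<open>|s - 1|\<close>, which
      is \<open>|N - h k|\<close> over \<open>h k\<close>.\<close>
    also have "\<dots> = sqrt r * (r + 1) / \<bar>s - 1\<bar>"
    proof -
      have "s - 1 = (r - 1) * (r + 1)" using r by (simp add: algebra_simps power2_eq_square)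
      then have "\<bar>s - 1\<bar> = \<bar>r - 1\<bar> * (r + 1)" using r by (simp add: abs_mult)
      then show ?thesis using r by simp
    qed
    also have "\<dots> \<le> 2 * (1 + s) / \<bar>s - 1\<bar>"
    proof (rule divide_right_mono)
      have "sqrt r \<le> (1 + r) / 2"
        using arith_geo_mean_sqrt[of 1 r] r by simp
      then have "sqrt r * (r + 1) \<le> (1 + r) / 2 * (r + 1)" using r by (intro mult_right_mono) auto
      also have "\<dots> \<le> 2 * (1 + r\<^sup>2)"
      proof -
        have "2 * (1 + r\<^sup>2) - (1 + r) / 2 * (r + 1) = ((r - 1)\<^sup>2 + 2 * r\<^sup>2 + 2) / 2"
          by (simp add: power2_eq_square field_simps)
        also have "\<dots> \<ge> 0" by simp
        finally show ?thesis by simp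
      qed
      finally show "sqrt r * (r + 1) \<le> 2 * (1 + s)" using r by simp
    qed simp
    also have "\<dots> \<le> 2 * (1 + 2 * (s / \<bar>s - 1\<bar>))"
    proof -
      have "(1 + s) \<le> \<bar>s - 1\<bar> + 2 * s" using s by (auto simp: abs_if)
      then have "(1 + s) / \<bar>s - 1\<bar> \<le> (\<bar>s - 1\<bar> + 2 * s) / \<bar>s - 1\<bar>" by (intro divide_right_mono) auto
      also have "\<dots> = 1 + 2 * (s / \<bar>s - 1\<bar>)" using sne by (simp add: add_divide_distrib)
      finally have q: "(1 + s) / \<bar>s - 1\<bar> \<le> 1 + 2 * (s / \<bar>s - 1\<bar>)" .
      have "2 * ((1 + s) / \<bar>s - 1\<bar>) \<le> 2 * (1 + 2 * (s / \<bar>s - 1\<bar>))" by (rule mult_left_mono[OF q]) simp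
      then show ?thesis by (simp only: times_divide_eq_right)
    qed
    also have "s / \<bar>s - 1\<bar> = N / \<bar>N - real (h * k)\<bar>"
      unfolding s1 using hk by (simp add: s_def abs_mult)
    finally show ?thesis by simp
  qed
  have "norm (integral {a..real D} (\<lambda>u. of_real (u powr \<alpha>) * cis (2 * pi * (real h * x / u + real k * u)))
     - (if h * k \<le> M then of_real (u0 powr (\<alpha> + 1 / 2) / sqrt (real k)) * cis (4 * pi * sqrt (real h * x * real k)) * ((1 + \<i>) / 2) else 0))
     \<le> 40 * (real D powr \<alpha> / real k) * (1 + sqrt (a * u0) / \<bar>a - u0\<bar>)"
    unfolding case1[symmetric]
  proof (rule saddle_point_integral)
    show "2 * (real h * x) \<le> real k * (real D)\<^sup>2"
    proof -
      have "2 * (real h * x) \<le> 1 * (real D)\<^sup>2" using hx_le_D_sq[OF h(2)] by simp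
      also have "\<dots> \<le> real k * (real D)\<^sup>2" using k by (intro mult_right_mono) auto
      finally show ?thesis .
    qed
  qed (use hk a aD alpha x_pos u0_def ane in auto)
  also have "\<dots> \<le> 40 * (real D powr \<alpha> / real k) * (1 + (2 + 4 * (N / \<bar>N - real (h * k)\<bar>)))"
    using X by (intro mult_left_mono add_left_mono) auto
  also have "\<dots> = real D powr \<alpha> * (120 + 160 * (N / \<bar>N - real (h * k)\<bar>)) / real k"
    using hk by (simp add: field_simps)
  finally show ?thesis unfolding saddle_def a_def u0_def .
qed

lemma conjugate_integral:
  assumes h: "h \<ge> 1" "real h \<le> Z * real D" and k: "k \<ge> 1"
  shows "norm (integral {real h / Z..real D} (\<lambda>u. of_real (u powr \<alpha>) * cis (2 * pi * (real h * x / u - real k * u))))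
     \<le> 8 * real D powr \<alpha> / real k"
proof -
  have "norm (integral {real h / Z..real D} (\<lambda>u. of_real (u powr \<alpha>) * cis (2 * pi * (real h * x / u - real k * u))))
     \<le> 8 * (real D powr \<alpha> / (real h * x / (real D)\<^sup>2 + real k))"
    by (rule nonstationary_integral_bound)
      (use h k x_pos Z_pos alpha in \<open>auto simp: divide_le_eq mult.commute\<close>)
  also have "\<dots> \<le> 8 * (real D powr \<alpha> / real k)"
    using h k x_pos D_pos by (intro mult_left_mono divide_left_mono mult_pos_pos add_nonneg_pos) auto
  finally show ?thesis by simp
qed

text \<open>Poisson summation for one \<open>h\<close>. The hypothesis on \<open>K\<close> makes the
  truncation error a constant times \<open>D powr \<alpha>\<close>; the zero frequency is kept as an
  integral, since it belongs to the main terms.\<close>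

lemma sum_minus_integral:
  assumes h: "h \<ge> 1" "real h \<le> Z * real D" and K: "real (D + 1) * (Z + 7 * N) \<le> sqrt (2 * real K + 1)"
  shows "norm ((\<Sum>d=nat \<lceil>real h / Z\<rceil>..D. F h (real d)) - integral {real h / Z..real D} (F h)
      - (\<Sum>k=1..K. if h * k \<le> M then saddle h k else 0))
      \<le> real D powr \<alpha> * (9 + (\<Sum>k=1..K. (128 + 160 * (N / \<bar>N - real (h * k)\<bar>)) / real k))"
proof -
  define a where "a = real h / Z"
  have a: "a > 0" using h Z_pos by (simp add: a_def)
  have aD: "a \<le> real D" using h Z_pos by (simp add: a_def divide_le_eq mult.commute)
  define P where "P = (\<lambda>k u. of_real (u powr \<alpha>) * cis (2 * pi * (real h * x / u + real k * u)))"
  define Q where "Q = (\<lambda>k u. of_real (u powr \<alpha>) * cis (2 * pi * (real h * x / u - real k * u)))"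
  have Pi: "P k integrable_on {a..real D}" and Qi: "Q k integrable_on {a..real D}" for k :: nat
    unfolding P_def Q_def using a by (auto intro!: integrable_continuous_real continuous_intros)
  have "integral {a..real D} (\<lambda>u. dirichlet_kernel K u *\<^sub>R F h u) = integral {a..real D} (\<lambda>u. F h u + (\<Sum>k=1..K. P k u + Q k u))"
    unfolding kernel_mult_F P_def Q_def ..
  also have "\<dots> = integral {a..real D} (F h) + (\<Sum>k=1..K. integral {a..real D} (P k) + integral {a..real D} (Q k))"
    by (intro integral_unique has_integral_add has_integral_sum integrable_integral Pi Qi F_integrable a) auto
  finally have I: "integral {a..real D} (\<lambda>u. dirichlet_kernel K u *\<^sub>R F h u) =
     integral {a..real D} (F h) + (\<Sum>k=1..K. integral {a..real D} (P k) + integral {a..real D} (Q k))" .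
  define r where "r = saw_rem K (a - \<lceil>a\<rceil> + 1)"
  have r: "\<bar>r\<bar> \<le> 2" unfolding r_def by (rule saw_rem_bounded) linarith+
  define S where "S = (\<Sum>d=nat \<lceil>a\<rceil>..D. F h (real d))"
  define R where "R = S - integral {a..real D} (\<lambda>u. dirichlet_kernel K u *\<^sub>R F h u) - (1 / 2) *\<^sub>R F h (real D) - r *\<^sub>R F h a"
  have "norm R \<le> real (D + 1) * (real D powr \<alpha> * (Z + 7 * N) * (6 / sqrt (2 * real K + 1)))"
    unfolding R_def S_def r_def
    by (rule euler_maclaurin_truncated[where F' = "F' h"])
      (use a aD in \<open>auto intro!: F_deriv F'_continuous_on norm_F'_le h simp: a_def\<close>)
  also have "\<dots> = 6 * real D powr \<alpha> * (real (D + 1) * (Z + 7 * N) / sqrt (2 * real K + 1))" by simp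
  also have "\<dots> \<le> 6 * real D powr \<alpha> * 1"
    using K by (intro mult_left_mono) (auto simp: divide_le_eq)
  finally have R: "norm R \<le> 6 * real D powr \<alpha>" by simp
  have "S - integral {a..real D} (F h) - (\<Sum>k=1..K. if h * k \<le> M then saddle h k else 0)
    = (R + (1 / 2) *\<^sub>R F h (real D) + r *\<^sub>R F h a) + (\<Sum>k=1..K. (integral {a..real D} (P k) - (if h * k \<le> M then saddle h k else 0)) + integral {a..real D} (Q k))"
    unfolding R_def I by (simp add: sum.distrib sum_subtractf)
  also have "norm \<dots> \<le> 9 * real D powr \<alpha> + (\<Sum>k=1..K. real D powr \<alpha> * ((128 + 160 * (N / \<bar>N - real (h * k)\<bar>)) / real k))"
  proof (rule order_trans[OF norm_triangle_ineq], rule add_mono)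
    have "a powr \<alpha> \<le> real D powr \<alpha>" using a aD alpha by (intro powr_mono2) auto
    then have "norm (r *\<^sub>R F h a) \<le> 2 * real D powr \<alpha>"
      using r by (simp add: norm_F) (intro mult_mono; simp)
    moreover have "norm ((1 / 2) *\<^sub>R F h (real D)) = real D powr \<alpha> / 2" by (simp add: norm_F)
    moreover have "norm (R + (1 / 2) *\<^sub>R F h (real D) + r *\<^sub>R F h a) \<le> norm R + norm ((1 / 2) *\<^sub>R F h (real D)) + norm (r *\<^sub>R F h a)"
      by (intro order_trans[OF norm_triangle_ineq] add_right_mono norm_triangle_ineq)
    ultimately show "norm (R + (1 / 2) *\<^sub>R F h (real D) + r *\<^sub>R F h a) \<le> 9 * real D powr \<alpha>"
      using R powr_ge_zero[of "real D" \<alpha>] by linarith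
    show "norm (\<Sum>k=1..K. (integral {a..real D} (P k) - (if h * k \<le> M then saddle h k else 0)) + integral {a..real D} (Q k))
       \<le> (\<Sum>k=1..K. real D powr \<alpha> * ((128 + 160 * (N / \<bar>N - real (h * k)\<bar>)) / real k))"
    proof (rule sum_norm_le)
      fix k assume "k \<in> {1..K}"
      then have k: "k \<ge> 1" by simp
      have "norm ((integral {a..real D} (P k) - (if h * k \<le> M then saddle h k else 0)) + integral {a..real D} (Q k))
        \<le> real D powr \<alpha> * (120 + 160 * (N / \<bar>N - real (h * k)\<bar>)) / real k + 8 * real D powr \<alpha> / real k"
        unfolding a_def P_def Q_def
        by (rule order_trans[OF norm_triangle_ineq add_mono[OF saddle_integral[OF h k] conjugate_integral[OF h k]]])
      also have "\<dots> = real D powr \<alpha> * ((128 + 160 * (N / \<bar>N - real (h * k)\<bar>)) / real k)"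
        by (simp add: algebra_simps add_divide_distrib)
      finally show "norm ((integral {a..real D} (P k) - (if h * k \<le> M then saddle h k else 0)) + integral {a..real D} (Q k))
        \<le> real D powr \<alpha> * ((128 + 160 * (N / \<bar>N - real (h * k)\<bar>)) / real k)" .
    qed
  qed
  also have "\<dots> = real D powr \<alpha> * (9 + (\<Sum>k=1..K. (128 + 160 * (N / \<bar>N - real (h * k)\<bar>)) / real k))"
    by (simp add: sum_distrib_left distrib_left)
  finally show ?thesis unfolding a_def S_def .
qed

end

section \<open>The mean-value terms\<close>

context voronoi begin

lemma F_integral_le:
  assumes "0 < e" "e \<le> w" "h \<ge> 1"
  shows "norm (integral {e..w} (F h)) \<le> 8 * w powr \<alpha> * w\<^sup>2 / (real h * x)"
proof -
  have "norm (integral {e..w} (\<lambda>u. of_real (u powr \<alpha>) * cis (2 * pi * (real h * x / u - 0 * u)))) \<le> 8 * (w powr \<alpha> / (real h * x / w\<^sup>2 + 0))"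
    by (rule nonstationary_integral_bound) (use assms x_pos alpha in auto)
  then show ?thesis using assms by (simp add: F_def[abs_def])
qed

text \<open>Integration by parts followed by \<open>v = x / u\<close> yields a cosine integral of
  \<open>v powr (- 1 - \<alpha>)\<close>; over all \<open>h\<close> these are the Poisson terms of
  the series for \<open>zeta (1 + \<alpha>)\<close>. The lower limit is \<open>x / m\<close> because
  the sine vanishes there.\<close>

lemma Im_F_integral:
  assumes e: "e = x / real m" and m: "m \<ge> 1" and eD: "e \<le> real D" and h: "h \<ge> 1"
  shows "Im (integral {e..real D} (F h)) / (pi * real h) =
     real D powr (1 + \<alpha>) / (1 + \<alpha>) * (sin (2 * pi * real h * (x / real D)) / (pi * real h))
     + x powr (1 + \<alpha>) / (1 + \<alpha>) * integral {x / real D..real m} (\<lambda>v. 2 * cos (2 * pi * real h * v) * v powr (- 1 - \<alpha>))"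
proof -
  have e0: "e > 0" using e m x_pos by simp
  define c where "c = x / real D"
  have c: "c > 0" using x_pos D_pos by (simp add: c_def)
  have cm: "c \<le> real m" using eD m D_pos x_pos by (simp add: c_def e field_simps)
  define G where "G = (\<lambda>u. u powr (1 + \<alpha>) / (1 + \<alpha>) * sin (2 * pi * real h * x / u))"
  define C where "C = (\<lambda>v. cos (2 * pi * real h * v) * v powr (- 1 - \<alpha>))"
  have G_deriv: "(G has_real_derivative (u powr \<alpha> * sin (2 * pi * real h * x / u)
      - 2 * pi * real h * x / (1 + \<alpha>) * (u powr (\<alpha> - 1) * cos (2 * pi * real h * x / u)))) (at u within S)" if "u > 0" for u S
  proof -
    have "((\<lambda>u. u powr (1 + \<alpha>) / (1 + \<alpha>)) has_real_derivative (1 + \<alpha>) * u powr (1 + \<alpha> - 1) / (1 + \<alpha>)) (at u within S)"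
      by (intro DERIV_cdivide has_field_derivative_at_within[OF has_real_derivative_powr] that)
    moreover have "((\<lambda>u. sin (2 * pi * real h * x / u)) has_real_derivative cos (2 * pi * real h * x / u) * (- (2 * pi * real h * x / u\<^sup>2))) (at u within S)"
      using that by (auto intro!: derivative_eq_intros simp: power2_eq_square)
    ultimately have D: "(G has_real_derivative ((1 + \<alpha>) * u powr (1 + \<alpha> - 1) / (1 + \<alpha>) * sin (2 * pi * real h * x / u)
        + cos (2 * pi * real h * x / u) * (- (2 * pi * real h * x / u\<^sup>2)) * (u powr (1 + \<alpha>) / (1 + \<alpha>)))) (at u within S)"
      unfolding G_def by (rule DERIV_mult)
    have e1: "(1 + \<alpha>) * u powr (1 + \<alpha> - 1) / (1 + \<alpha>) = u powr \<alpha>" using alpha by simp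
    have e2: "u powr (1 + \<alpha>) = u\<^sup>2 * u powr (\<alpha> - 1)"
      using that by (simp add: powr_add powr_diff power2_eq_square)
    have e3: "s * (- (b / u\<^sup>2)) * (u\<^sup>2 * p / (1 + \<alpha>)) = - (b / (1 + \<alpha>) * (p * s))" for s b p
      using that by simp
    show ?thesis using D unfolding e1 e2 e3 by simp
  qed
  have I1: "((\<lambda>u. u powr \<alpha> * sin (2 * pi * real h * x / u)
      - 2 * pi * real h * x / (1 + \<alpha>) * (u powr (\<alpha> - 1) * cos (2 * pi * real h * x / u))) has_integral (G (real D) - G e)) {e..real D}"
    by (rule fundamental_theorem_of_calculus[OF eD])
      (use e0 G_deriv in \<open>auto simp flip: has_real_derivative_iff_has_vector_derivative\<close>)
  have Ge: "G e = 0"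
  proof -
    have "2 * pi * real h * x / e = real (2 * h * m) * pi" using e m x_pos by simp
    then have "sin (2 * pi * real h * x / e) = 0" by (simp only: sin_npi)
    then show ?thesis by (simp add: G_def)
  qed
  have sub: "((\<lambda>u. (- x / u\<^sup>2) *\<^sub>R C (x / u)) has_integral (integral {x / e..x / real D} C - integral {x / real D..x / e} C)) {e..real D}"
  proof (rule has_integral_substitution_general[where s = "{}" and c = c and d = "real m"])
    show "(\<lambda>u. x / u) ` {e..real D} \<subseteq> {c..real m}"
    proof
      fix v assume "v \<in> (\<lambda>u. x / u) ` {e..real D}"
      then obtain u where u: "v = x / u" "e \<le> u" "u \<le> real D" by (metis imageE atLeastAtMost_iff)
      have "x / real D \<le> x / u" "x / u \<le> x / e"
        using u e0 x_pos by (auto intro!: divide_left_mono mult_pos_pos)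
      then show "v \<in> {c..real m}" using e m x_pos by (simp add: u c_def)
    qed
    show "continuous_on {c..real m} C"
      unfolding C_def using c by (auto intro!: continuous_intros)
  qed (use e0 eD in \<open>auto intro!: continuous_intros derivative_eq_intros simp: power2_eq_square\<close>)
  have xe: "x / e = real m" using e m x_pos by simp
  \<comment> \<open>The substitution reverses orientation and gives a difference over
    \<open>{m..c}\<close> and \<open>{c..m}\<close>; the first interval is empty unless
    \<open>c = m\<close>, when both integrals vanish.\<close>
  have "integral {x / e..x / real D} C - integral {x / real D..x / e} C = - integral {c..real m} C"
  proof (cases "c = real m")
    case False
    then have "{real m..c} = {}" using cm by auto
    then show ?thesis unfolding xe c_def[symmetric] by simp
  qed (simp add: xe flip: c_def)
  with sub have "((\<lambda>u. (- x / u\<^sup>2) * C (x / u)) has_integral - integral {c..real m} C) {e..real D}" by simp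
  from has_integral_mult_right[OF this, of "- (x powr \<alpha>)"]
  have I2: "((\<lambda>u. - (x powr \<alpha>) * ((- x / u\<^sup>2) * C (x / u))) has_integral x powr \<alpha> * integral {c..real m} C) {e..real D}"
    by simp
  have I2': "((\<lambda>u. u powr (\<alpha> - 1) * cos (2 * pi * real h * x / u)) has_integral x powr \<alpha> * integral {c..real m} C) {e..real D}"
  proof (rule has_integral_eq[OF _ I2])
    fix u assume "u \<in> {e..real D}"
    then have u: "u > 0" using e0 by auto
    have "(x / u) powr (- 1 - \<alpha>) = (x powr (- 1 - \<alpha>)) / (u powr (- 1 - \<alpha>))" using u x_pos by (simp add: powr_divide)
    also have "\<dots> = (u * u powr \<alpha>) / (x * x powr \<alpha>)"
      using u x_pos by (simp add: powr_diff powr_minus field_simps)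
    finally have P: "x powr \<alpha> * (x / u\<^sup>2) * (x / u) powr (- 1 - \<alpha>) = u powr \<alpha> / u"
      using u x_pos by (simp add: power2_eq_square)
    have "- (x powr \<alpha>) * ((- x / u\<^sup>2) * C (x / u)) =
       (x powr \<alpha> * (x / u\<^sup>2) * (x / u) powr (- 1 - \<alpha>)) * cos (2 * pi * real h * x / u)"
      by (simp add: C_def)
    also have "\<dots> = u powr (\<alpha> - 1) * cos (2 * pi * real h * x / u)"
      unfolding P using u by (simp add: powr_diff)
    finally show "- (x powr \<alpha>) * ((- x / u\<^sup>2) * C (x / u)) = u powr (\<alpha> - 1) * cos (2 * pi * real h * x / u)" .
  qed
  from has_integral_add[OF I1 has_integral_mult_right[OF I2', of "2 * pi * real h * x / (1 + \<alpha>)"]]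
  have "((\<lambda>u. u powr \<alpha> * sin (2 * pi * real h * x / u)) has_integral (G (real D) + 2 * pi * real h * x / (1 + \<alpha>) * (x powr \<alpha> * integral {c..real m} C))) {e..real D}"
    using Ge by simp
  moreover have "((\<lambda>u. u powr \<alpha> * sin (2 * pi * real h * x / u)) has_integral Im (integral {e..real D} (F h))) {e..real D}"
    using has_integral_linear[OF integrable_integral[OF F_integrable[OF e0, of h "real D"]] bounded_linear_Im]
    by (simp add: F_def[abs_def] o_def mult_ac)
  ultimately have "Im (integral {e..real D} (F h)) = G (real D) + 2 * pi * real h * x / (1 + \<alpha>) * (x powr \<alpha> * integral {c..real m} C)"
    using has_integral_unique by blast
  moreover have "2 * pi * real h * x / (1 + \<alpha>) * (x powr \<alpha> * J) / (pi * real h) = x * x powr \<alpha> / (1 + \<alpha>) * (2 * J)" for J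
    using h by simp
  ultimately have "Im (integral {e..real D} (F h)) / (pi * real h) = G (real D) / (pi * real h) + x * x powr \<alpha> / (1 + \<alpha>) * (2 * integral {c..real m} C)"
    by (simp only: add_divide_distrib)
  also have "2 * integral {c..real m} C = integral {c..real m} (\<lambda>v. 2 * C v)" by simp
  finally show ?thesis
    using x_pos by (simp add: G_def C_def c_def powr_add mult_ac)
qed

text \<open>Euler-Maclaurin summation read backwards: it evaluates the cosine integrals by a partial
  zeta sum. As \<open>x / D <= 1/2\<close>, that sum starts at \<open>n = 1\<close>, and the lower
  end leaves a \<open>saw_rem\<close> term.\<close>

lemma zeta_partial_sum_expansion:
  assumes m: "m \<ge> 1" "x / real D \<le> real m"
  shows "\<bar>(\<Sum>h=1..L. integral {x / real D..real m} (\<lambda>v. 2 * cos (2 * pi * real h * v) * v powr (- 1 - \<alpha>)))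
      - ((\<Sum>n=1..m. real n powr (- 1 - \<alpha>)) - real m powr (- 1 - \<alpha>) / 2
          - ((x / real D) powr (- \<alpha>) - real m powr (- \<alpha>)) / \<alpha> - saw_rem L (x / real D) * (x / real D) powr (- 1 - \<alpha>))\<bar>
     \<le> real (m + 1) * ((1 + \<alpha>) * (x / real D) powr (- 2 - \<alpha>) * (6 / sqrt (2 * real L + 1)))"
proof -
  define c where "c = x / real D"
  have c: "0 < c" "c \<le> 1 / 2" "c \<le> real m" using x_pos D_pos D2x m by (auto simp: c_def field_simps)
  define f where "f = (\<lambda>v. complex_of_real (v powr (- 1 - \<alpha>)))"
  define f' where "f' = (\<lambda>v. complex_of_real ((- 1 - \<alpha>) * v powr (- 2 - \<alpha>)))"
  have ceil: "\<lceil>c\<rceil> = 1" using c by (simp add: ceiling_eq_iff)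
  have f_deriv: "(f has_vector_derivative f' v) (at v within S)" if "v > 0" for v S
    unfolding f_def f'_def using that
    by (auto intro!: derivative_eq_intros has_vector_derivative_of_real simp flip: has_real_derivative_iff_has_vector_derivative simp: )
  have ci: "(\<lambda>v. 2 * cos (2 * pi * real h * v) * v powr (- 1 - \<alpha>)) integrable_on {c..real m}" for h
    using c by (auto intro!: integrable_continuous_real continuous_intros)
  have pi: "((\<lambda>v. v powr (- 1 - \<alpha>)) has_integral (c powr (- \<alpha>) - real m powr (- \<alpha>)) / \<alpha>) {c..real m}"
  proof -
    have ex: "- \<alpha> - 1 = - 1 - \<alpha>" by simp
    have "((\<lambda>v. v powr (- 1 - \<alpha>)) has_integral (- (real m powr (- \<alpha>)) / \<alpha> - - (c powr (- \<alpha>)) / \<alpha>)) {c..real m}"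
      by (rule fundamental_theorem_of_calculus)
        (use c alpha in \<open>auto intro!: derivative_eq_intros simp: ex simp flip: has_real_derivative_iff_has_vector_derivative\<close>)
    then show ?thesis by (simp add: diff_divide_distrib)
  qed
  have ki: "((\<lambda>v. dirichlet_kernel L v * v powr (- 1 - \<alpha>)) has_integral
      ((c powr (- \<alpha>) - real m powr (- \<alpha>)) / \<alpha> + (\<Sum>h=1..L. integral {c..real m} (\<lambda>v. 2 * cos (2 * pi * real h * v) * v powr (- 1 - \<alpha>))))) {c..real m}"
  proof -
    have "dirichlet_kernel L v * v powr (- 1 - \<alpha>) = v powr (- 1 - \<alpha>) + (\<Sum>h=1..L. 2 * cos (2 * pi * real h * v) * v powr (- 1 - \<alpha>))" for v
      by (simp add: dirichlet_kernel_def distrib_right sum_distrib_left sum_distrib_right)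
    then show ?thesis
      by (simp only:) (intro has_integral_add pi has_integral_sum integrable_integral ci; simp)
  qed
  have "norm ((\<Sum>d=nat \<lceil>c\<rceil>..m. f (real d)) - integral {c..real m} (\<lambda>u. dirichlet_kernel L u *\<^sub>R f u)
            - (1 / 2) *\<^sub>R f (real m) - saw_rem L (c - \<lceil>c\<rceil> + 1) *\<^sub>R f c)
         \<le> real (m + 1) * ((1 + \<alpha>) * c powr (- 2 - \<alpha>) * (6 / sqrt (2 * real L + 1)))"
  proof (rule euler_maclaurin_truncated)
    show "norm (f' u) \<le> (1 + \<alpha>) * c powr (- 2 - \<alpha>)" if "u \<in> {c..real m}" for u
    proof -
      have "norm (f' u) = (1 + \<alpha>) * u powr (- 2 - \<alpha>)" using alpha unfolding f'_def norm_of_real by (simp add: abs_mult)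
      also have "\<dots> \<le> (1 + \<alpha>) * c powr (- 2 - \<alpha>)"
        using that c alpha by (intro mult_left_mono powr_mono2') auto
      finally show ?thesis .
    qed
    show "continuous_on {c..real m} f'" unfolding f'_def using c by (auto intro!: continuous_intros)
  qed (use c f_deriv in auto)
  also have "integral {c..real m} (\<lambda>u. dirichlet_kernel L u *\<^sub>R f u) = of_real
      ((c powr (- \<alpha>) - real m powr (- \<alpha>)) / \<alpha> + (\<Sum>h=1..L. integral {c..real m} (\<lambda>v. 2 * cos (2 * pi * real h * v) * v powr (- 1 - \<alpha>))))"
  proof -
    have "((\<lambda>v. complex_of_real (dirichlet_kernel L v * v powr (- 1 - \<alpha>))) has_integral
      of_real ((c powr (- \<alpha>) - real m powr (- \<alpha>)) / \<alpha> + (\<Sum>h=1..L. integral {c..real m} (\<lambda>v. 2 * cos (2 * pi * real h * v) * v powr (- 1 - \<alpha>))))) {c..real m}"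
      by (rule has_integral_of_real[OF ki])
    from integral_unique[OF this] show ?thesis by (simp only: f_def scaleR_conv_of_real of_real_mult)
  qed
  also have "(\<Sum>d=nat \<lceil>c\<rceil>..m. f (real d)) - of_real
      ((c powr (- \<alpha>) - real m powr (- \<alpha>)) / \<alpha> + (\<Sum>h=1..L. integral {c..real m} (\<lambda>v. 2 * cos (2 * pi * real h * v) * v powr (- 1 - \<alpha>))))
      - (1 / 2) *\<^sub>R f (real m) - saw_rem L (c - \<lceil>c\<rceil> + 1) *\<^sub>R f c =
     complex_of_real ((\<Sum>n=1..m. real n powr (- 1 - \<alpha>)) -
      ((c powr (- \<alpha>) - real m powr (- \<alpha>)) / \<alpha> + (\<Sum>h=1..L. integral {c..real m} (\<lambda>v. 2 * cos (2 * pi * real h * v) * v powr (- 1 - \<alpha>))))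
      - real m powr (- 1 - \<alpha>) / 2 - saw_rem L c * c powr (- 1 - \<alpha>))"
    by (simp add: ceil f_def scaleR_conv_of_real)
  finally show ?thesis
    unfolding c_def[symmetric] norm_of_real by (subst abs_minus_commute) (simp add: algebra_simps)
qed

section \<open>Evaluation of the sum of the zero frequencies\<close>

lemma H_bounds: "1 \<le> H" "real H \<le> Z * real D" "Z * real D / 2 \<le> real H" "M \<le> H" "Z * real D < real H + 1"
proof -
  have ZD: "Z * real D \<ge> 2 * real M + 1" using ZD_ge by (simp add: N_def)
  show H: "1 \<le> H" "M \<le> H" "real H \<le> Z * real D" "Z * real D < real H + 1"
    unfolding H_def using ZD by linarith+
  show "Z * real D / 2 \<le> real H" using H by linarith
qed

lemma sum_inverse_squares_le:
  assumes "1 \<le> a" "a \<le> b"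
  shows "(\<Sum>h=Suc a..b. 1 / (real h)\<^sup>2) \<le> 1 / real a - 1 / real b"
  using assms(2)
proof (induction b rule: dec_induct)
  case (step b)
  have "1 / (real (Suc b))\<^sup>2 \<le> 1 / real b - 1 / real (Suc b)"
  proof -
    have "1 / (real (Suc b))\<^sup>2 \<le> 1 / (real b * real (Suc b))"
      using step assms by (intro divide_left_mono) (auto simp: power2_eq_square)
    also have "\<dots> = 1 / real b - 1 / real (Suc b)" using step assms by (simp add: field_simps)
    finally show ?thesis .
  qed
  then show ?case using step by simp
qed simp

text \<open>For \<open>s = zeta (1 + \<alpha>)\<close> the last summand is a main term of the
  divisor sum, and the other two cancel against the end terms at \<open>D\<close> of the smooth sums
  over \<open>d\<close>. The argument \<open>s\<close> also admits partial zeta sums before the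
  limit.\<close>

definition main_term :: "real \<Rightarrow> real" where
  "main_term s = real D powr (1 + \<alpha>) / (2 * (1 + \<alpha>)) - x * real D powr \<alpha> / \<alpha> + x powr (1 + \<alpha>) / (1 + \<alpha>) * s"

definition int_sum :: real where
  "int_sum = (\<Sum>h=1..H. Im (integral {real h / Z..real D} (F h)) / (pi * real h))"

text \<open>The lower limits move from \<open>h / Z\<close> to the common \<open>x / m\<close>, and
  \<open>h\<close> runs on to \<open>L\<close>. The first change costs order \<open>1 / N\<close>
  for each of \<open>H\<close> terms, the second a tail of \<open>1 / h^2\<close>; relative to
  \<open>D powr \<alpha>\<close> both are of order \<open>D / (Z x)\<close>.\<close>

lemma int_sum_finite:
  assumes m: "m \<ge> 1" "x * Z \<le> real m" and L: "H \<le> L"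
  shows "\<bar>int_sum - (\<Sum>h=1..L. Im (integral {x / real m..real D} (F h)) / (pi * real h))\<bar> \<le> 24 * real D powr \<alpha> * (real D / (Z * x))"
proof -
  define e where "e = x / real m"
  have e: "e > 0" "e \<le> 1 / Z" using m x_pos Z_pos by (simp_all add: e_def field_simps)
  have low: "\<bar>Im (integral {real h / Z..real D} (F h)) / (pi * real h) - Im (integral {e..real D} (F h)) / (pi * real h)\<bar> \<le> 8 * real D powr \<alpha> / N"
    if "h \<in> {1..H}" for h
  proof -
    have h: "h \<ge> 1" "real h > 0" "real h \<le> Z * real D" using that H_bounds by auto
    have w: "e \<le> real h / Z" "real h / Z \<le> real D"
    proof -
      have "1 / Z \<le> real h / Z" using h Z_pos by (intro divide_right_mono) auto
      then show "e \<le> real h / Z" using e by linarith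
      show "real h / Z \<le> real D" using h Z_pos by (simp add: divide_le_eq mult.commute)
    qed
    have split: "integral {e..real D} (F h) = integral {e..real h / Z} (F h) + integral {real h / Z..real D} (F h)"
      by (rule Henstock_Kurzweil_Integration.integral_combine[symmetric]) (use w F_integrable e in auto)
    have "\<bar>Im (integral {real h / Z..real D} (F h)) / (pi * real h) - Im (integral {e..real D} (F h)) / (pi * real h)\<bar>
       = \<bar>Im (integral {e..real h / Z} (F h))\<bar> / (pi * real h)"
      unfolding split by (simp add: diff_divide_distrib[symmetric] abs_mult)
    also have "\<dots> \<le> (8 * (real h / Z) powr \<alpha> * (real h / Z)\<^sup>2 / (real h * x)) / (1 * real h)"
      using h pi_gt3 F_integral_le[OF e(1) w(1) h(1)] abs_Im_le_cmod[of "integral {e..real h / Z} (F h)"]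
      by (intro frac_le mult_right_mono) auto
    also have "\<dots> = 8 * (real h / Z) powr \<alpha> / N"
      using h Z_pos x_pos Z_sq[symmetric] by (simp add: power_divide power2_eq_square)
    also have "\<dots> \<le> 8 * real D powr \<alpha> / N"
      using h w Z_pos N_pos alpha by (intro divide_right_mono mult_left_mono powr_mono2) auto
    finally show ?thesis .
  qed
  have high: "\<bar>Im (integral {e..real D} (F h)) / (pi * real h)\<bar> \<le> 8 * real D powr \<alpha> * (real D)\<^sup>2 / x * (1 / (real h)\<^sup>2)"
    if "h \<in> {Suc H..L}" for h
  proof -
    have h: "h \<ge> 1" "real h > 0" using that by auto
    have eD: "e \<le> real D"
    proof -
      have "1 / Z \<le> real H / Z" using H_bounds Z_pos by (intro divide_right_mono) auto
      also have "\<dots> \<le> real D" using H_bounds Z_pos by (simp add: divide_le_eq mult.commute)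
      finally show ?thesis using e by linarith
    qed
    have "\<bar>Im (integral {e..real D} (F h)) / (pi * real h)\<bar> = \<bar>Im (integral {e..real D} (F h))\<bar> / (pi * real h)"
      by (simp add: abs_mult)
    also have "\<dots> \<le> (8 * real D powr \<alpha> * (real D)\<^sup>2 / (real h * x)) / (1 * real h)"
      using h pi_gt3 F_integral_le[OF e(1) eD h(1)] abs_Im_le_cmod[of "integral {e..real D} (F h)"]
      by (intro frac_le mult_right_mono) auto
    also have "\<dots> = 8 * real D powr \<alpha> * (real D)\<^sup>2 / x * (1 / (real h)\<^sup>2)"
      by (simp add: power2_eq_square)
    finally show ?thesis .
  qed
  have ZD: "Z * real D / N = real D / (Z * x)"
    using Z_sq Z_pos x_pos N_pos by (simp add: field_simps power2_eq_square)
  have "{1..L} = {1..H} \<union> {Suc H..L}" using L H_bounds by auto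
  then have "(\<Sum>h=1..L. Im (integral {e..real D} (F h)) / (pi * real h)) =
     (\<Sum>h=1..H. Im (integral {e..real D} (F h)) / (pi * real h)) + (\<Sum>h=Suc H..L. Im (integral {e..real D} (F h)) / (pi * real h))"
    by (simp only:) (rule sum.union_disjoint; auto)
  then have "\<bar>int_sum - (\<Sum>h=1..L. Im (integral {e..real D} (F h)) / (pi * real h))\<bar> \<le>
     \<bar>\<Sum>h=1..H. Im (integral {real h / Z..real D} (F h)) / (pi * real h) - Im (integral {e..real D} (F h)) / (pi * real h)\<bar>
     + \<bar>\<Sum>h=Suc H..L. Im (integral {e..real D} (F h)) / (pi * real h)\<bar>"
    by (simp add: int_sum_def sum_subtractf)
  also have "\<bar>\<Sum>h=1..H. Im (integral {real h / Z..real D} (F h)) / (pi * real h) - Im (integral {e..real D} (F h)) / (pi * real h)\<bar>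
     \<le> (\<Sum>h=1..H. 8 * real D powr \<alpha> / N)"
    by (rule order_trans[OF sum_abs sum_mono[OF low]])
  also have "\<dots> = 8 * real D powr \<alpha> * (real H / N)" by simp
  also have "\<dots> \<le> 8 * real D powr \<alpha> * (Z * real D / N)"
    using H_bounds N_pos by (intro mult_left_mono divide_right_mono) auto
  also have "\<bar>\<Sum>h=Suc H..L. Im (integral {e..real D} (F h)) / (pi * real h)\<bar> \<le> (\<Sum>h=Suc H..L. 8 * real D powr \<alpha> * (real D)\<^sup>2 / x * (1 / (real h)\<^sup>2))"
    by (rule order_trans[OF sum_abs sum_mono[OF high]])
  also have "\<dots> = 8 * real D powr \<alpha> * (real D)\<^sup>2 / x * (\<Sum>h=Suc H..L. 1 / (real h)\<^sup>2)"
    by (simp only: sum_distrib_left)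
  also have "\<dots> \<le> 8 * real D powr \<alpha> * (real D)\<^sup>2 / x * (2 / (Z * real D))"
  proof (rule mult_left_mono)
    have "(\<Sum>h=Suc H..L. 1 / (real h)\<^sup>2) \<le> 1 / real H - 1 / real L"
      by (rule sum_inverse_squares_le[OF H_bounds(1) L])
    also have "\<dots> \<le> 1 / real H" by simp
    also have "\<dots> \<le> 1 / (Z * real D / 2)"
      using H_bounds Z_pos D_pos by (intro divide_left_mono) auto
    finally show "(\<Sum>h=Suc H..L. 1 / (real h)\<^sup>2) \<le> 2 / (Z * real D)" by simp
  qed (use x_pos in auto)
  also have "\<dots> = 16 * real D powr \<alpha> * (real D / (Z * x))"
    using D_pos by (simp add: power2_eq_square mult.commute)
  finally show ?thesis unfolding ZD e_def by (simp add: mult_ac)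
qed

text \<open>With \<open>m\<close> fixed, letting the number \<open>L\<close> of frequencies tend to
  infinity removes the Euler-Maclaurin error, while the cost of changing the integrals is
  independent of \<open>L\<close>.\<close>

lemma int_sum_partial:
  assumes m: "m \<ge> 1" "x * Z \<le> real m"
  shows "\<bar>int_sum - main_term ((\<Sum>n=1..m. real n powr (- 1 - \<alpha>)) - real m powr (- 1 - \<alpha>) / 2 + real m powr (- \<alpha>) / \<alpha>)\<bar>
     \<le> 24 * real D powr \<alpha> * (real D / (Z * x))"
proof -
  define c where "c = x / real D"
  define s where "s = (\<Sum>n=1..m. real n powr (- 1 - \<alpha>)) - real m powr (- 1 - \<alpha>) / 2 + real m powr (- \<alpha>) / \<alpha>"
  define E where "E = 24 * real D powr \<alpha> * (real D / (Z * x))"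
  define C where "C = x powr (1 + \<alpha>) / (1 + \<alpha>) * (real (m + 1) * ((1 + \<alpha>) * c powr (- 2 - \<alpha>) * 6))"
  have c: "c > 0" using x_pos D_pos by (simp add: c_def)
  have eD: "x / real m \<le> real D"
  proof -
    have "x / real m \<le> x" using m x_pos by (simp add: divide_le_eq)
    then show ?thesis using D2x x_pos by linarith
  qed
  have "c \<le> 1" using D2x x_pos D_pos by (simp add: c_def divide_le_eq)
  then have cm: "c \<le> real m" using m by linarith
  have step: "\<bar>int_sum - main_term s\<bar> \<le> E + C / sqrt (2 * real L + 1)" if L: "H \<le> L" for L
  proof -
    define T where "T = (\<Sum>h=1..L. integral {c..real m} (\<lambda>v. 2 * cos (2 * pi * real h * v) * v powr (- 1 - \<alpha>)))"
    define Y where "Y = (\<Sum>h=1..L. Im (integral {x / real m..real D} (F h)) / (pi * real h))"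
    have "Y = (\<Sum>h=1..L. real D powr (1 + \<alpha>) / (1 + \<alpha>) * (sin (2 * pi * real h * c) / (pi * real h))
       + x powr (1 + \<alpha>) / (1 + \<alpha>) * integral {c..real m} (\<lambda>v. 2 * cos (2 * pi * real h * v) * v powr (- 1 - \<alpha>)))"
      unfolding Y_def c_def by (rule sum.cong[OF refl Im_F_integral[OF refl m(1) eD]]) simp
    also have "\<dots> = real D powr (1 + \<alpha>) / (1 + \<alpha>) * (\<Sum>h=1..L. sin (2 * pi * real h * c) / (pi * real h)) + x powr (1 + \<alpha>) / (1 + \<alpha>) * T"
      unfolding T_def by (simp only: sum.distrib sum_distrib_left)
    also have "(\<Sum>h=1..L. sin (2 * pi * real h * c) / (pi * real h)) = saw_rem L c - c + 1 / 2"
      by (simp add: saw_rem_def)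
    finally have Y: "Y = real D powr (1 + \<alpha>) / (1 + \<alpha>) * (saw_rem L c - c + 1 / 2) + x powr (1 + \<alpha>) / (1 + \<alpha>) * T" .
    define W where "W = s - c powr (- \<alpha>) / \<alpha> - saw_rem L c * c powr (- 1 - \<alpha>)"
    have "\<bar>T - W\<bar> \<le> real (m + 1) * ((1 + \<alpha>) * c powr (- 2 - \<alpha>) * (6 / sqrt (2 * real L + 1)))"
      using zeta_partial_sum_expansion[of m L] m cm unfolding T_def W_def s_def c_def
      by (simp add: diff_divide_distrib algebra_simps)
    then have "x powr (1 + \<alpha>) / (1 + \<alpha>) * \<bar>T - W\<bar> \<le> C / sqrt (2 * real L + 1)"
      using mult_left_mono[of "\<bar>T - W\<bar>" _ "x powr (1 + \<alpha>) / (1 + \<alpha>)"] alpha by (fastforce simp: C_def)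
    \<comment> \<open>The two \<open>saw_rem\<close> terms at \<open>c = x / D\<close>, from the
      sine series and from the zeta expansion, cancel because \<open>x powr (1 + \<alpha>) * c powr
      (- 1 - \<alpha>) = D powr (1 + \<alpha>)\<close>.\<close>
    moreover have "Y - main_term s = x powr (1 + \<alpha>) / (1 + \<alpha>) * (T - W)"
    proof -
      have p1: "x powr (1 + \<alpha>) * c powr (- 1 - \<alpha>) = real D powr (1 + \<alpha>)"
        and p2: "x powr (1 + \<alpha>) * c powr (- \<alpha>) = x * real D powr \<alpha>"
        and p3: "real D powr (1 + \<alpha>) * c = x * real D powr \<alpha>"
        using x_pos D_pos unfolding c_def
        by (simp_all add: powr_divide powr_minus powr_add powr_diff field_simps)
      have "x powr (1 + \<alpha>) / (1 + \<alpha>) * W = (x powr (1 + \<alpha>) * s - (x powr (1 + \<alpha>) * c powr (- \<alpha>)) / \<alpha> - saw_rem L c * (x powr (1 + \<alpha>) * c powr (- 1 - \<alpha>))) / (1 + \<alpha>)"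
        unfolding W_def times_divide_eq_left
        by (rule arg_cong[where f = "\<lambda>t. t / (1 + \<alpha>)"]) (simp add: right_diff_distrib mult_ac)
      also have "\<dots> = (x powr (1 + \<alpha>) * s - x * real D powr \<alpha> / \<alpha> - saw_rem L c * real D powr (1 + \<alpha>)) / (1 + \<alpha>)"
        unfolding p1 p2 ..
      finally have xW: "x powr (1 + \<alpha>) / (1 + \<alpha>) * W = (x powr (1 + \<alpha>) * s - x * real D powr \<alpha> / \<alpha> - saw_rem L c * real D powr (1 + \<alpha>)) / (1 + \<alpha>)" .
      have yc: "real D powr (1 + \<alpha>) / (1 + \<alpha>) * (saw_rem L c - c + 1 / 2) =
         (real D powr (1 + \<alpha>) * saw_rem L c - x * real D powr \<alpha> + real D powr (1 + \<alpha>) / 2) / (1 + \<alpha>)"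
        unfolding p3[symmetric] times_divide_eq_left
        by (rule arg_cong[where f = "\<lambda>t. t / (1 + \<alpha>)"]) (simp add: right_diff_distrib distrib_left)
      have gen: "(d * r - q + d / 2) / (1 + \<alpha>) + t - (d / (2 * (1 + \<alpha>)) - q / \<alpha> + p / (1 + \<alpha>) * s) = t - (p * s - q / \<alpha> - r * d) / (1 + \<alpha>)"
        for d r q t p
      proof -
        have "q / \<alpha> - q / (1 + \<alpha>) = q / \<alpha> / (1 + \<alpha>)" using alpha by (simp add: field_simps)
        moreover have "d / 2 / (1 + \<alpha>) = d / (2 * (1 + \<alpha>))" by simp
        ultimately show ?thesis
          unfolding diff_divide_distrib add_divide_distrib times_divide_eq_left by (simp only: mult.commute[of d r])
      qed
      show ?thesis unfolding Y main_term_def yc right_diff_distrib xW by (rule gen)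
    qed
    then have "\<bar>Y - main_term s\<bar> = x powr (1 + \<alpha>) / (1 + \<alpha>) * \<bar>T - W\<bar>"
      using alpha by (simp add: abs_mult)
    ultimately have "\<bar>Y - main_term s\<bar> \<le> C / sqrt (2 * real L + 1)" by simp
    moreover have "\<bar>int_sum - Y\<bar> \<le> E"
      unfolding Y_def E_def by (rule int_sum_finite[OF m L])
    ultimately show ?thesis by linarith
  qed
  have "((\<lambda>L. E + C / sqrt (2 * real L + 1)) \<longlongrightarrow> E + 0) sequentially"
    by (intro tendsto_add tendsto_const) real_asymp
  then have "\<bar>int_sum - main_term s\<bar> \<le> E + 0"
    by (rule tendsto_lowerbound) (use step in \<open>auto simp: eventually_sequentially\<close>)
  then show ?thesis by (simp add: E_def s_def)
qed

theorem int_sum_main: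
  "\<bar>int_sum - main_term (Re (zeta (complex_of_real (1 + \<alpha>))))\<bar> \<le> 24 * real D powr \<alpha> * (real D / (Z * x))"
proof -
  let ?s = "\<lambda>m. (\<Sum>n=1..m. real n powr (- 1 - \<alpha>)) - real m powr (- 1 - \<alpha>) / 2 + real m powr (- \<alpha>) / \<alpha>"
  have "(\<lambda>m. \<Sum>n<m. real (Suc n) powr (- 1 - \<alpha>)) \<longlonglongrightarrow> Re (zeta (complex_of_real (1 + \<alpha>)))"
    using zeta_real_sums[OF alpha(1)] by (simp add: sums_def)
  also have "(\<lambda>m. \<Sum>n<m. real (Suc n) powr (- 1 - \<alpha>)) = (\<lambda>m. \<Sum>n=1..m. real n powr (- 1 - \<alpha>))"
    by (intro ext sum.reindex_bij_witness[where i = "\<lambda>n. n - 1" and j = Suc]) auto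
  finally have "?s \<longlonglongrightarrow> Re (zeta (complex_of_real (1 + \<alpha>))) - 0 / 2 + 0 / \<alpha>"
    using alpha by (intro tendsto_add tendsto_diff tendsto_divide tendsto_const tendsto_neg_powr filterlim_real_sequentially) auto
  then have lim: "(\<lambda>m. \<bar>int_sum - main_term (?s m)\<bar>) \<longlonglongrightarrow> \<bar>int_sum - main_term (Re (zeta (complex_of_real (1 + \<alpha>))))\<bar>"
    unfolding main_term_def by (intro tendsto_intros) simp
  have "eventually (\<lambda>m. \<bar>int_sum - main_term (?s m)\<bar> \<le> 24 * real D powr \<alpha> * (real D / (Z * x))) sequentially"
    unfolding eventually_sequentially
  proof (intro exI allI impI)
    fix m assume m: "max 1 (nat \<lceil>x * Z\<rceil>) \<le> m"
    then have "1 \<le> m" "x * Z \<le> real m" by linarith+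
    then show "\<bar>int_sum - main_term (?s m)\<bar> \<le> 24 * real D powr \<alpha> * (real D / (Z * x))" by (rule int_sum_partial)
  qed
  then show ?thesis by (rule tendsto_upperbound[OF lim]) simp
qed

end

section \<open>Summation over divisors\<close>

text \<open>Pairs are sorted by their product. As \<open>H\<close> and \<open>K\<close> are at least
  \<open>P\<close>, no pair is cut off and complete divisor sums appear.\<close>

lemma sum_divisor_pairs:
  fixes f :: "nat \<Rightarrow> nat \<Rightarrow> real"
  assumes "P \<le> H" "P \<le> K"
  shows "(\<Sum>h=1..H. \<Sum>k=1..K. if h * k \<le> P then f h (h * k) else 0) = (\<Sum>m=1..P. \<Sum>h | h dvd m. f h m)"
proof -
  have "(\<Sum>h=1..H. \<Sum>k=1..K. if h * k \<le> P then f h (h * k) else 0) =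
      (\<Sum>(h, k)\<in>{1..H} \<times> {1..K}. if h * k \<le> P then f h (h * k) else 0)"
    by (simp add: sum.cartesian_product)
  also have "\<dots> = (\<Sum>(h, k)\<in>{p\<in>{1..H} \<times> {1..K}. fst p * snd p \<le> P}. f h (h * k))"
    by (subst sum.inter_filter) (auto intro!: sum.cong)
  also have "\<dots> = (\<Sum>(m, h)\<in>Sigma {1..P} (\<lambda>m. {h. h dvd m}). f h m)"
  proof (rule sum.reindex_bij_witness[where i = "\<lambda>(m, h). (h, m div h)" and j = "\<lambda>(h, k). (h * k, h)"])
    fix q assume q: "q \<in> Sigma {1..P} (\<lambda>m. {h. h dvd m})"
    obtain m h where mh: "q = (m, h)" "1 \<le> m" "m \<le> P" "h dvd m" using q by auto
    then have "h \<le> m" "m div h \<le> m" "1 \<le> h" "1 \<le> m div h"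
      by (auto dest: dvd_imp_le simp: Suc_le_eq div_greater_zero_iff dvd_pos_nat)
    then show "(case q of (m, h) \<Rightarrow> (h, m div h)) \<in> {p\<in>{1..H} \<times> {1..K}. fst p * snd p \<le> P}"
    proof -
      have "h \<le> H" "m div h \<le> K"
        using mh assms \<open>h \<le> m\<close> \<open>m div h \<le> m\<close> by linarith+
      then show ?thesis using mh \<open>1 \<le> h\<close> \<open>1 \<le> m div h\<close> by auto
    qed
    show "(case case q of (m, h) \<Rightarrow> (h, m div h) of (h, k) \<Rightarrow> (h * k, h)) = q"
      using mh by simp
  next
    fix p assume "p \<in> {p\<in>{1..H} \<times> {1..K}. fst p * snd p \<le> P}"
    then obtain h k where hk: "p = (h, k)" "1 \<le> h" "1 \<le> k" "h * k \<le> P" by auto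
    show "(case case p of (h, k) \<Rightarrow> (h * k, h) of (m, h) \<Rightarrow> (h, m div h)) = p" using hk by simp
    show "(case p of (h, k) \<Rightarrow> (h * k, h)) \<in> Sigma {1..P} (\<lambda>m. {h. h dvd m})" using hk by (auto simp: Suc_le_eq)
    show "(case case p of (h, k) \<Rightarrow> (h * k, h) of (m, h) \<Rightarrow> f h m) = (case p of (h, k) \<Rightarrow> f h (h * k))" using hk by simp
  qed
  also have "\<dots> = (\<Sum>m=1..P. \<Sum>h | h dvd m. f h m)"
    by (rule sum.Sigma[symmetric]) auto
  finally show ?thesis .
qed

text \<open>For nonnegative terms the ranges may be enlarged until all divisors occur.\<close>

lemma sum_divisor_pairs_le:
  fixes g :: "nat \<Rightarrow> real"
  assumes g: "\<And>m. 0 \<le> g m" and T: "\<And>m. 1 \<le> m \<Longrightarrow> m \<le> P \<Longrightarrow> real (card {d. d dvd m}) \<le> T"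
  shows "(\<Sum>h=1..H. \<Sum>k=1..K. if h * k \<le> P then g (h * k) else 0) \<le> T * (\<Sum>m=1..P. g m)"
proof -
  have "(\<Sum>h=1..H. \<Sum>k=1..K. if h * k \<le> P then g (h * k) else 0) \<le> (\<Sum>h=1..max H P. \<Sum>k=1..K. if h * k \<le> P then g (h * k) else 0)"
    by (rule sum_mono2) (auto intro!: sum_nonneg g)
  also have "\<dots> \<le> (\<Sum>h=1..max H P. \<Sum>k=1..max K P. if h * k \<le> P then g (h * k) else 0)"
    by (rule sum_mono, rule sum_mono2) (auto intro!: g)
  also have "\<dots> = (\<Sum>m=1..P. \<Sum>h | h dvd m. g m)"
    by (rule sum_divisor_pairs[where f = "\<lambda>h m. g m"]) auto
  also have "\<dots> = (\<Sum>m=1..P. real (card {h. h dvd m}) * g m)" by simp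
  also have "\<dots> \<le> (\<Sum>m=1..P. T * g m)"
    by (intro sum_mono mult_right_mono T g) auto
  finally show ?thesis by (simp add: sum_distrib_left)
qed

lemma sin_frac: "sin (2 * pi * real h * frac y) = sin (2 * pi * real h * y)"
proof -
  have "2 * pi * real h * frac y = 2 * pi * real h * y - real_of_int (int h * \<lfloor>y\<rfloor>) * (2 * pi)"
    by (simp add: frac_def algebra_simps)
  then show ?thesis using sin.minus_of_int[of "2 * pi * real h * y" "int h * \<lfloor>y\<rfloor>"] by (simp add: mult_ac)
qed

text \<open>The identity is exact for every \<open>K\<close>, so the Fourier length may vary with
  \<open>d\<close>.\<close>

lemma floor_saw_rem:
  "of_int \<lfloor>y\<rfloor> = y - 1 / 2 - saw_rem K (frac y) + (\<Sum>h=1..K. sin (2 * pi * real h * y) / (pi * real h))"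
  by (simp add: saw_rem_def sin_frac) (simp add: frac_def)

lemma saw_rem_frac_decay:
  assumes "\<bar>y - real j\<bar> \<le> 1 / 2" "y \<noteq> real j"
  shows "\<bar>saw_rem K (frac y)\<bar> \<le> 1 / ((2 * real K + 1) * \<bar>y - real j\<bar>)"
proof (cases "real j < y")
  case True
  then have "\<lfloor>y\<rfloor> = int j" using assms by (intro floor_unique) auto
  then have f: "frac y = y - real j" by (simp add: frac_def)
  then show ?thesis using saw_rem_decay_aux[of "frac y" K] True assms by simp
next
  case False
  then have lt: "y < real j" using assms by simp
  then have "\<lfloor>y\<rfloor> = int j - 1" using assms by (intro floor_unique) auto
  then have f: "frac y = 1 - (real j - y)" by (simp add: frac_def)
  have "\<bar>saw_rem K (real j - y)\<bar> \<le> 1 / ((2 * real K + 1) * (real j - y))"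
    using lt assms by (intro saw_rem_decay_aux) auto
  then show ?thesis unfolding f saw_rem_reflect using lt by simp
qed

lemma sum_powr_le:
  assumes a: "0 < a" "a < 1"
  shows "\<bar>(\<Sum>d=1..n. real d powr a) - real n powr (1 + a) / (1 + a)\<bar> \<le> real n powr a"
proof -
  have "real n powr (1 + a) / (1 + a) \<le> (\<Sum>d=1..n. real d powr a) \<and> (\<Sum>d=1..n. real d powr a) \<le> real n powr (1 + a) / (1 + a) + real n powr a"
  proof (induction n)
    case (Suc n)
    have "real n * real n powr a \<le> real (Suc n) powr (1 + a) / (1 + a) - real n powr (1 + a) / (1 + a) + real n * real n powr a - real n powr a
       \<and> real (Suc n) powr (1 + a) / (1 + a) - real n powr (1 + a) / (1 + a) \<le> real (Suc n) powr a"
    proof (cases "n = 0")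
      case False
      then have n: "real n > 0" by simp
      have "\<exists>z>real n. z < real (Suc n) \<and> real (Suc n) powr (1 + a) / (1 + a) - real n powr (1 + a) / (1 + a) = (real (Suc n) - real n) * (z powr a)"
      proof (rule MVT2)
        fix z assume "real n \<le> z" "z \<le> real (Suc n)"
        then have "z > 0" using n by linarith
        then have "((\<lambda>z. z powr (1 + a) / (1 + a)) has_real_derivative (1 + a) * z powr (1 + a - 1) / (1 + a)) (at z)"
          by (intro DERIV_cdivide has_real_derivative_powr)
        then show "((\<lambda>z. z powr (1 + a) / (1 + a)) has_real_derivative z powr a) (at z)" using a by simp
      qed simp
      then obtain z where z: "real n < z" "z < real (Suc n)" "real (Suc n) powr (1 + a) / (1 + a) - real n powr (1 + a) / (1 + a) = z powr a"
        by auto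
      have "real n powr a \<le> z powr a" "z powr a \<le> real (Suc n) powr a"
        using z n a by (auto intro!: powr_mono2)
      then show ?thesis using z(3) by simp
    qed (use a in \<open>simp add: divide_le_eq\<close>)
    then show ?case using Suc by (simp del: of_nat_Suc)
  qed simp
  then show ?thesis by linarith
qed

context voronoi begin

definition osc_sum :: real where
  "osc_sum = (\<Sum>d=1..D. real d powr \<alpha> * (\<Sum>h=1..nat \<lfloor>Z * real d\<rfloor>. sin (2 * pi * real h * (x / real d)) / (pi * real h)))"

text \<open>After the interchange \<open>h <= Z d\<close> reads \<open>d >= h / Z\<close>; this
  creates the lower limit of the integrals.\<close>

lemma osc_sum_swap: "osc_sum = (\<Sum>h=1..H. Im (\<Sum>d=nat \<lceil>real h / Z\<rceil>..D. F h (real d)) / (pi * real h))"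
proof -
  have 1: "{1..nat \<lfloor>Z * real d\<rfloor>} = {h. h \<in> {1..H} \<and> real h \<le> Z * real d}" if "d \<in> {1..D}" for d
  proof -
    have "Z * real d \<le> Z * real D" using that Z_pos by (intro mult_left_mono) auto
    moreover have "0 \<le> Z * real d" using Z_pos by simp
    ultimately show ?thesis unfolding H_def by (auto simp: le_nat_iff le_floor_iff)
  qed
  have 2: "{nat \<lceil>real h / Z\<rceil>..D} = {d. d \<in> {1..D} \<and> real h \<le> Z * real d}" if "h \<in> {1..H}" for h
  proof (rule set_eqI)
    fix d
    have "real h / Z > 0" using that Z_pos by simp
    then have "1 \<le> d" if "real h / Z \<le> real d" using that by (cases d) auto
    moreover have "nat \<lceil>real h / Z\<rceil> \<le> d \<longleftrightarrow> real h / Z \<le> real d"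
      by (simp add: nat_le_iff ceiling_le_iff)
    moreover have "real h \<le> Z * real d \<longleftrightarrow> real h / Z \<le> real d"
      using Z_pos by (simp add: divide_le_eq mult.commute)
    ultimately show "d \<in> {nat \<lceil>real h / Z\<rceil>..D} \<longleftrightarrow> d \<in> {d. d \<in> {1..D} \<and> real h \<le> Z * real d}"
      by auto
  qed
  have "osc_sum = (\<Sum>d\<in>{1..D}. \<Sum>h | h \<in> {1..H} \<and> real h \<le> Z * real d. Im (F h (real d)) / (pi * real h))"
    unfolding osc_sum_def
  proof (rule sum.cong[OF refl])
    fix d assume d: "d \<in> {1..D}"
    show "real d powr \<alpha> * (\<Sum>h=1..nat \<lfloor>Z * real d\<rfloor>. sin (2 * pi * real h * (x / real d)) / (pi * real h))
       = (\<Sum>h | h \<in> {1..H} \<and> real h \<le> Z * real d. Im (F h (real d)) / (pi * real h))"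
      unfolding 1[OF d] sum_distrib_left by (rule sum.cong) (auto simp: F_def mult_ac)
  qed
  also have "\<dots> = (\<Sum>h\<in>{1..H}. \<Sum>d | d \<in> {1..D} \<and> real h \<le> Z * real d. Im (F h (real d)) / (pi * real h))"
    by (rule sum.swap_restrict) auto
  also have "\<dots> = (\<Sum>h=1..H. Im (\<Sum>d=nat \<lceil>real h / Z\<rceil>..D. F h (real d)) / (pi * real h))"
    by (rule sum.cong[OF refl]) (subst 2, auto simp: Im_sum sum_divide_distrib)
  finally show ?thesis .
qed

definition voronoi_sum :: real where
  "voronoi_sum = x powr (1 / 4 + \<alpha> / 2) / (sqrt 2 * pi) *
     (\<Sum>m=1..M. divisor_sigma \<alpha> m * real m powr (- (3 / 4) - \<alpha> / 2) * cos (4 * pi * sqrt (real m * x) - pi / 4))"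

text \<open>The shift by \<open>pi / 4\<close> comes from
  \<open>cos t + sin t = sqrt 2 cos (t - pi / 4)\<close>. The powers of \<open>h\<close> and
  \<open>k\<close> combine to \<open>h powr \<alpha>\<close> times a power of \<open>h k\<close>, so
  summing over the factorisations of \<open>m\<close> produces \<open>divisor_sigma\<close>.\<close>

lemma Im_saddle:
  assumes "h \<ge> 1" "k \<ge> 1"
  shows "Im (saddle h k) / (pi * real h) = x powr (1 / 4 + \<alpha> / 2) / (sqrt 2 * pi) *
     (real h powr \<alpha> * real (h * k) powr (- (3 / 4) - \<alpha> / 2) * cos (4 * pi * sqrt (real (h * k) * x) - pi / 4))"
proof -
  define \<theta> where "\<theta> = 4 * pi * sqrt (real (h * k) * x)"
  have hk: "real h > 0" "real k > 0" using assms by auto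
  have "Im (cis \<theta> * ((1 + \<i>) / 2)) = (cos \<theta> + sin \<theta>) / 2" by (simp add: field_simps)
  also have "\<dots> = cos (\<theta> - pi / 4) / sqrt 2"
  proof -
    have "cos (\<theta> - pi / 4) = (cos \<theta> + sin \<theta>) * (sqrt 2 / 2)"
      by (simp add: cos_diff cos_45 sin_45 distrib_right)
    then show ?thesis by simp
  qed
  finally have im: "Im (cis \<theta> * ((1 + \<i>) / 2)) = cos (\<theta> - pi / 4) / sqrt 2" .
  have "sqrt (real h * x / real k) powr (\<alpha> + 1 / 2) = (real h * x / real k) powr ((\<alpha> + 1 / 2) / 2)"
    using hk x_pos by (simp add: powr_half_sqrt[symmetric] powr_powr)
  also have "(\<alpha> + 1 / 2) / 2 = 1 / 4 + \<alpha> / 2" by simp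
  finally have u0: "sqrt (real h * x / real k) powr (\<alpha> + 1 / 2) = (real h * x / real k) powr (1 / 4 + \<alpha> / 2)" .
  have amp: "(real h * x / real k) powr (1 / 4 + \<alpha> / 2) / sqrt (real k) / real h =
     x powr (1 / 4 + \<alpha> / 2) * (real h powr \<alpha> * real (h * k) powr (- (3 / 4) - \<alpha> / 2))"
  proof -
    have "(real h * x / real k) powr (1 / 4 + \<alpha> / 2) / sqrt (real k) / real h =
      x powr (1 / 4 + \<alpha> / 2) * (real h powr (1 / 4 + \<alpha> / 2) * real h powr (- 1)) * (real k powr (- (1 / 4 + \<alpha> / 2)) * real k powr (- (1 / 2)))"
      using hk x_pos by (simp add: powr_mult powr_divide powr_minus powr_half_sqrt field_simps)
    also have "real h powr (1 / 4 + \<alpha> / 2) * real h powr (- 1) = real h powr \<alpha> * real h powr (- (3 / 4) - \<alpha> / 2)"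
      unfolding powr_add[symmetric] by (rule arg_cong[where f = "\<lambda>t. real h powr t"]) (simp add: field_simps)
    also have "real k powr (- (1 / 4 + \<alpha> / 2)) * real k powr (- (1 / 2)) = real k powr (- (3 / 4) - \<alpha> / 2)"
      unfolding powr_add[symmetric] by (rule arg_cong[where f = "\<lambda>t. real k powr t"]) (simp add: field_simps)
    finally show ?thesis using hk by (simp add: powr_mult mult_ac)
  qed
  have "Im (saddle h k) = (real h * x / real k) powr (1 / 4 + \<alpha> / 2) / sqrt (real k) * Im (cis \<theta> * ((1 + \<i>) / 2))"
  proof -
    have "Im (of_real r * c * w) = r * Im (c * w)" for r c w by (simp add: algebra_simps)
    moreover have "real h * x * real k = real (h * k) * x" by simp
    ultimately show ?thesis unfolding saddle_def u0 \<theta>_def by (simp only:)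
  qed
  then have "Im (saddle h k) / (pi * real h) = ((real h * x / real k) powr (1 / 4 + \<alpha> / 2) / sqrt (real k) / real h) * cos (\<theta> - pi / 4) / (sqrt 2 * pi)"
    unfolding im by simp
  then show ?thesis unfolding amp \<theta>_def by simp
qed

lemma saddle_sum:
  assumes "M \<le> K"
  shows "(\<Sum>h=1..H. Im (\<Sum>k=1..K. if h * k \<le> M then saddle h k else 0) / (pi * real h)) = voronoi_sum"
proof -
  define f where "f = (\<lambda>h m. x powr (1 / 4 + \<alpha> / 2) / (sqrt 2 * pi) *
     (real h powr \<alpha> * real m powr (- (3 / 4) - \<alpha> / 2) * cos (4 * pi * sqrt (real m * x) - pi / 4)))"
  have "(\<Sum>h=1..H. Im (\<Sum>k=1..K. if h * k \<le> M then saddle h k else 0) / (pi * real h))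
     = (\<Sum>h=1..H. \<Sum>k=1..K. if h * k \<le> M then f h (h * k) else 0)"
  proof (rule sum.cong[OF refl])
    fix h assume h: "h \<in> {1..H}"
    show "Im (\<Sum>k=1..K. if h * k \<le> M then saddle h k else 0) / (pi * real h) = (\<Sum>k=1..K. if h * k \<le> M then f h (h * k) else 0)"
      unfolding Im_sum sum_divide_distrib
    proof (rule sum.cong[OF refl])
      fix k assume "k \<in> {1..K}"
      then show "Im (if h * k \<le> M then saddle h k else 0) / (pi * real h) = (if h * k \<le> M then f h (h * k) else 0)"
        using Im_saddle[of h k] h by (simp add: f_def)
    qed
  qed
  also have "\<dots> = (\<Sum>m=1..M. \<Sum>h | h dvd m. f h m)"
    using H_bounds assms by (intro sum_divisor_pairs) auto
  also have "\<dots> = voronoi_sum"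
    unfolding voronoi_sum_def f_def divisor_sigma_def sum_distrib_left sum_distrib_right by simp
  finally show ?thesis .
qed

text \<open>Pairs \<open>d k <= x\<close> are counted by \<open>d\<close>; those \<open>d\<close>
  between \<open>x\<close> and \<open>D\<close> exceeding \<open>x\<close> contribute zero, so the
  sum may run up to \<open>D\<close>.\<close>

lemma divisor_sum_eq:
  "(\<Sum>n | 0 < n \<and> real n \<le> x. divisor_sigma \<alpha> n) = (\<Sum>d=1..D. real d powr \<alpha> * of_int \<lfloor>x / real d\<rfloor>)"
proof -
  define X where "X = nat \<lfloor>x\<rfloor>"
  have XD: "X \<le> D" using D2x x_pos unfolding X_def by linarith
  have "{n. 0 < n \<and> real n \<le> x} = {1..X}" using x_pos unfolding X_def by (auto simp: le_nat_iff le_floor_iff)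
  then have "(\<Sum>n | 0 < n \<and> real n \<le> x. divisor_sigma \<alpha> n) = (\<Sum>n=1..X. \<Sum>d | d dvd n. real d powr \<alpha>)"
    by (simp add: divisor_sigma_def)
  also have "\<dots> = (\<Sum>d=1..D. \<Sum>k=1..X. if d * k \<le> X then real d powr \<alpha> else 0)"
    by (rule sum_divisor_pairs[where f = "\<lambda>d n. real d powr \<alpha>", symmetric]) (use XD in auto)
  also have "\<dots> = (\<Sum>d=1..D. real d powr \<alpha> * of_int \<lfloor>x / real d\<rfloor>)"
  proof (rule sum.cong[OF refl])
    fix d assume "d \<in> {1..D}"
    then have d: "d > 0" by simp
    have "k \<le> X" if "d * k \<le> X" for k
      using mult_le_mono1[of 1 d k] d that by linarith
    then have "{k\<in>{1..X}. d * k \<le> X} = {1..X div d}"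
      using d by (auto simp: less_eq_div_iff_mult_less_eq mult.commute)
    then have "(\<Sum>k=1..X. if d * k \<le> X then real d powr \<alpha> else 0) = real d powr \<alpha> * real (X div d)"
      by (subst sum.inter_filter[symmetric]) simp_all
    also have "real (X div d) = of_int \<lfloor>x / real d\<rfloor>"
    proof -
      have "\<lfloor>x / real d\<rfloor> = \<lfloor>x\<rfloor> div int d" using floor_divide_real_eq_div[of "int d" x] by simp
      also have "\<lfloor>x\<rfloor> = int X" using x_pos by (simp add: X_def)
      finally show ?thesis by (simp flip: zdiv_int)
    qed
    finally show "(\<Sum>k=1..X. if d * k \<le> X then real d powr \<alpha> else 0) = real d powr \<alpha> * of_int \<lfloor>x / real d\<rfloor>" .
  qed
  finally show ?thesis .
qed

end

section \<open>The truncated Voronoi formula\<close>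

context voronoi begin

text \<open>With \<open>t = |N - m|\<close> one has \<open>N <= m + t\<close>, which separates a
  harmonic term from \<open>1 / t\<close>. Beyond \<open>2 M\<close> moreover
  \<open>t >= m / 2\<close>, so \<open>1 / t\<close> joins the harmonic part; hence
  \<open>608 = 288 + 320\<close>.\<close>

lemma pair_error_le:
  assumes m: "m \<ge> 1"
  shows "(128 + 160 * (N / \<bar>N - real m\<bar>)) / real m \<le> 608 / real m + (if m \<le> 2 * M then 160 / \<bar>N - real m\<bar> else 0)"
proof -
  define t where "t = \<bar>N - real m\<bar>"
  have t: "t > 0" using N_minus_nat[of m] unfolding t_def by linarith
  have m0: "real m > 0" using m by simp
  have "N / (t * real m) \<le> (real m + t) / (t * real m)"
    using t m0 by (intro divide_right_mono) (auto simp: t_def)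
  also have "\<dots> = 1 / t + 1 / real m" using t m0 by (simp add: field_simps)
  finally have 1: "N / (t * real m) \<le> 1 / t + 1 / real m" .
  have 2: "1 / t \<le> 2 / real m" if "\<not> m \<le> 2 * M"
  proof -
    have "real m \<ge> 2 * real M + 1" using that by linarith
    then have "real m / 2 \<le> t" by (simp add: t_def N_def)
    then have "1 / t \<le> 1 / (real m / 2)" using m0 t by (intro divide_left_mono) auto
    then show ?thesis by simp
  qed
  define q r where "q = 1 / real m" and "r = 1 / t"
  have q: "q \<ge> 0" by (simp add: q_def)
  have e: "128 / real m = 128 * q" "608 / real m = 608 * q" "2 / real m = 2 * q" "160 / t = 160 * r"
    by (simp_all add: q_def r_def)
  have "(128 + 160 * (N / t)) / real m = 128 / real m + 160 * (N / (t * real m))"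
    using m0 t by (simp add: field_simps)
  also have "\<dots> \<le> 128 / real m + 160 * (1 / t + 1 / real m)" using 1 by simp
  also have "\<dots> = 288 * q + 160 * r" unfolding e(1) q_def r_def by simp
  also have "\<dots> \<le> 608 / real m + (if m \<le> 2 * M then 160 / t else 0)"
  proof (cases "m \<le> 2 * M")
    case True
    then show ?thesis unfolding e using q by simp
  next
    case False
    then have "r \<le> 2 * q" using 2 unfolding e r_def by blast
    then show ?thesis unfolding e using False by simp
  qed
  finally show ?thesis unfolding t_def .
qed

text \<open>The harmonic parts give a product of two logarithms. The pairs with
  \<open>h k <= 2 M\<close> are grouped by product at the price of a divisor count, leaving a sum of
  inverse distances from \<open>N\<close>.\<close>

lemma osc_sum_error:
  assumes M: "M \<ge> 1" and K: "real (D + 1) * (Z + 7 * N) \<le> sqrt (2 * real K + 1)" "M \<le> K"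
    and T: "\<And>m. 1 \<le> m \<Longrightarrow> m \<le> 2 * M \<Longrightarrow> real (card {d. d dvd m}) \<le> T"
  shows "\<bar>osc_sum - int_sum - voronoi_sum\<bar> \<le> real D powr \<alpha> *
    (9 * (1 + ln (real H)) + 608 * ((1 + ln (real H)) * (1 + ln (real K))) + 960 * (T * (1 + ln (2 * real M + 1))))"
proof -
  define L where "L = (\<lambda>h. \<Sum>k=1..K. (128 + 160 * (N / \<bar>N - real (h * k)\<bar>)) / real k)"
  have K1: "K \<ge> 1" using M K by simp
  have hH: "(\<Sum>h=1..H. 1 / real h) \<le> 1 + ln (real H)" by (rule harmonic_sum_le[OF H_bounds(1)])
  have hK: "(\<Sum>k=1..K. 1 / real k) \<le> 1 + ln (real K)" by (rule harmonic_sum_le[OF K1])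
  have T0: "T \<ge> 0" using T[of 1] M by (simp add: order_trans[OF of_nat_0_le_iff])
  define W where "W = (\<lambda>h. (\<Sum>d=nat \<lceil>real h / Z\<rceil>..D. F h (real d)) - integral {real h / Z..real D} (F h)
      - (\<Sum>k=1..K. if h * k \<le> M then saddle h k else 0))"
  have "osc_sum - int_sum - voronoi_sum = (\<Sum>h=1..H. Im (W h) / (pi * real h))"
    unfolding osc_sum_swap int_sum_def saddle_sum[OF K(2), symmetric] W_def
    by (simp add: sum_subtractf diff_divide_distrib)
  then have "\<bar>osc_sum - int_sum - voronoi_sum\<bar> \<le> (\<Sum>h=1..H. \<bar>Im (W h) / (pi * real h)\<bar>)"
    by (simp only: sum_abs)
  also have "\<dots> \<le> (\<Sum>h=1..H. real D powr \<alpha> * (9 * (1 / real h) + L h / real h))"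
  proof (rule sum_mono)
    fix h assume "h \<in> {1..H}"
    then have h: "h \<ge> 1" "real h \<le> Z * real D" using H_bounds by auto
    have "norm (W h) \<le> real D powr \<alpha> * (9 + L h)"
      unfolding W_def L_def by (rule sum_minus_integral[OF h K(1)])
    then have "\<bar>Im (W h)\<bar> / (pi * real h) \<le> real D powr \<alpha> * (9 + L h) / (1 * real h)"
      using h pi_gt3 abs_Im_le_cmod[of "W h"] by (intro frac_le mult_right_mono) auto
    then show "\<bar>Im (W h) / (pi * real h)\<bar> \<le> real D powr \<alpha> * (9 * (1 / real h) + L h / real h)"
      by (simp add: abs_mult add_divide_distrib distrib_left)
  qed
  also have "\<dots> = real D powr \<alpha> * (9 * (\<Sum>h=1..H. 1 / real h) + (\<Sum>h=1..H. L h / real h))"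
    by (simp only: sum.distrib sum_distrib_left[symmetric])
  also have "\<dots> \<le> real D powr \<alpha> * (9 * (1 + ln (real H)) + (608 * ((1 + ln (real H)) * (1 + ln (real K))) + 960 * (T * (1 + ln (2 * real M + 1)))))"
  proof (intro mult_left_mono add_mono hH)
    have "(\<Sum>h=1..H. L h / real h) \<le> (\<Sum>h=1..H. \<Sum>k=1..K. 608 * (1 / real h * (1 / real k)) + (if h * k \<le> 2 * M then 160 / \<bar>N - real (h * k)\<bar> else 0))"
    proof (rule sum_mono)
      fix h assume h: "h \<in> {1..H}"
      have "L h / real h = (\<Sum>k=1..K. (128 + 160 * (N / \<bar>N - real (h * k)\<bar>)) / real (h * k))"
        unfolding L_def sum_divide_distrib by (simp add: mult.commute)
      also have "\<dots> \<le> (\<Sum>k=1..K. 608 * (1 / real h * (1 / real k)) + (if h * k \<le> 2 * M then 160 / \<bar>N - real (h * k)\<bar> else 0))"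
      proof (rule sum_mono)
        fix k assume "k \<in> {1..K}"
        then have "h * k \<ge> 1" using h by (cases h; cases k) auto
        from pair_error_le[OF this]
        show "(128 + 160 * (N / \<bar>N - real (h * k)\<bar>)) / real (h * k) \<le> 608 * (1 / real h * (1 / real k)) + (if h * k \<le> 2 * M then 160 / \<bar>N - real (h * k)\<bar> else 0)"
          by simp
      qed
      finally show "L h / real h \<le> (\<Sum>k=1..K. 608 * (1 / real h * (1 / real k)) + (if h * k \<le> 2 * M then 160 / \<bar>N - real (h * k)\<bar> else 0))" .
    qed
    also have "\<dots> = 608 * ((\<Sum>h=1..H. 1 / real h) * (\<Sum>k=1..K. 1 / real k)) + (\<Sum>h=1..H. \<Sum>k=1..K. if h * k \<le> 2 * M then 160 / \<bar>N - real (h * k)\<bar> else 0)"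
    proof -
      have "608 * ((\<Sum>h=1..H. 1 / real h) * (\<Sum>k=1..K. 1 / real k)) = (\<Sum>h=1..H. \<Sum>k=1..K. 608 * (1 / real h * (1 / real k)))"
        unfolding sum_product by (simp only: sum_distrib_left)
      then show ?thesis by (simp only: sum.distrib)
    qed
    also have "\<dots> \<le> 608 * ((1 + ln (real H)) * (1 + ln (real K))) + T * (\<Sum>m=1..2*M. 160 / \<bar>N - real m\<bar>)"
    proof (intro add_mono mult_left_mono mult_mono hH hK)
      show "(\<Sum>h=1..H. \<Sum>k=1..K. if h * k \<le> 2 * M then 160 / \<bar>N - real (h * k)\<bar> else 0) \<le> T * (\<Sum>m=1..2*M. 160 / \<bar>N - real m\<bar>)"
        by (rule sum_divisor_pairs_le[where g = "\<lambda>m. 160 / \<bar>N - real m\<bar>"]) (use T in auto)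
    qed (use H_bounds in \<open>auto intro!: sum_nonneg add_nonneg_nonneg ln_ge_zero\<close>)
    also have "T * (\<Sum>m=1..2*M. 160 / \<bar>N - real m\<bar>) \<le> T * (160 * (6 * (1 + ln (2 * real M + 1))))"
    proof (rule mult_left_mono[OF _ T0])
      have "{n \<in> {1..2*M}. 1 / 2 \<le> \<bar>N - real n\<bar>} = {1..2*M}" using N_minus_nat by auto
      then have "(\<Sum>m=1..2*M. 1 / \<bar>N - real m\<bar>) \<le> 6 * (1 + ln (real (2 * M) + 1))"
        using sum_inverse_distance_le[of N "2 * M"] N_pos M by (simp add: N_def)
      moreover have "(\<Sum>m=1..2*M. 160 / \<bar>N - real m\<bar>) = 160 * (\<Sum>m=1..2*M. 1 / \<bar>N - real m\<bar>)"
        by (simp add: sum_distrib_left)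
      ultimately show "(\<Sum>m=1..2*M. 160 / \<bar>N - real m\<bar>) \<le> 160 * (6 * (1 + ln (2 * real M + 1)))" by simp
    qed
    finally show "(\<Sum>h=1..H. L h / real h) \<le> 608 * ((1 + ln (real H)) * (1 + ln (real K))) + 960 * (T * (1 + ln (2 * real M + 1)))"
      by (simp add: mult_ac)
  qed auto
  finally show ?thesis by (simp only: add.assoc)
qed

text \<open>With \<open>j\<close> the integer nearest to \<open>x / d\<close>, the distance between
  them is \<open>|x - d j| / d\<close>. The Fourier length \<open>Z d\<close> cancels this
  \<open>d\<close>, so the bound depends only on the product \<open>d j\<close>.\<close>

lemma saw_rem_multiple_bound:
  assumes d: "d \<ge> 1" and j: "j = nat (round (x / real d))"
  shows "\<bar>saw_rem (nat \<lfloor>Z * real d\<rfloor>) (frac (x / real d))\<bar> \<le>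
     (if \<bar>x - real (d * j)\<bar> < 1 / 2 then 2 else 1 / (Z * \<bar>x - real (d * j)\<bar>))"
proof (cases "\<bar>x - real (d * j)\<bar> < 1 / 2")
  case True
  then show ?thesis using saw_rem_bounded[of "frac (x / real d)"] frac_ge_0[of "x / real d"] frac_lt_1[of "x / real d"] by simp
next
  case False
  define y where "y = x / real d"
  have d0: "real d > 0" using d by simp
  have y0: "y > 0" using x_pos d0 by (simp add: y_def)
  have "round y \<ge> 0" using y0 by (simp add: round_def)
  then have "real j = of_int (round y)" by (simp add: j y_def)
  then have yj: "\<bar>y - real j\<bar> \<le> 1 / 2" using of_int_round_abs_le[of y] by (simp add: abs_minus_commute)
  have dist: "\<bar>x - real (d * j)\<bar> = real d * \<bar>y - real j\<bar>"
  proof -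
    have "x - real (d * j) = real d * (y - real j)" using d0 by (simp add: y_def right_diff_distrib)
    then show ?thesis using d0 by (simp add: abs_mult)
  qed
  have yne: "y \<noteq> real j" using False dist by auto
  define K where "K = nat \<lfloor>Z * real d\<rfloor>"
  have K: "Z * real d \<le> 2 * real K + 1"
  proof -
    have "Z * real d \<le> real K + 1" using Z_pos d0 unfolding K_def by simp
    then show ?thesis by linarith
  qed
  have "\<bar>saw_rem K (frac y)\<bar> \<le> 1 / ((2 * real K + 1) * \<bar>y - real j\<bar>)"
    by (rule saw_rem_frac_decay[OF yj yne])
  also have "\<dots> \<le> 1 / ((Z * real d) * \<bar>y - real j\<bar>)"
    using K yne Z_pos d0 by (intro divide_left_mono mult_right_mono mult_pos_pos) auto
  also have "\<dots> = 1 / (Z * \<bar>x - real (d * j)\<bar>)" unfolding dist by (simp add: mult.assoc)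
  finally show ?thesis using False by (simp add: K_def y_def)
qed

text \<open>Since the bound depends only on \<open>n = d j\<close>, the sum over \<open>d\<close>
  becomes one over \<open>n <= 2 x\<close>, each \<open>n\<close> occurring at most as often as it
  has divisors. The case \<open>j = 0\<close> is at distance \<open>x\<close> and gives
  \<open>D / (Z x)\<close> in total.\<close>

lemma truncation_error:
  assumes T: "\<And>m. 1 \<le> m \<Longrightarrow> m \<le> nat \<lfloor>2 * x\<rfloor> \<Longrightarrow> real (card {d. d dvd m}) \<le> T"
  shows "\<bar>\<Sum>d=1..D. real d powr \<alpha> * saw_rem (nat \<lfloor>Z * real d\<rfloor>) (frac (x / real d))\<bar>
     \<le> real D powr \<alpha> * (real D / (Z * x) + T * (2 + 6 * (1 + ln (2 * x + 1)) / Z))"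
proof -
  define P where "P = nat \<lfloor>2 * x\<rfloor>"
  define f where "f = (\<lambda>n. if \<bar>x - real n\<bar> < 1 / 2 then 2 else 1 / (Z * \<bar>x - real n\<bar>))"
  define R where "R = (\<lambda>d. saw_rem (nat \<lfloor>Z * real d\<rfloor>) (frac (x / real d)))"
  have P: "real P \<le> 2 * x" "x \<le> real P" using x1 unfolding P_def by linarith+
  have T0: "T \<ge> 0"
  proof -
    have "1 \<le> P" using P x1 by (cases P) auto
    then show ?thesis using T[of 1] by (simp add: P_def order_trans[OF of_nat_0_le_iff])
  qed
  have f0: "f n \<ge> 0" for n using Z_pos by (simp add: f_def)
  have each: "\<bar>R d\<bar> \<le> 1 / (Z * x) + (\<Sum>n | n \<in> {1..P} \<and> d dvd n. f n)" if "d \<in> {1..D}" for d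
  proof -
    have d: "d \<ge> 1" "real d > 0" using that by auto
    define j where "j = nat (round (x / real d))"
    have Rf: "\<bar>R d\<bar> \<le> f (d * j)"
      unfolding R_def f_def by (rule saw_rem_multiple_bound[OF d(1) j_def])
    have S0: "0 \<le> (\<Sum>n | n \<in> {1..P} \<and> d dvd n. f n)" by (rule sum_nonneg) (rule f0)
    show ?thesis
    proof (cases "j = 0")
      case True
      then have "f (d * j) \<le> 1 / (Z * x)" using x1 by (simp add: f_def)
      then show ?thesis using Rf S0 by linarith
    next
      case False
      have xd: "x / real d \<ge> 0" using x_pos by simp
      have r0: "round (x / real d) \<ge> 0" using xd by (simp add: round_def)
      have rj: "real j = of_int (round (x / real d))" using r0 by (simp add: j_def)
      have jle: "real j \<le> x / real d + 1 / 2" using of_int_round_abs_le[of "x / real d"] rj by linarith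
      \<comment> \<open>Rounding gives \<open>j <= x / d + 1/2\<close>, and \<open>j >= 1\<close>
        forces \<open>x / d >= 1/2\<close>; together the multiple is at most
        \<open>2 x\<close>.\<close>
      have "1 \<le> real j" using False by simp
      then have "1 / 2 \<le> x / real d" using jle by linarith
      then have "real j \<le> 2 * (x / real d)" using jle by linarith
      then have "real d * real j \<le> 2 * x" using d by (simp add: field_simps)
      then have "real (d * j) \<le> 2 * x" by simp
      then have "d * j \<le> P" unfolding P_def by linarith
      moreover have "1 \<le> d * j" using d False by simp
      ultimately have "f (d * j) \<le> (\<Sum>n | n \<in> {1..P} \<and> d dvd n. f n)"
        by (intro member_le_sum f0) auto
      moreover have "0 \<le> 1 / (Z * x)" using Z_pos x_pos by simp
      ultimately show ?thesis using Rf by linarith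
    qed
  qed
  have "\<bar>\<Sum>d=1..D. real d powr \<alpha> * R d\<bar> \<le> (\<Sum>d=1..D. real d powr \<alpha> * \<bar>R d\<bar>)"
    by (rule order_trans[OF sum_abs]) (simp add: abs_mult)
  also have "\<dots> \<le> (\<Sum>d=1..D. real D powr \<alpha> * (1 / (Z * x) + (\<Sum>n | n \<in> {1..P} \<and> d dvd n. f n)))"
    using alpha each by (intro sum_mono mult_mono powr_mono2) auto
  also have "\<dots> = real D powr \<alpha> * (real D / (Z * x) + (\<Sum>d\<in>{1..D}. \<Sum>n | n \<in> {1..P} \<and> d dvd n. f n))"
    by (simp add: sum_distrib_left[symmetric] sum.distrib)
  also have "(\<Sum>d\<in>{1..D}. \<Sum>n | n \<in> {1..P} \<and> d dvd n. f n) = (\<Sum>n\<in>{1..P}. \<Sum>d | d \<in> {1..D} \<and> d dvd n. f n)"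
    by (rule sum.swap_restrict) auto
  also have "\<dots> \<le> (\<Sum>n\<in>{1..P}. T * f n)"
  proof (rule sum_mono)
    fix n assume n: "n \<in> {1..P}"
    have "card {d. d \<in> {1..D} \<and> d dvd n} \<le> card {d. d dvd n}"
      using n by (intro card_mono) auto
    then have "real (card {d. d \<in> {1..D} \<and> d dvd n}) \<le> T"
      using T[of n] n by (simp add: P_def)
    then show "(\<Sum>d | d \<in> {1..D} \<and> d dvd n. f n) \<le> T * f n"
      using f0[of n] by (simp add: mult_right_mono)
  qed
  also have "\<dots> = T * (\<Sum>n=1..P. f n)" by (simp add: sum_distrib_left)
  also have "\<dots> \<le> T * (2 + 6 * (1 + ln (2 * x + 1)) / Z)"
  proof (rule mult_left_mono[OF _ T0])
    let ?A = "{n\<in>{1..P}. \<bar>x - real n\<bar> < 1 / 2}" and ?B = "{n\<in>{1..P}. 1 / 2 \<le> \<bar>x - real n\<bar>}"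
    have "(\<Sum>n=1..P. f n) = (\<Sum>n\<in>?A \<union> ?B. f n)" by (rule sum.cong) auto
    also have "\<dots> = (\<Sum>n\<in>?A. f n) + (\<Sum>n\<in>?B. f n)"
      by (rule sum.union_disjoint) auto
    also have "(\<Sum>n\<in>?A. f n) = 2 * real (card ?A)" by (simp add: f_def)
    also have "card ?A \<le> 1"
    proof -
      have "m = n" if "m \<in> ?A" "n \<in> ?A" for m n
      proof -
        have "\<bar>x - real m\<bar> < 1 / 2" "\<bar>x - real n\<bar> < 1 / 2" using that by auto
        then have "\<bar>real m - real n\<bar> < 1" by linarith
        then show ?thesis by linarith
      qed
      then show ?thesis by (subst card_le_Suc0_iff_eq[simplified One_nat_def[symmetric]]) auto
    qed
    also have "(\<Sum>n\<in>?B. f n) = (\<Sum>n\<in>?B. 1 / \<bar>x - real n\<bar>) / Z"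
      unfolding sum_divide_distrib by (rule sum.cong) (auto simp: f_def)
    also have "\<dots> \<le> 6 * (1 + ln (real P + 1)) / Z"
      using P x_pos Z_pos by (intro divide_right_mono sum_inverse_distance_le) auto
    also have "\<dots> \<le> 6 * (1 + ln (2 * x + 1)) / Z"
      using P x_pos Z_pos by (intro divide_right_mono mult_left_mono add_left_mono) auto
    finally show "(\<Sum>n=1..P. f n) \<le> 2 + 6 * (1 + ln (2 * x + 1)) / Z" by simp
  qed
  finally show ?thesis by (simp add: R_def mult_left_mono)
qed

text \<open>The finite form of the formula, with the divisor bound \<open>T\<close> and the
  frequency \<open>K\<close> still free. The end terms of size \<open>x D powr \<alpha>\<close> and
  \<open>D powr (1 + \<alpha>)\<close> in the smooth sums over \<open>d\<close> cancel against those
  of the zero frequencies.\<close>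

theorem voronoi_truncated:
  assumes M: "M \<ge> 1" and K: "real (D + 1) * (Z + 7 * N) \<le> sqrt (2 * real K + 1)" "M \<le> K"
    and T: "\<And>m. 1 \<le> m \<Longrightarrow> m \<le> max (2 * M) (nat \<lfloor>2 * x\<rfloor>) \<Longrightarrow> real (card {d. d dvd m}) \<le> T"
  shows "\<bar>sigma_error \<alpha> x - voronoi_sum\<bar> \<le> real D powr \<alpha> *
     (2 + 25 * (real D / (Z * x)) + 9 * (1 + ln (real H)) + 608 * ((1 + ln (real H)) * (1 + ln (real K)))
      + 960 * (T * (1 + ln (2 * real M + 1))) + T * (2 + 6 * (1 + ln (2 * x + 1)) / Z))"
proof -
  define R where "R = (\<Sum>d=1..D. real d powr \<alpha> * saw_rem (nat \<lfloor>Z * real d\<rfloor>) (frac (x / real d)))"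
  define S1 where "S1 = (\<Sum>d=1..D. real d powr (\<alpha> - 1))"
  define S0 where "S0 = (\<Sum>d=1..D. real d powr \<alpha>)"
  define zm where "zm = Re (zeta (complex_of_real (1 - \<alpha>)))"
  define zp where "zp = Re (zeta (complex_of_real (1 + \<alpha>)))"
  have D1: "D \<ge> 1" using D_pos by simp
  have "(\<Sum>n | 0 < n \<and> real n \<le> x. divisor_sigma \<alpha> n) = (\<Sum>d=1..D. x * real d powr (\<alpha> - 1) - real d powr \<alpha> / 2
      - real d powr \<alpha> * saw_rem (nat \<lfloor>Z * real d\<rfloor>) (frac (x / real d))
      + real d powr \<alpha> * (\<Sum>h=1..nat \<lfloor>Z * real d\<rfloor>. sin (2 * pi * real h * (x / real d)) / (pi * real h)))"
    unfolding divisor_sum_eq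
  proof (rule sum.cong[OF refl])
    fix d assume "d \<in> {1..D}"
    then have d: "real d > 0" by simp
    have "real d powr \<alpha> * (x / real d) = x * real d powr (\<alpha> - 1)" using d by (simp add: powr_diff)
    then show "real d powr \<alpha> * of_int \<lfloor>x / real d\<rfloor> = x * real d powr (\<alpha> - 1) - real d powr \<alpha> / 2
      - real d powr \<alpha> * saw_rem (nat \<lfloor>Z * real d\<rfloor>) (frac (x / real d))
      + real d powr \<alpha> * (\<Sum>h=1..nat \<lfloor>Z * real d\<rfloor>. sin (2 * pi * real h * (x / real d)) / (pi * real h))"
      unfolding floor_saw_rem[of "x / real d" "nat \<lfloor>Z * real d\<rfloor>"] by (simp only: distrib_left right_diff_distrib)
  qed
  also have "\<dots> = x * S1 - S0 / 2 - R + osc_sum"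
    by (simp add: S1_def S0_def R_def osc_sum_def sum.distrib sum_subtractf sum_distrib_left sum_divide_distrib)
  finally have E: "sigma_error \<alpha> x = x * S1 - S0 / 2 - R + osc_sum - (x powr (1 + \<alpha>) / (1 + \<alpha>) * zp + x * zm)"
    by (simp add: sigma_error_def zp_def zm_def)
  have "\<bar>S1 - real D powr \<alpha> / \<alpha> - zm\<bar> \<le> real D powr (\<alpha> - 1)"
    unfolding S1_def zm_def using alpha D1 by (intro sum_powr_zeta) auto
  then have "x * \<bar>S1 - real D powr \<alpha> / \<alpha> - zm\<bar> \<le> real D * real D powr (\<alpha> - 1)"
    using x_pos D2x by (intro mult_mono) auto
  also have "\<dots> = real D powr \<alpha>" using D_pos by (simp add: powr_diff)
  finally have e1: "\<bar>x * S1 - x * real D powr \<alpha> / \<alpha> - x * zm\<bar> \<le> real D powr \<alpha>"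
    using x_pos by (simp add: abs_mult_pos' right_diff_distrib)
  have e2: "\<bar>S0 - real D powr (1 + \<alpha>) / (1 + \<alpha>)\<bar> \<le> real D powr \<alpha>"
    unfolding S0_def using alpha by (intro sum_powr_le) auto
  have e3: "\<bar>osc_sum - int_sum - voronoi_sum\<bar> \<le> real D powr \<alpha> *
    (9 * (1 + ln (real H)) + 608 * ((1 + ln (real H)) * (1 + ln (real K))) + 960 * (T * (1 + ln (2 * real M + 1))))"
    by (rule osc_sum_error[OF M K]) (use T in auto)
  have e4: "\<bar>int_sum - main_term zp\<bar> \<le> 24 * real D powr \<alpha> * (real D / (Z * x))"
    unfolding zp_def by (rule int_sum_main)
  have e5: "\<bar>R\<bar> \<le> real D powr \<alpha> * (real D / (Z * x) + T * (2 + 6 * (1 + ln (2 * x + 1)) / Z))"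
    unfolding R_def by (rule truncation_error) (use T in auto)
  have split: "sigma_error \<alpha> x - voronoi_sum = (x * S1 - x * real D powr \<alpha> / \<alpha> - x * zm) - (S0 - real D powr (1 + \<alpha>) / (1 + \<alpha>)) / 2
     + (osc_sum - int_sum - voronoi_sum) + (int_sum - main_term zp) - R"
  proof -
    have "real D powr (1 + \<alpha>) / (2 * (1 + \<alpha>)) = real D powr (1 + \<alpha>) / (1 + \<alpha>) / 2" by simp
    moreover have "p - s / 2 - r + o' - (q + z) - v = (p - a - z) - (s - d) / 2 + (o' - i - v) + (i - (d / 2 - a + q)) - r"
      for p s r o' q z v a d i :: real by (simp add: field_simps)
    ultimately show ?thesis unfolding E main_term_def by (simp only:)
  qed
  have "\<bar>sigma_error \<alpha> x - voronoi_sum\<bar> \<le> real D powr \<alpha> + real D powr \<alpha> + real D powr \<alpha> *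
    (9 * (1 + ln (real H)) + 608 * ((1 + ln (real H)) * (1 + ln (real K))) + 960 * (T * (1 + ln (2 * real M + 1))))
    + 24 * real D powr \<alpha> * (real D / (Z * x)) + real D powr \<alpha> * (real D / (Z * x) + T * (2 + 6 * (1 + ln (2 * x + 1)) / Z))"
  proof -
    have "\<bar>a - b / 2 + c + d - r\<bar> \<le> P + P + Q + W + Y"
      if "\<bar>a\<bar> \<le> P" "\<bar>b\<bar> \<le> P" "\<bar>c\<bar> \<le> Q" "\<bar>d\<bar> \<le> W" "\<bar>r\<bar> \<le> Y" for a b c d r P Q W Y :: real
      using that by linarith
    from this[OF e1 e2 e3 e4 e5]
    show "\<bar>sigma_error \<alpha> x - voronoi_sum\<bar> \<le> real D powr \<alpha> + real D powr \<alpha> + real D powr \<alpha> *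
      (9 * (1 + ln (real H)) + 608 * ((1 + ln (real H)) * (1 + ln (real K))) + 960 * (T * (1 + ln (2 * real M + 1))))
      + 24 * real D powr \<alpha> * (real D / (Z * x)) + real D powr \<alpha> * (real D / (Z * x) + T * (2 + 6 * (1 + ln (2 * x + 1)) / Z))"
      unfolding split .
  qed
  also have "\<dots> = real D powr \<alpha> *
     (2 + 25 * (real D / (Z * x)) + 9 * (1 + ln (real H)) + 608 * ((1 + ln (real H)) * (1 + ln (real K)))
      + 960 * (T * (1 + ln (2 * real M + 1))) + T * (2 + 6 * (1 + ln (2 * x + 1)) / Z))"
    by (simp add: distrib_left mult_ac)
  finally show ?thesis .
qed

end

text \<open>Each logarithm and divisor count is at most a constant times
  \<open>x powr \<delta>\<close>; at most two such factors occur together, and the hypotheses on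
  \<open>M\<close> save at least \<open>x powr (2 \<delta>)\<close> to absorb them.\<close>

lemma voronoi_error_bound:
  fixes \<alpha> \<epsilon> c C :: real
  assumes alpha: "0 < \<alpha>" "\<alpha> < 1 / 2" and eps: "0 < \<epsilon>" and cC: "0 < c" "1 \<le> C"
  shows "\<exists>A. \<forall>x M. 1 \<le> x \<longrightarrow> 1 \<le> M \<longrightarrow> c * x powr (1 / 2 + \<alpha> + \<epsilon>) \<le> real M + 1 / 2 \<longrightarrow>
      real M + 1 / 2 \<le> C * x powr (1 / (2 * \<alpha>) - \<epsilon>) \<longrightarrow>
      \<bar>sigma_error \<alpha> x - x powr (1 / 4 + \<alpha> / 2) / (sqrt 2 * pi) *
     (\<Sum>m=1..M. divisor_sigma \<alpha> m * real m powr (- (3 / 4) - \<alpha> / 2) * cos (4 * pi * sqrt (real m * x) - pi / 4))\<bar>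
      \<le> A * x powr (1 / 4 + \<alpha> / 2)"
proof -
  define B where "B = 1 / (2 * \<alpha>)"
  have B: "B > 1" using alpha by (simp add: B_def field_simps)
  \<comment> \<open>The upper bound for \<open>M\<close> saves
    \<open>\<alpha> \<epsilon> / 2 = 2 \<delta>\<close> in the exponent, and the lower bound saves
    \<open>\<epsilon> / 2\<close>, which is more.\<close>
  define \<delta> where "\<delta> = \<alpha> * \<epsilon> / 4"
  have \<delta>: "\<delta> > 0" using alpha eps by (simp add: \<delta>_def)
  \<comment> \<open>\<open>E x powr \<beta>\<close> will dominate every quantity inside a logarithm.
    The bound for \<open>K\<close> decides: it is of size \<open>P^4 x^2\<close> with
    \<open>P = C x powr B\<close>, and 2400 leaves room over \<open>48^2 = 2304\<close> for rounding
    up.\<close>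
  define \<beta> where "\<beta> = 4 * B + 2"
  have \<beta>: "\<beta> > 0" using B by (simp add: \<beta>_def)
  define E where "E = 2400 * C ^ 4"
  have E: "E \<ge> 1" using one_le_power[OF cC(2), of 4] unfolding E_def by linarith
  \<comment> \<open>With this exponent, divisor counts up to \<open>E x powr \<beta>\<close> are of
    order \<open>x powr \<delta>\<close>.\<close>
  have "\<delta> / \<beta> > 0" using \<delta> \<beta> by simp
  then obtain C\<tau> where C\<tau>: "C\<tau> > 0" "\<And>n. n > 0 \<Longrightarrow> real (card {d. d dvd n}) \<le> C\<tau> * real n powr (\<delta> / \<beta>)"
    using divisor_count_bound[of "\<delta> / \<beta>"] by blast
  define C4 where "C4 = 1 + ln E + \<beta> / \<delta>"
  define C5 where "C5 = C\<tau> * E powr (\<delta> / \<beta>)"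
  define C6 where "C6 = 127 + 9 * C4 + 608 * (C4 * C4) + 960 * (C5 * C4) + C5 * (2 + 6 * C4)"
  have C4: "C4 \<ge> 1" using E \<beta> \<delta> by (simp add: C4_def)
  have C5: "C5 > 0" using C\<tau> E by (simp add: C5_def)
  have C6: "C6 > 0" using C4 C5 by (simp add: C6_def add_pos_pos)
  define A where "A = 20 * C6 * (C powr (\<alpha> / 2) + c powr (- (1 / 2)))"
  show ?thesis
  proof (intro exI[of _ A] allI impI)
    fix x :: real and M :: nat
    assume x1: "1 \<le> x" and M1: "1 \<le> M" and nl: "c * x powr (1 / 2 + \<alpha> + \<epsilon>) \<le> real M + 1 / 2"
      and nu: "real M + 1 / 2 \<le> C * x powr (1 / (2 * \<alpha>) - \<epsilon>)"
    define n where "n = real M + 1 / 2"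
    define D where "D = nat \<lceil>2 * x + 2 * sqrt (n * x)\<rceil>"
    have n1: "n \<ge> 1" using M1 by (simp add: n_def)
    have D_ge: "2 * x + 2 * sqrt (n * x) \<le> real D" unfolding D_def by linarith
    have sq0: "0 \<le> sqrt (n * x)" using n1 x1 by simp
    interpret voronoi \<alpha> x M D
    proof
      show "2 * x \<le> real D" using D_ge sq0 by linarith
      show "2 * sqrt ((real M + 1 / 2) * x) \<le> real D" using D_ge x1 unfolding n_def by linarith
    qed (use alpha x1 in auto)
    have Nn: "N = n" by (simp add: N_def n_def)
    have Zx: "sqrt (n * x) = Z * x" using Zx_eq Nn by simp
    have D_le: "real D \<le> 3 * x + 2 * (Z * x)"
    proof -
      have "real D \<le> 2 * x + 2 * sqrt (n * x) + 1" using D_ge sq0 x1 unfolding D_def by linarith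
      then show ?thesis using x1 Zx by linarith
    qed
    have xB1: "1 \<le> x powr B" using x1 B by (intro ge_one_powr_ge_zero) auto
    have nB: "n \<le> C * x powr B"
    proof -
      have "x powr (1 / (2 * \<alpha>) - \<epsilon>) \<le> x powr B" unfolding B_def using x1 eps by (intro powr_mono) auto
      then have "C * x powr (1 / (2 * \<alpha>) - \<epsilon>) \<le> C * x powr B" using cC by (intro mult_left_mono) auto
      then show ?thesis using nu by (simp add: n_def)
    qed
    have Zn: "Z \<le> n"
    proof -
      have "n / x \<le> n / 1" using n1 x1 by (intro divide_left_mono) auto
      also have "\<dots> \<le> n * n" using n1 mult_left_mono[of 1 n n] by simp
      finally have "sqrt (n / x) \<le> sqrt (n * n)" by (rule real_sqrt_le_mono)
      then show ?thesis using n1 Nn by (simp add: Z_def)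
    qed
    define P where "P = C * x powr B"
    have P1: "P \<ge> 1" using cC xB1 mult_mono[of 1 C 1 "x powr B"] by (simp add: P_def)
    have nP: "n \<le> P" and ZP: "Z \<le> P" using nB Zn by (simp_all add: P_def)
    have xP: "1 \<le> x * P" using x1 P1 mult_mono[of 1 x 1 P] by simp
    have xxP: "x \<le> x * P" using x1 P1 mult_left_mono[of 1 P x] by simp
    have PxP: "P \<le> x * P" using x1 P1 mult_right_mono[of 1 x P] by simp
    have DP: "real D \<le> 5 * (x * P)"
    proof -
      have "Z * x \<le> x * P" using ZP x1 mult_left_mono[of Z P x] by (simp add: mult.commute)
      then show ?thesis using D_le xxP by linarith
    qed
    define V where "V = E * x powr \<beta>"
    have V_eq: "V = 2400 * (P ^ 4 * x\<^sup>2)"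
    proof -
      have "x powr \<beta> = (x powr B) ^ 4 * x\<^sup>2"
        using x1 by (simp add: \<beta>_def powr_add powr_power mult.commute)
      then show ?thesis by (simp add: V_def E_def P_def power_mult_distrib)
    qed
    have V1: "V \<ge> 1"
    proof -
      have "1 \<le> x powr \<beta>" using x1 \<beta> by (intro ge_one_powr_ge_zero) auto
      then show ?thesis using E mult_mono[of 1 E 1 "x powr \<beta>"] by (simp add: V_def)
    qed
    have xP2: "x * P * P \<le> P ^ 4 * x\<^sup>2" "1 \<le> P ^ 4 * x\<^sup>2" "x * P \<le> P ^ 4 * x\<^sup>2"
    proof -
      have a: "1 \<le> x * P * P * P" using xP P1 by (intro order_trans[OF _ mult_mono[of 1 "x * P * P" 1 P]] order_trans[OF _ mult_mono[of 1 "x * P" 1 P]]) auto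
      have "x * P * P * 1 \<le> x * P * P * (x * P * P)" 
        using xP P1 x1 mult_mono[of 1 "x * P" 1 P] by (intro mult_left_mono) auto
      also have "\<dots> = P ^ 4 * x\<^sup>2" by (simp add: power2_eq_square power4_eq_xxxx mult_ac)
      finally show 1: "x * P * P \<le> P ^ 4 * x\<^sup>2" by simp
      have "x * P * 1 \<le> x * P * P" using xP P1 by (intro mult_left_mono) auto
      then show "x * P \<le> P ^ 4 * x\<^sup>2" using 1 by simp
      then show "1 \<le> P ^ 4 * x\<^sup>2" using xP by linarith
    qed
    \<comment> \<open>Large enough for the hypothesis of the Poisson step, yet polynomial in
      \<open>x\<close> and therefore harmless inside a logarithm.\<close>
    define K where "K = nat \<lceil>(real (D + 1) * (Z + 7 * n))\<^sup>2\<rceil>"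
    have Q: "0 \<le> real (D + 1) * (Z + 7 * n)" using Z_pos n1 by simp
    have K_ge: "(real (D + 1) * (Z + 7 * n))\<^sup>2 \<le> real K" unfolding K_def by linarith
    have K1: "real (D + 1) * (Z + 7 * N) \<le> sqrt (2 * real K + 1)"
      unfolding Nn by (rule real_le_rsqrt) (use K_ge in linarith)
    have QM: "real M \<le> real (D + 1) * (Z + 7 * n)"
    proof -
      have "real M \<le> n" by (simp add: n_def)
      also have "n \<le> 1 * (Z + 7 * n)" using Z_pos n1 by simp
      also have "\<dots> \<le> real (D + 1) * (Z + 7 * n)" using Z_pos n1 by (intro mult_right_mono) auto
      finally show ?thesis .
    qed
    have KM: "M \<le> K"
    proof -
      have "1 * real M \<le> (real (D + 1) * (Z + 7 * n)) * (real (D + 1) * (Z + 7 * n))"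
        using QM M1 by (intro mult_mono) auto
      then have "real M \<le> real K" using K_ge by (simp add: power2_eq_square)
      then show ?thesis by simp
    qed
    have HV: "real H \<le> V"
    proof -
      have "real H \<le> Z * real D" by (rule H_bounds)
      also have "\<dots> \<le> P * (5 * (x * P))" using ZP DP Z_pos P1 by (intro mult_mono) auto
      also have "\<dots> = 5 * (x * P * P)" by simp
      also have "\<dots> \<le> V" using xP2 V_eq by linarith
      finally show ?thesis .
    qed
    have KV: "real K \<le> V"
    proof -
      have "real (D + 1) * (Z + 7 * n) \<le> (6 * (x * P)) * (8 * P)"
        using DP xP ZP nP Z_pos n1 by (intro mult_mono) auto
      then have "(real (D + 1) * (Z + 7 * n))\<^sup>2 \<le> (48 * (x * P * P))\<^sup>2"
        using Q by (intro power_mono) auto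
      also have "\<dots> = 2304 * (P ^ 4 * x\<^sup>2)" by (simp add: power_mult_distrib power2_eq_square power4_eq_xxxx mult_ac)
      finally have "(real (D + 1) * (Z + 7 * n))\<^sup>2 \<le> 2304 * (P ^ 4 * x\<^sup>2)" .
      moreover have "real K \<le> (real (D + 1) * (Z + 7 * n))\<^sup>2 + 1"
        unfolding K_def using zero_le_power2[of "real (D + 1) * (Z + 7 * n)"] by linarith
      ultimately show ?thesis using xP2 V_eq by linarith
    qed
    have MV: "2 * real M + 1 \<le> V" "real (max (2 * M) (nat \<lfloor>2 * x\<rfloor>)) \<le> V" "2 * x + 1 \<le> V"
    proof -
      have m: "2 * real M + 1 \<le> 2 * (x * P)" using nP PxP unfolding n_def by linarith
      then show "2 * real M + 1 \<le> V" using xP2 V_eq by linarith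
      show x: "2 * x + 1 \<le> V" using xxP xP xP2 V_eq by linarith
      have "real (nat \<lfloor>2 * x\<rfloor>) \<le> 2 * x" using x1 by linarith
      then have "real (nat \<lfloor>2 * x\<rfloor>) \<le> V" using x by linarith
      moreover have "2 * real M \<le> V" using m xP2 V_eq by linarith
      ultimately show "real (max (2 * M) (nat \<lfloor>2 * x\<rfloor>)) \<le> V" by (simp add: max_def)
    qed
    define T where "T = C\<tau> * V powr (\<delta> / \<beta>)"
    have T: "real (card {d. d dvd m}) \<le> T" if "1 \<le> m" "m \<le> max (2 * M) (nat \<lfloor>2 * x\<rfloor>)" for m
    proof -
      have "real m \<le> V" using that MV(2) of_nat_mono[OF that(2), where 'a = real] by linarith
      then have "C\<tau> * real m powr (\<delta> / \<beta>) \<le> T"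
        unfolding T_def using C\<tau> \<delta> \<beta> by (intro mult_left_mono powr_mono2) auto
      with C\<tau>(2)[of m] that show ?thesis by simp
    qed
    define u where "u = x powr \<delta>"
    have u1: "u \<ge> 1" using x1 \<delta> by (simp add: u_def ge_one_powr_ge_zero)
    have T_eq: "T = C5 * u"
      using x1 E \<beta> by (simp add: T_def C5_def V_def u_def powr_mult powr_powr)
    have L: "1 + ln v \<le> C4 * u" if "0 < v" "v \<le> V" for v
    proof -
      have "ln v \<le> ln V" using that by simp
      also have "\<dots> = ln E + \<beta> * ln x" using E x1 by (simp add: V_def ln_mult ln_powr)
      also have "\<dots> \<le> ln E + \<beta> * (x powr \<delta> / \<delta>)"
        using \<beta> \<delta> x1 by (intro add_left_mono mult_left_mono ln_powr_bound) auto
      finally have "1 + ln v \<le> (1 + ln E) * 1 + \<beta> / \<delta> * u" by (simp add: u_def)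
      also have "\<dots> \<le> (1 + ln E) * u + \<beta> / \<delta> * u"
        using E u1 by (intro add_right_mono mult_left_mono) auto
      finally show ?thesis by (simp add: C4_def algebra_simps)
    qed
    have LH: "1 + ln (real H) \<le> C4 * u" using HV H_bounds by (intro L) auto
    have LK: "1 + ln (real K) \<le> C4 * u" using KV KM M1 by (intro L) auto
    have LM: "1 + ln (2 * real M + 1) \<le> C4 * u" using MV by (intro L) auto
    have Lx: "1 + ln (2 * x + 1) \<le> C4 * u" using MV x1 by (intro L) auto
    \<comment> \<open>\<open>Z\<close> is small or large according to whether \<open>N\<close> is
      below or above \<open>x\<close>; \<open>z\<close> dominates both 1 and
      \<open>1 / Z\<close>.\<close>
    define z where "z = 1 + 1 / Z"
    have z1: "z \<ge> 1" "1 / Z \<le> z" using Z_pos by (simp_all add: z_def)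
    have uu: "1 \<le> u * u" "u \<le> u * u" using u1 mult_mono[of 1 u 1 u] mult_left_mono[of 1 u u] by simp_all
    have zu: "w \<le> w * z" if "w \<ge> 0" for w using z1 mult_left_mono[of 1 z w] that by simp
    have C4u: "0 \<le> C4 * u" "0 \<le> C5 * u" using C4 C5 u1 by auto
    have br: "2 + 25 * (real D / (Z * x)) + 9 * (1 + ln (real H)) + 608 * ((1 + ln (real H)) * (1 + ln (real K)))
      + 960 * (T * (1 + ln (2 * real M + 1))) + T * (2 + 6 * (1 + ln (2 * x + 1)) / Z) \<le> C6 * (u * u * z)"
    proof -
      define w where "w = u * u * z"
      have uuw: "u * u \<le> w" unfolding w_def using zu[of "u * u"] u1 by simp
      then have w1: "1 \<le> w" "u \<le> w" using uu by linarith+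
      have zw: "z \<le> w" unfolding w_def using uu z1 mult_right_mono[of 1 "u * u" z] by simp
      have "real D / (Z * x) \<le> (3 * x + 2 * (Z * x)) / (Z * x)"
        using D_le Z_pos x_pos by (intro divide_right_mono) auto
      also have "\<dots> = 3 * (1 / Z) + 2" using Z_pos x_pos by (simp add: field_simps)
      also have "\<dots> \<le> 5 * w" using z1 zw by linarith
      finally have b1: "25 * (real D / (Z * x)) \<le> 125 * w" by simp
      have "C4 * u \<le> C4 * w" using C4 w1 by (intro mult_left_mono) auto
      then have b2: "1 + ln (real H) \<le> C4 * w" using LH by (rule order_trans[rotated])
      have "(1 + ln (real H)) * (1 + ln (real K)) \<le> (C4 * u) * (C4 * u)"
        using LH LK H_bounds KM M1 C4u by (intro mult_mono) (auto intro!: add_nonneg_nonneg ln_ge_zero)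
      also have "\<dots> = C4 * C4 * (u * u)" by simp
      also have "\<dots> \<le> C4 * C4 * w" using C4 uuw by (intro mult_left_mono) auto
      finally have b3: "(1 + ln (real H)) * (1 + ln (real K)) \<le> C4 * C4 * w" .
      have "T * (1 + ln (2 * real M + 1)) \<le> (C5 * u) * (C4 * u)"
        unfolding T_eq using LM C4u by (intro mult_left_mono) auto
      also have "\<dots> = C5 * C4 * (u * u)" by simp
      also have "\<dots> \<le> C5 * C4 * w" using C4 C5 uuw by (intro mult_left_mono) auto
      finally have b4: "T * (1 + ln (2 * real M + 1)) \<le> C5 * C4 * w" .
      have "6 * (1 + ln (2 * x + 1)) / Z = 6 * (1 + ln (2 * x + 1)) * (1 / Z)" by simp
      also have "\<dots> \<le> 6 * (C4 * u) * z" using Lx z1 C4u Z_pos x1 ln_ge_zero[of "2 * x + 1"] by (intro mult_mono) auto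
      finally have "2 + 6 * (1 + ln (2 * x + 1)) / Z \<le> 2 * (u * z) + 6 * (C4 * u) * z"
        using u1 z1 mult_mono[of 1 u 1 z] by linarith
      then have "T * (2 + 6 * (1 + ln (2 * x + 1)) / Z) \<le> (C5 * u) * (2 * (u * z) + 6 * (C4 * u) * z)"
        unfolding T_eq using C4u by (intro mult_left_mono) auto
      also have "\<dots> = C5 * (2 + 6 * C4) * w" by (simp add: w_def algebra_simps)
      finally have b5: "T * (2 + 6 * (1 + ln (2 * x + 1)) / Z) \<le> C5 * (2 + 6 * C4) * w" .
      have "C6 * w = 127 * w + 9 * (C4 * w) + 608 * (C4 * C4 * w) + 960 * (C5 * C4 * w) + C5 * (2 + 6 * C4) * w"
        by (simp add: C6_def algebra_simps)
      moreover have "2 + p + 9 * a + 608 * b + 960 * c + d \<le> 127 * w + 9 * a' + 608 * b' + 960 * c' + d'"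
        if "p \<le> 125 * w" "a \<le> a'" "b \<le> b'" "c \<le> c'" "d \<le> d'" for p a b c d a' b' c' d' :: real
        using that w1(1) by linarith
      note this[OF b1 b2 b3 b4 b5]
      ultimately show ?thesis unfolding w_def by (simp only:)
    qed
    have "\<bar>sigma_error \<alpha> x - voronoi_sum\<bar> \<le> real D powr \<alpha> * (C6 * (u * u * z))"
      by (rule order_trans[OF voronoi_truncated[OF M1 K1 KM T] mult_left_mono[OF br]]) auto
    also have "\<dots> = C6 * (u * u) * (real D powr \<alpha> * z)" by simp
    also have "real D powr \<alpha> * z \<le> 20 * (x powr \<alpha> * (Z powr \<alpha> + 1 / Z))"
    proof -
      \<comment> \<open>Separating \<open>Z >= 1\<close> from \<open>Z < 1\<close> leaves
        \<open>(x Z) powr \<alpha>\<close> and \<open>x powr \<alpha> / Z\<close>, the two errors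
        that the hypotheses on \<open>M\<close> control.\<close>
      define y where "y = max 1 Z"
      have y: "y \<ge> 1" by (simp add: y_def)
      have "real D \<le> 5 * (x * y)"
      proof -
        have "Z * x \<le> y * x" "1 * x \<le> y * x" using x_pos by (intro mult_right_mono; simp add: y_def)+
        then show ?thesis using D_le by (simp add: mult.commute)
      qed
      then have "real D powr \<alpha> \<le> (5 * (x * y)) powr \<alpha>" using alpha by (intro powr_mono2) auto
      also have "\<dots> = 5 powr \<alpha> * (x powr \<alpha> * y powr \<alpha>)" using x_pos y by (simp add: powr_mult)
      also have "\<dots> \<le> 5 * (x powr \<alpha> * y powr \<alpha>)"
      proof (rule mult_right_mono)
        have "(5::real) powr \<alpha> \<le> 5 powr 1" using alpha by (intro powr_mono) auto
        then show "(5::real) powr \<alpha> \<le> 5" by simp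
      qed auto
      finally have "real D powr \<alpha> * z \<le> 5 * (x powr \<alpha> * y powr \<alpha>) * z" using z1 by (intro mult_right_mono) auto
      also have "\<dots> = 5 * (x powr \<alpha> * (y powr \<alpha> * z))" by simp
      finally have D_yz: "real D powr \<alpha> * z \<le> 5 * (x powr \<alpha> * (y powr \<alpha> * z))" .
      have "y powr \<alpha> * z \<le> 4 * (Z powr \<alpha> + 1 / Z)"
      proof -
        have r: "0 \<le> Z powr \<alpha>" "0 \<le> 1 / Z" using Z_pos by simp_all
        have bound: "v \<le> 4 * (p + q)" if "0 \<le> p" "0 \<le> q" "v \<le> p * 2 \<or> v \<le> 2 * q" for v p q :: real
          using that unfolding distrib_left by linarith
        show ?thesis
        proof (cases "Z \<ge> 1")
          case True
          then have "z \<le> 2" by (simp add: z_def)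
          then have "y powr \<alpha> * z \<le> y powr \<alpha> * 2" by (rule mult_left_mono) simp
          moreover have "y = Z" using True by (simp add: y_def)
          ultimately have "y powr \<alpha> * z \<le> Z powr \<alpha> * 2" by simp
          then show ?thesis using bound[OF r] by blast
        next
          case False
          then have "1 \<le> 1 / Z" using Z_pos by simp
          then have "z \<le> 2 * (1 / Z)" unfolding z_def by linarith
          moreover have "y powr \<alpha> = 1" using False by (simp add: y_def)
          ultimately have "y powr \<alpha> * z \<le> 2 * (1 / Z)" by simp
          then show ?thesis using bound[OF r] by blast
        qed
      qed
      then have "5 * (x powr \<alpha> * (y powr \<alpha> * z)) \<le> 5 * (x powr \<alpha> * (4 * (Z powr \<alpha> + 1 / Z)))"
        by (intro mult_left_mono) auto
      with D_yz have "real D powr \<alpha> * z \<le> 5 * (x powr \<alpha> * (4 * (Z powr \<alpha> + 1 / Z)))" by (rule order_trans)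
      moreover have "5 * (p * (4 * s)) = 20 * (p * s)" for p s :: real by simp
      ultimately show ?thesis by (simp only:)
    qed
    also have "x powr \<alpha> * (Z powr \<alpha> + 1 / Z) \<le> (C powr (\<alpha> / 2) + c powr (- (1 / 2))) * x powr (1 / 4 + \<alpha> / 2 - 2 * \<delta>)"
    proof -
      have "x powr \<alpha> * Z powr \<alpha> = (Z * x) powr \<alpha>" using x_pos Z_pos by (simp add: powr_mult mult.commute)
      also have "Z * x = (n * x) powr (1 / 2)" using Zx n1 x1 by (simp add: powr_half_sqrt)
      also have "((n * x) powr (1 / 2)) powr \<alpha> = (n * x) powr (\<alpha> / 2)" by (simp add: powr_powr)
      \<comment> \<open>The upper bound for \<open>M\<close> enters here, and the lower bound in the
        estimate of \<open>1 / Z\<close> below.\<close>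
      also have "\<dots> \<le> (C * x powr (B - \<epsilon>) * x) powr (\<alpha> / 2)"
        using nu n1 x1 alpha by (intro powr_mono2 mult_right_mono) (auto simp: n_def B_def)
      also have "\<dots> = C powr (\<alpha> / 2) * x powr ((B - \<epsilon>) * (\<alpha> / 2) + \<alpha> / 2)"
        using cC x1 by (simp add: powr_mult powr_powr powr_add)
      also have "(B - \<epsilon>) * (\<alpha> / 2) + \<alpha> / 2 = 1 / 4 + \<alpha> / 2 - 2 * \<delta>"
        using alpha by (simp add: B_def \<delta>_def field_simps)
      finally have p1: "x powr \<alpha> * Z powr \<alpha> \<le> C powr (\<alpha> / 2) * x powr (1 / 4 + \<alpha> / 2 - 2 * \<delta>)" .
      have "1 / Z = (x / n) powr (1 / 2)"
        using n1 x1 by (simp add: Z_def Nn powr_half_sqrt real_sqrt_divide)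
      also have "\<dots> \<le> (x / (c * x powr (1 / 2 + \<alpha> + \<epsilon>))) powr (1 / 2)"
        using nl n1 x1 cC by (intro powr_mono2 divide_left_mono) (auto simp: n_def)
      also have "x / (c * x powr (1 / 2 + \<alpha> + \<epsilon>)) = (1 / c) * x powr (1 / 2 - \<alpha> - \<epsilon>)"
      proof -
        have "x powr (1 / 2 - \<alpha> - \<epsilon>) * x powr (1 / 2 + \<alpha> + \<epsilon>) = x powr 1"
          unfolding powr_add[symmetric] by (rule arg_cong[where f = "\<lambda>t. x powr t"]) simp
        then have "x / (c * x powr (1 / 2 + \<alpha> + \<epsilon>)) =
          (x powr (1 / 2 - \<alpha> - \<epsilon>) * x powr (1 / 2 + \<alpha> + \<epsilon>)) / (c * x powr (1 / 2 + \<alpha> + \<epsilon>))"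
          using x1 by simp
        then show ?thesis using x1 by simp
      qed
      also have "((1 / c) * x powr (1 / 2 - \<alpha> - \<epsilon>)) powr (1 / 2) = c powr (- (1 / 2)) * x powr (1 / 4 - \<alpha> / 2 - \<epsilon> / 2)"
      proof -
        have "((1 / c) * x powr (1 / 2 - \<alpha> - \<epsilon>)) powr (1 / 2) = (1 / c) powr (1 / 2) * x powr ((1 / 2 - \<alpha> - \<epsilon>) * (1 / 2))"
          using cC by (simp only: powr_mult powr_powr)
        also have "(1 / c) powr (1 / 2) = c powr (- (1 / 2))"
          using cC by (simp add: powr_divide powr_minus_divide)
        also have "(1 / 2 - \<alpha> - \<epsilon>) * (1 / 2) = 1 / 4 - \<alpha> / 2 - \<epsilon> / 2" by simp
        finally show ?thesis .
      qed
      finally have "x powr \<alpha> * (1 / Z) \<le> x powr \<alpha> * (c powr (- (1 / 2)) * x powr (1 / 4 - \<alpha> / 2 - \<epsilon> / 2))"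
        by (intro mult_left_mono) auto
      also have "\<dots> = c powr (- (1 / 2)) * x powr (\<alpha> + (1 / 4 - \<alpha> / 2 - \<epsilon> / 2))" unfolding powr_add by simp
      also have "\<dots> \<le> c powr (- (1 / 2)) * x powr (1 / 4 + \<alpha> / 2 - 2 * \<delta>)"
      proof (intro mult_left_mono powr_mono)
        have "2 * \<delta> \<le> \<epsilon> / 2" using alpha eps mult_right_mono[of \<alpha> 1 \<epsilon>] by (simp add: \<delta>_def)
        then show "\<alpha> + (1 / 4 - \<alpha> / 2 - \<epsilon> / 2) \<le> 1 / 4 + \<alpha> / 2 - 2 * \<delta>" by simp
      qed (use x1 in auto)
      finally show ?thesis using p1 by (simp add: distrib_left distrib_right)
    qed
    finally have "\<bar>sigma_error \<alpha> x - voronoi_sum\<bar> \<le> C6 * (u * u) * (20 * ((C powr (\<alpha> / 2) + c powr (- (1 / 2))) * x powr (1 / 4 + \<alpha> / 2 - 2 * \<delta>)))"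
      using C6 u1 by (simp add: mult_left_mono)
    also have "\<dots> = A * (u * u * x powr (1 / 4 + \<alpha> / 2 - 2 * \<delta>))" by (simp add: A_def)
    also have "u * u * x powr (1 / 4 + \<alpha> / 2 - 2 * \<delta>) = x powr (1 / 4 + \<alpha> / 2)"
      unfolding u_def powr_add[symmetric] by simp
    finally show "\<bar>sigma_error \<alpha> x - x powr (1 / 4 + \<alpha> / 2) / (sqrt 2 * pi) *
     (\<Sum>m=1..M. divisor_sigma \<alpha> m * real m powr (- (3 / 4) - \<alpha> / 2) * cos (4 * pi * sqrt (real m * x) - pi / 4))\<bar>
      \<le> A * x powr (1 / 4 + \<alpha> / 2)"
      by (simp only: voronoi_sum_def)
  qed
qed

text \<open>The sum sees only the integer part \<open>M\<close> of \<open>N x\<close>, so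
  \<open>N x\<close> may be replaced by \<open>M + 1/2\<close>; once \<open>N x >= 1\<close> this
  changes it by at most a factor 2.\<close>

theorem theorem2:
  fixes \<alpha> \<epsilon> :: real and N :: "real \<Rightarrow> real"
  assumes "0 < \<alpha>" and "\<alpha> < 1 / 2" and "0 < \<epsilon>"
    and "\<forall>\<^sub>F x in at_top. 0 \<le> N x"
    and "(\<lambda>x. x powr (1 / 2 + \<alpha> + \<epsilon>)) \<in> O[at_top](N)"
    and "N \<in> O[at_top](\<lambda>x. x powr (1 / (2 * \<alpha>) - \<epsilon>))"
  shows "(\<lambda>x. sigma_error \<alpha> x
              - x powr (1 / 4 + \<alpha> / 2) / (sqrt 2 * pi)
                * (\<Sum>m | 0 < m \<and> real m \<le> N x.
                     divisor_sigma \<alpha> m * real m powr (- (3 / 4) - \<alpha> / 2)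
                     * cos (4 * pi * sqrt (real m * x) - pi / 4)))
         \<in> O[at_top](\<lambda>x. x powr (1 / 4 + \<alpha> / 2))"
proof -
  obtain a where a: "a > 0" "\<forall>\<^sub>F x in at_top. norm (x powr (1 / 2 + \<alpha> + \<epsilon>)) \<le> a * norm (N x)"
    using landau_o.bigE[OF assms(5)] by metis
  obtain b where b: "b > 0" "\<forall>\<^sub>F x in at_top. norm (N x) \<le> b * norm (x powr (1 / (2 * \<alpha>) - \<epsilon>))"
    using landau_o.bigE[OF assms(6)] by metis
  \<comment> \<open>The factors 2 in \<open>c\<close> and \<open>C\<close> pay for passing from
    \<open>N x\<close> to \<open>M + 1/2\<close>.\<close>
  define c where "c = 1 / (2 * a)"
  define C where "C = max 1 (2 * b)"
  have cC: "0 < c" "1 \<le> C" using a by (simp_all add: c_def C_def)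
  from voronoi_error_bound[OF assms(1-3) cC] obtain A where A: "\<forall>x M. 1 \<le> x \<longrightarrow> 1 \<le> M \<longrightarrow> c * x powr (1 / 2 + \<alpha> + \<epsilon>) \<le> real M + 1 / 2 \<longrightarrow>
      real M + 1 / 2 \<le> C * x powr (1 / (2 * \<alpha>) - \<epsilon>) \<longrightarrow>
      \<bar>sigma_error \<alpha> x - x powr (1 / 4 + \<alpha> / 2) / (sqrt 2 * pi) *
     (\<Sum>m=1..M. divisor_sigma \<alpha> m * real m powr (- (3 / 4) - \<alpha> / 2) * cos (4 * pi * sqrt (real m * x) - pi / 4))\<bar>
      \<le> A * x powr (1 / 4 + \<alpha> / 2)" ..
  have "filterlim (\<lambda>x::real. x powr (1 / 2 + \<alpha> + \<epsilon>)) at_top at_top"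
    using assms(1,3) by real_asymp
  \<comment> \<open>Together with the lower bound on \<open>N\<close> this forces
    \<open>N x >= 1\<close>, hence \<open>M >= 1\<close>.\<close>
  then have big: "\<forall>\<^sub>F x::real in at_top. a \<le> x powr (1 / 2 + \<alpha> + \<epsilon>)"
    by (simp add: filterlim_at_top)
  show ?thesis
  proof (rule landau_o.bigI)
    show "\<forall>\<^sub>F x in at_top. norm (sigma_error \<alpha> x
              - x powr (1 / 4 + \<alpha> / 2) / (sqrt 2 * pi)
                * (\<Sum>m | 0 < m \<and> real m \<le> N x.
                     divisor_sigma \<alpha> m * real m powr (- (3 / 4) - \<alpha> / 2)
                     * cos (4 * pi * sqrt (real m * x) - pi / 4))) \<le> max A 1 * norm (x powr (1 / 4 + \<alpha> / 2))"
      using assms(4) a(2) b(2) big eventually_ge_at_top[of 1]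
    proof eventually_elim
      case (elim x)
      define M where "M = nat \<lfloor>N x\<rfloor>"
      have lo: "x powr (1 / 2 + \<alpha> + \<epsilon>) \<le> a * N x" and hi: "N x \<le> b * x powr (1 / (2 * \<alpha>) - \<epsilon>)"
        using elim by simp_all
      have "a * 1 \<le> a * N x" using lo elim by linarith
      then have N1: "1 \<le> N x" using a(1) by (simp only: mult_le_cancel_left_pos)
      have M1: "1 \<le> M" "real M \<le> N x" "N x < real M + 1" using N1 unfolding M_def by linarith+
      have set_eq: "{m. 0 < m \<and> real m \<le> N x} = {1..M}"
        using N1 unfolding M_def by (auto simp: le_nat_iff le_floor_iff)
      have l2: "c * x powr (1 / 2 + \<alpha> + \<epsilon>) \<le> real M + 1 / 2"
      proof -
        have "c * x powr (1 / 2 + \<alpha> + \<epsilon>) \<le> c * (a * N x)" using lo cC by (intro mult_left_mono) auto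
        also have "\<dots> = N x / 2" using a by (simp add: c_def)
        also have "\<dots> \<le> real M + 1 / 2" using M1 by linarith
        finally show ?thesis .
      qed
      have u2: "real M + 1 / 2 \<le> C * x powr (1 / (2 * \<alpha>) - \<epsilon>)"
      proof -
        have "real M + 1 / 2 \<le> 2 * N x" using M1 N1 by linarith
        also have "\<dots> \<le> (2 * b) * x powr (1 / (2 * \<alpha>) - \<epsilon>)" using hi by simp
        also have "\<dots> \<le> C * x powr (1 / (2 * \<alpha>) - \<epsilon>)" by (intro mult_right_mono) (auto simp: C_def)
        finally show ?thesis .
      qed
      have "A * x powr (1 / 4 + \<alpha> / 2) \<le> max A 1 * norm (x powr (1 / 4 + \<alpha> / 2))" by (simp add: mult_right_mono)
      with A[rule_format, OF elim(5) M1(1) l2 u2] show ?case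
        unfolding set_eq real_norm_def by (rule order_trans)
    qed
  qed simp
qed

end
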